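(* Let $k$ be an algebraically closed field of characteristic $0$, $R=k[x,y]$, $\mathfrak m=(x,y)$, and let $L=(x^d,x^{d-1}y^{a_1},\dots,xy^{a_{d-1}},y^{a_d})$ with $0=a_0<a_1<\dots<a_d$ and $a_d>d$ be a lex-segment ideal. Let $P=k[y,z]$ and let $T(L)\subseteq P$ be the ideal generated by $z^{d-i}y^{a_i-i}$ for $i=0,\dots,d$. Then $\operatorname{depth}\operatorname{gr}_L(R)=\operatorname{depth}\operatorname{gr}_{T(L)}(P)$.
   Context: $T(L)$ is obtained from $L$ by substituting $x=yz$ in each generator $x^{d-i}y^{a_i}$ and dividing by $y^d$; it corresponds to the transform of $L$ in $R[\mathfrak m/y]\cong P$. $\operatorname{gr}_J(A)=\bigoplus_{n\ge0}J^n/J^{n+1}$. *)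

theory Defs
  imports "HOL-Computational_Algebra.Polynomial" "HOL-Library.Extended_Nat"
begin

definition ideal_gen_in :: "'r::comm_ring_1 set \<Rightarrow> 'r set \<Rightarrow> 'r set" where
  "ideal_gen_in A S = {(\<Sum>i<n. c i * s i) | (n::nat) c s. \<forall>i<n. c i \<in> A \<and> s i \<in> S}"

abbreviation ideal_gen :: "'r::comm_ring_1 set \<Rightarrow> 'r set" where
  "ideal_gen S \<equiv> ideal_gen_in UNIV S"

fun ideal_pow :: "'r::comm_ring_1 set \<Rightarrow> nat \<Rightarrow> 'r set" where
  "ideal_pow I 0 = UNIV"
| "ideal_pow I (Suc n) = ideal_gen {a * b | a b. a \<in> ideal_pow I n \<and> b \<in> I}"

definition rees :: "'r::comm_ring_1 set \<Rightarrow> 'r poly set" where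
  "rees I = {F. \<forall>n. coeff F n \<in> ideal_pow I n}"

text \<open>The associated graded ring gr_I(R) is rees I / (I * rees I).
  This is the ideal I * rees I of the Rees algebra.\<close>
definition gr_kernel :: "'r::comm_ring_1 set \<Rightarrow> 'r poly set" where
  "gr_kernel I = ideal_gen_in (rees I) {[:c:] | c. c \<in> I}"

text \<open>Preimage in rees I of the homogeneous maximal ideal of gr_I(R), given the
  maximal ideal m of R (containing I): generated by m and I t.\<close>
definition gr_max :: "'r::comm_ring_1 set \<Rightarrow> 'r set \<Rightarrow> 'r poly set" where
  "gr_max m I = ideal_gen_in (rees I) ({[:c:] | c. c \<in> m} \<union> {monom c 1 | c. c \<in> I})"

text \<open>fs is a gr_I(R)-regular sequence contained in the homogeneous maximal ideal
  (elements represented by preimages in the Rees algebra).\<close>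
definition gr_regular_seq :: "'r::comm_ring_1 set \<Rightarrow> 'r set \<Rightarrow> 'r poly list \<Rightarrow> bool" where
  "gr_regular_seq m I fs \<longleftrightarrow>
     set fs \<subseteq> gr_max m I \<and>
     (\<forall>i<length fs.
        let J = gr_kernel I \<union> ideal_gen_in (rees I) (set (take i fs));
            J' = ideal_gen_in (rees I) (J)
        in \<forall>g\<in>rees I. fs ! i * g \<in> J' \<longrightarrow> g \<in> J') \<and>
     1 \<notin> ideal_gen_in (rees I) (gr_kernel I \<union> set fs)"

definition depth_gr :: "'r::comm_ring_1 set \<Rightarrow> 'r set \<Rightarrow> enat" where
  "depth_gr m I = Sup {enat (length fs) | fs. gr_regular_seq m I fs}"

definition var_out :: "'k::comm_ring_1 poly poly" where
  "var_out = monom 1 1"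
definition var_in :: "'k::comm_ring_1 poly poly" where
  "var_in = [:[:0, 1:]:]"

end

(* For a monomial ideal I generated by the x^(d-k) y^(b k), two homogeneous elements f1, f2 of degree 1
   of gr_I(R) form a system of parameters: the sums, over the vertices of the Newton polygon of even
   and of odd rank, of the corresponding generators F1 and F2, with J = (F1, F2). A Koszul argument
   shows that depth 2 is equivalent to f1, f2 being a regular sequence, and the Briancon-Skoda
   theorem (I^2 <= J locally), which is elementary for monomials, turns this into the reduction
   condition I^2 <= J I + I^3. Positive depth is equivalent to I^(n+1) : I = I^n for all n. Both
   conditions pass between L and T(L) under the substitution x = yz, because L^n consists of the
   elements of y^(nd) T(L)^n that are polynomials in x and y, and because F1 is monic in x. *)
theory Submission
  imports Defs
begin

section \<open>Ideals and regular sequences in a subring\<close>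

text \<open>The ring is not local, and (F1, F2) may have zeros away from the origin, so the
  reduction condition does not yield I^2 = J I. Local reasoning is replaced by an element e with 1 -
  e \<in> I that carries I^(n+2) into J I^(n+1) for all n; it acts as the identity on I^n modulo
  I^(n+1) and can be cancelled there. The elements x^d and y^(b d) alone are parameters only if the
  Newton polygon has a single edge, which is why all vertices enter; the alternating sums are
  explicit, and the shear that takes one staircase to the other preserves vertices and ranks, so
  they correspond up to y^d. The two directions of the comparison are of unequal difficulty: from L
  to T(L) an equation is substituted and divided by a power of y, while on the way back the
  cofactors need bounded z-degree before they come from polynomials in x and y. The associated
  graded ring is handled as the Rees algebra modulo an ideal, and socle elements take the place of
  dimension theory, also in excluding regular sequences of length three.\<close>

locale csubring =
  fixes A :: "'c::comm_ring_1 set"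
  assumes one_closed [simp]: "1 \<in> A"
    and add_closed [simp]: "x \<in> A \<Longrightarrow> y \<in> A \<Longrightarrow> x + y \<in> A"
    and mult_closed [simp]: "x \<in> A \<Longrightarrow> y \<in> A \<Longrightarrow> x * y \<in> A"
    and uminus_closed [simp]: "x \<in> A \<Longrightarrow> - x \<in> A"
begin

lemma zero_closed [simp]: "0 \<in> A"
  using add_closed[of 1 "-1"] by simp

lemma diff_closed [simp]: "x \<in> A \<Longrightarrow> y \<in> A \<Longrightarrow> x - y \<in> A"
  using add_closed[of x "-y"] by simp

lemma power_closed [simp]: "x \<in> A \<Longrightarrow> x ^ n \<in> A"
  by (induction n) auto

definition idl :: "'c set \<Rightarrow> bool" where
  "idl Q \<longleftrightarrow> Q \<subseteq> A \<and> 0 \<in> Q \<and> (\<forall>x\<in>Q. \<forall>y\<in>Q. x + y \<in> Q) \<and> (\<forall>a\<in>A. \<forall>x\<in>Q. a * x \<in> Q)"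

text \<open>Regularity of f on A modulo Q, expressed inside A so that no quotient ring has to be
  formed.\<close>

definition nzd :: "'c set \<Rightarrow> 'c \<Rightarrow> bool" where
  "nzd Q f \<longleftrightarrow> (\<forall>g\<in>A. f * g \<in> Q \<longrightarrow> g \<in> Q)"

definition adjoin :: "'c set \<Rightarrow> 'c \<Rightarrow> 'c set" where
  "adjoin Q f = {x + a * f | x a. x \<in> Q \<and> a \<in> A}"

lemma idl_sub: "idl Q \<Longrightarrow> x \<in> Q \<Longrightarrow> x \<in> A"
  and idl_zero: "idl Q \<Longrightarrow> 0 \<in> Q"
  and idl_add: "idl Q \<Longrightarrow> x \<in> Q \<Longrightarrow> y \<in> Q \<Longrightarrow> x + y \<in> Q"
  and idl_mult: "idl Q \<Longrightarrow> a \<in> A \<Longrightarrow> x \<in> Q \<Longrightarrow> a * x \<in> Q"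
  by (auto simp: idl_def)

lemma idl_mult2: "idl Q \<Longrightarrow> a \<in> A \<Longrightarrow> x \<in> Q \<Longrightarrow> x * a \<in> Q"
  by (subst mult.commute) (rule idl_mult)

lemma idl_uminus: "idl Q \<Longrightarrow> x \<in> Q \<Longrightarrow> - x \<in> Q"
  using idl_mult[of Q "-1" x] by simp

lemma idl_diff: "idl Q \<Longrightarrow> x \<in> Q \<Longrightarrow> y \<in> Q \<Longrightarrow> x - y \<in> Q"
  using idl_add[of Q x "-y"] idl_uminus[of Q y] by simp

lemma idl_sum: "idl Q \<Longrightarrow> (\<And>i. i \<in> I \<Longrightarrow> f i \<in> Q) \<Longrightarrow> sum f I \<in> Q"
  by (induction I rule: infinite_finite_induct) (auto intro: idl_zero idl_add)

lemmas idl_intros = idl_add idl_diff idl_uminus idl_mult idl_mult2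

lemma adjoinI: "idl Q \<Longrightarrow> a \<in> A \<Longrightarrow> x - a * f \<in> Q \<Longrightarrow> x \<in> adjoin Q f"
  unfolding adjoin_def by (rule CollectI, rule exI[of _ "x - a * f"], rule exI[of _ a]) simp

lemma adjoin_idl:
  assumes "idl Q" "f \<in> A" shows "idl (adjoin Q f)"
  unfolding idl_def
proof (intro conjI ballI)
  show "adjoin Q f \<subseteq> A" using assms by (auto simp: adjoin_def idl_def)
  show "0 \<in> adjoin Q f" unfolding adjoin_def
    by (rule CollectI, rule exI[of _ 0], rule exI[of _ 0]) (simp add: idl_zero[OF assms(1)])
next
  fix x y assume "x \<in> adjoin Q f" "y \<in> adjoin Q f"
  then obtain x1 a y1 b where *: "x = x1 + a * f" "y = y1 + b * f" "x1 \<in> Q" "y1 \<in> Q" "a \<in> A" "b \<in> A"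
    by (auto simp: adjoin_def)
  have "x + y - (a + b) * f = x1 + y1" by (simp add: * algebra_simps)
  then show "x + y \<in> adjoin Q f"
    using idl_add[OF assms(1) *(3,4)] by (intro adjoinI[OF assms(1) add_closed[OF *(5,6)]]) simp
next
  fix c x assume "c \<in> A" "x \<in> adjoin Q f"
  then obtain x1 a where *: "x = x1 + a * f" "x1 \<in> Q" "a \<in> A" by (auto simp: adjoin_def)
  have "c * x - (c * a) * f = c * x1" by (simp add: * algebra_simps)
  then show "c * x \<in> adjoin Q f"
    using idl_mult[OF assms(1) \<open>c \<in> A\<close> *(2)]
      by (intro adjoinI[OF assms(1) mult_closed[OF \<open>c \<in> A\<close> *(3)]]) simp
qed

lemma adjoin_sub: "Q \<subseteq> adjoin Q f"
  unfolding adjoin_def by (rule subsetI, rule CollectI, rule exI, rule exI[of _ 0]) simp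

lemma adjoin_gen: "idl Q \<Longrightarrow> f \<in> adjoin Q f"
  unfolding adjoin_def by (rule CollectI, rule exI[of _ 0], rule exI[of _ 1]) (simp add: idl_zero)

lemma adjoin_least: "idl P \<Longrightarrow> Q \<subseteq> P \<Longrightarrow> f \<in> P \<Longrightarrow> adjoin Q f \<subseteq> P"
  unfolding adjoin_def by (auto intro!: idl_add idl_mult)

lemma adjoinE:
  assumes "x \<in> adjoin Q f" obtains a where "a \<in> A" "x - a * f \<in> Q"
  using assms unfolding adjoin_def by auto

lemma sum_closed [simp]: "(\<And>i. i \<in> I \<Longrightarrow> f i \<in> A) \<Longrightarrow> sum f I \<in> A"
  by (induction I rule: infinite_finite_induct) auto

lemma gen_idl:
  assumes "S \<subseteq> A" shows "idl (ideal_gen_in A S)"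
  unfolding idl_def
proof (intro conjI ballI)
  show "ideal_gen_in A S \<subseteq> A"
    using assms unfolding ideal_gen_in_def by (auto intro!: sum_closed mult_closed)
  show "0 \<in> ideal_gen_in A S" unfolding ideal_gen_in_def
    by (auto intro!: exI[of _ "0::nat"])
next
  fix x y assume "x \<in> ideal_gen_in A S" "y \<in> ideal_gen_in A S"
  then obtain n c s m c' s' where
    x: "x = (\<Sum>i<(n::nat). c i * s i)" and cs: "\<forall>i<n. c i \<in> A \<and> s i \<in> S" and
    y: "y = (\<Sum>i<(m::nat). c' i * s' i)" and cs': "\<forall>i<m. c' i \<in> A \<and> s' i \<in> S"
    unfolding ideal_gen_in_def by blast
  let ?c = "\<lambda>i. if i < n then c i else c' (i - n)" and ?s = "\<lambda>i. if i < n then s i else s' (i - n)"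
  have "(\<Sum>i<n+m. ?c i * ?s i) = (\<Sum>i<n. ?c i * ?s i) + (\<Sum>i=n..<n+m. ?c i * ?s i)"
    using sum.atLeastLessThan_concat[of 0 n "n + m" "\<lambda>i. ?c i * ?s i"] by (simp only: lessThan_atLeast0)
  also have "(\<Sum>i=n..<n+m. ?c i * ?s i) = y"
    using sum.shift_bounds_nat_ivl[of "\<lambda>i. ?c i * ?s i" 0 n m]
    by (simp add: y lessThan_atLeast0 add.commute)
  also have "(\<Sum>i<n. ?c i * ?s i) = x" by (simp add: x)
  finally have "x + y = (\<Sum>i<n+m. ?c i * ?s i)" by simp
  moreover have "\<forall>i<n+m. ?c i \<in> A \<and> ?s i \<in> S" using cs cs' by auto
  ultimately show "x + y \<in> ideal_gen_in A S" unfolding ideal_gen_in_def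
    by (intro CollectI exI[of _ "n + m"] exI[of _ ?c] exI[of _ ?s] conjI)
next
  fix a x assume a: "a \<in> A" and "x \<in> ideal_gen_in A S"
  then obtain n c s where
    x: "x = (\<Sum>i<(n::nat). c i * s i)" and cs: "\<forall>i<n. c i \<in> A \<and> s i \<in> S"
    unfolding ideal_gen_in_def by blast
  have "a * x = (\<Sum>i<n. (a * c i) * s i)" by (simp add: x sum_distrib_left mult.assoc)
  then show "a * x \<in> ideal_gen_in A S" unfolding ideal_gen_in_def using a cs
    by (intro CollectI exI[of _ n] exI[of _ "\<lambda>i. a * c i"] exI[of _ s]) auto
qed

lemma gen_sub: "S \<subseteq> ideal_gen_in A S"
proof
  fix x assume "x \<in> S"
  then show "x \<in> ideal_gen_in A S" unfolding ideal_gen_in_def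
    by (intro CollectI exI[of _ "1::nat"] exI[of _ "\<lambda>i. 1"] exI[of _ "\<lambda>i. x"]) simp
qed

lemma gen_least: "idl P \<Longrightarrow> S \<subseteq> P \<Longrightarrow> ideal_gen_in A S \<subseteq> P"
  unfolding ideal_gen_in_def by (auto intro!: idl_sum idl_mult)

lemma gen_eqI:
  assumes "idl P" "S \<subseteq> P" "\<And>R. idl R \<Longrightarrow> S \<subseteq> R \<Longrightarrow> P \<subseteq> R"
  shows "ideal_gen_in A S = P"
proof (rule equalityI)
  show "ideal_gen_in A S \<subseteq> P" using assms(1,2) by (rule gen_least)
  have "S \<subseteq> A" using assms(1,2) by (auto simp: idl_def)
  then show "P \<subseteq> ideal_gen_in A S" by (intro assms(3) gen_idl gen_sub)
qed

lemma gen_union_gen: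
  assumes "K \<subseteq> A" "S \<subseteq> A"
  shows "ideal_gen_in A (K \<union> ideal_gen_in A S) = ideal_gen_in A (K \<union> S)"
proof (rule gen_eqI)
  show "idl (ideal_gen_in A (K \<union> S))" using assms by (intro gen_idl) auto
  then show "K \<union> ideal_gen_in A S \<subseteq> ideal_gen_in A (K \<union> S)"
    using gen_sub[of "K \<union> S"] by (intro Un_least gen_least) auto
  fix R assume R: "idl R" "K \<union> ideal_gen_in A S \<subseteq> R"
  then show "ideal_gen_in A (K \<union> S) \<subseteq> R"
    using gen_sub[of S] by (intro gen_least) auto
qed

lemma gen_insert:
  assumes "T \<subseteq> A" "f \<in> A"
  shows "ideal_gen_in A (insert f T) = adjoin (ideal_gen_in A T) f"
proof (rule gen_eqI)
  show "idl (adjoin (ideal_gen_in A T) f)" using assms by (intro adjoin_idl gen_idl)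
  show "insert f T \<subseteq> adjoin (ideal_gen_in A T) f"
    using adjoin_gen[OF gen_idl[OF assms(1)], of f] subset_trans[OF gen_sub[of T] adjoin_sub[of _ f]]
      by simp
  fix R assume "idl R" "insert f T \<subseteq> R"
  then show "adjoin (ideal_gen_in A T) f \<subseteq> R"
    by (intro adjoin_least gen_least) simp_all
qed

lemma gen_of_idl: "idl K \<Longrightarrow> ideal_gen_in A K = K"
  by (rule gen_eqI) (auto)

text \<open>On Z modulo B the elements of X commute and act nilpotently on each class. For one x
  after another, the last power that does not land in B produces a class killed by x, and elements
  treated earlier still kill it. The action is abstract because it serves both for A and for pairs
  of elements of A.\<close>

lemma socle:
  fixes act :: "'c \<Rightarrow> 'z \<Rightarrow> 'z"
  assumes fin: "finite X" and XA: "X \<subseteq> A"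
    and comm: "\<And>a b z. a \<in> A \<Longrightarrow> b \<in> A \<Longrightarrow> z \<in> Z \<Longrightarrow> act a (act b z) = act (a * b) z"
    and one: "\<And>z. z \<in> Z \<Longrightarrow> act 1 z = z"
    and Z: "\<And>a z. a \<in> A \<Longrightarrow> z \<in> Z \<Longrightarrow> act a z \<in> Z"
    and BB: "\<And>a z. a \<in> A \<Longrightarrow> z \<in> B \<Longrightarrow> act a z \<in> B" and BZ: "B \<subseteq> Z"
    and nil: "\<And>x z. x \<in> X \<Longrightarrow> z \<in> Z \<Longrightarrow> \<exists>n. act (x ^ n) z \<in> B"
    and z: "z \<in> Z" "z \<notin> B"
  shows "\<exists>z'\<in>Z. z' \<notin> B \<and> (\<forall>x\<in>X. act x z' \<in> B)"
  using fin XA nil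
proof (induction rule: finite_induct)
  case empty
  show ?case using z by auto
next
  case (insert x X)
  have "\<exists>z'\<in>Z. z' \<notin> B \<and> (\<forall>x\<in>X. act x z' \<in> B)"
    by (rule insert.IH) (use insert.prems(1) in simp, rule insert.prems(2), simp_all)
  then obtain y where y: "y \<in> Z" "y \<notin> B" "\<forall>x\<in>X. act x y \<in> B" by blast
  have ex: "\<exists>n. act (x ^ n) y \<in> B" by (rule insert.prems(2)) (use y in simp_all)
  define n where "n = (LEAST n. act (x ^ n) y \<in> B)"
  have nB: "act (x ^ n) y \<in> B" unfolding n_def using ex by (rule LeastI_ex)
  have least: "act (x ^ j) y \<notin> B" if "j < n" for j using that unfolding n_def by (rule not_less_Least)
  have "n \<noteq> 0"
  proof
    assume "n = 0"
    then show False using one[OF y(1)] y(2) nB by simp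
  qed
  then obtain k where k: "n = Suc k" using not0_implies_Suc by blast
  have xA: "x ^ j \<in> A" "x \<in> A" for j using insert.prems(1) by auto
  have "act (x ^ k) y \<notin> B"
    by (rule least) (simp add: k)
  moreover have "act x (act (x ^ k) y) \<in> B" using nB comm[OF xA(2) xA(1) y(1)] unfolding k by simp
  moreover have "act u (act (x ^ k) y) \<in> B" if "u \<in> X" for u
  proof -
    have uA: "u \<in> A" using that insert.prems(1) by auto
    have "act u (act (x ^ k) y) = act (x ^ k) (act u y)"
      using comm[OF uA xA(1) y(1)] comm[OF xA(1) uA y(1)] by (simp add: mult.commute)
    then show ?thesis using BB[OF xA(1)] bspec[OF y(3) that] by simp
  qed
  moreover have "act (x ^ k) y \<in> Z" using Z[OF xA(1) y(1)] .
  ultimately show ?case by (intro bexI[of _ "act (x ^ k) y"]) simp_all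
qed

end

context csubring
begin

text \<open>The multipliers that send z' into B form an ideal of A, so being killed by X extends to
  whatever X generates. \<open>B0\<close> and \<open>Badd\<close> express this without an addition
  on Z.\<close>

lemma socle_gen:
  fixes act :: "'c \<Rightarrow> 'z \<Rightarrow> 'z"
  assumes fin: "finite X" and XA: "X \<subseteq> A"
    and gens: "\<And>P. idl P \<Longrightarrow> X \<subseteq> P \<Longrightarrow> mm \<subseteq> P"
    and comm: "\<And>a b z. a \<in> A \<Longrightarrow> b \<in> A \<Longrightarrow> z \<in> Z \<Longrightarrow> act a (act b z) = act (a * b) z"
    and one: "\<And>z. z \<in> Z \<Longrightarrow> act 1 z = z"
    and Z: "\<And>a z. a \<in> A \<Longrightarrow> z \<in> Z \<Longrightarrow> act a z \<in> Z"
    and BB: "\<And>a z. a \<in> A \<Longrightarrow> z \<in> B \<Longrightarrow> act a z \<in> B" and BZ: "B \<subseteq> Z"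
    and B0: "\<And>z. z \<in> Z \<Longrightarrow> act 0 z \<in> B"
    and Badd: "\<And>a b z. a \<in> A \<Longrightarrow> b \<in> A \<Longrightarrow> z \<in> Z \<Longrightarrow> act a z \<in> B \<Longrightarrow> act b z \<in> B \<Longrightarrow> act (a + b) z \<in> B"
    and nil: "\<And>x z. x \<in> X \<Longrightarrow> z \<in> Z \<Longrightarrow> \<exists>n. act (x ^ n) z \<in> B"
    and z: "z \<in> Z" "z \<notin> B"
  shows "\<exists>z'\<in>Z. z' \<notin> B \<and> (\<forall>g\<in>mm. act g z' \<in> B)"
proof -
  have "\<exists>z'\<in>Z. z' \<notin> B \<and> (\<forall>x\<in>X. act x z' \<in> B)"
    using fin XA comm one Z BB BZ nil z by (rule socle)
  then obtain z' where z': "z' \<in> Z" "z' \<notin> B" "\<forall>x\<in>X. act x z' \<in> B" by blast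
  let ?P = "{c \<in> A. act c z' \<in> B}"
  have "idl ?P" unfolding idl_def
  proof (intro conjI ballI)
    show "0 \<in> ?P" using B0[OF z'(1)] by simp
  next
    fix x y assume "x \<in> ?P" "y \<in> ?P"
    then show "x + y \<in> ?P" using Badd[of x y, OF _ _ z'(1)] by simp
  next
    fix a x assume a: "a \<in> A" and x: "x \<in> ?P"
    then have "act a (act x z') \<in> B" using BB[OF a] by simp
    then show "a * x \<in> ?P" using comm[OF a _ z'(1), of x] x a by simp
  qed auto
  then have "mm \<subseteq> ?P" by (rule gens) (use XA z'(3) in auto)
  then show ?thesis using z' by blast
qed

text \<open>Here Z is the colon ideal B : Q; a power of each x lies in Q and therefore acts as zero
  on Z modulo B.\<close>

lemma socle_ideal:
  assumes fin: "finite X" and XA: "X \<subseteq> A"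
    and gens: "\<And>P. idl P \<Longrightarrow> X \<subseteq> P \<Longrightarrow> mm \<subseteq> P"
    and B: "idl B" and Q: "Q \<subseteq> A" and nil: "\<And>x. x \<in> X \<Longrightarrow> \<exists>n. x ^ n \<in> Q"
    and z: "z \<in> A" "z \<notin> B" "\<And>q. q \<in> Q \<Longrightarrow> q * z \<in> B"
  shows "\<exists>z'\<in>A. z' \<notin> B \<and> (\<forall>q\<in>Q. q * z' \<in> B) \<and> (\<forall>g\<in>mm. g * z' \<in> B)"
proof -
  let ?Z = "{z \<in> A. \<forall>q\<in>Q. q * z \<in> B}"
  have "\<exists>z'\<in>?Z. z' \<notin> B \<and> (\<forall>g\<in>mm. g * z' \<in> B)"
  proof (rule socle_gen[OF fin XA gens, where B = B and act = "(*)" and Z = ?Z and z = z])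
    fix a z assume a: "a \<in> A" and "z \<in> ?Z"
    moreover have "q * (a * z) = a * (q * z)" for q by (simp add: mult_ac)
    ultimately show "a * z \<in> ?Z" using idl_mult[OF B a]
      by (simp only: mem_Collect_eq mult_closed simp_thms) blast
  next
    show "B \<subseteq> ?Z" using B idl_mult[OF B] idl_sub[OF B] Q by blast
  next
    fix x z assume "x \<in> X" "z \<in> ?Z"
    then show "\<exists>n. x ^ n * z \<in> B" using nil by blast
  next
    fix a b z assume "a \<in> A" "b \<in> A" "z \<in> ?Z" "a * z \<in> B" "b * z \<in> B"
    then show "(a + b) * z \<in> B" using idl_add[OF B] by (simp add: distrib_right)
  qed (use z idl_zero[OF B] idl_mult[OF B] in \<open>auto simp: mult.assoc\<close>)
  then show ?thesis by blast
qed

section \<open>Koszul relations between two elements\<close>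

lemma nzdD: "nzd Q f \<Longrightarrow> g \<in> A \<Longrightarrow> f * g \<in> Q \<Longrightarrow> g \<in> Q"
  by (auto simp: nzd_def)

text \<open>The Koszul homology \<open>H_1(f1, f2)\<close> modulo \<open>K\<close> is killed by \<open>f1\<close> and \<open>f2\<close>, so if it is nonzero it contains
  a nonzero class killed by \<open>mm\<close>; two regular elements of \<open>mm\<close> show that such a class vanishes.\<close>

lemma koszul_H1:
  assumes K: "idl K" and f: "f1 \<in> A" "f2 \<in> A"
    and fin: "finite X" and XA: "X \<subseteq> A"
    and gens: "\<And>P. idl P \<Longrightarrow> X \<subseteq> P \<Longrightarrow> mm \<subseteq> P"
    and nil: "\<And>x. x \<in> X \<Longrightarrow> \<exists>n. x ^ n \<in> adjoin (adjoin K f1) f2"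
    and g: "g1 \<in> mm" "g2 \<in> mm" "nzd K g1" "nzd (adjoin K g1) g2"
    and u: "u1 \<in> A" "u2 \<in> A" "f1 * u1 + f2 * u2 \<in> K"
  shows "\<exists>w\<in>A. u1 - f2 * w \<in> K \<and> u2 + f1 * w \<in> K"
proof (rule ccontr)
  assume contra: "\<not> ?thesis"
  have K1: "idl (adjoin K f1)" using K f by (intro adjoin_idl)
  have mmA: "mm \<subseteq> A" by (rule gens) (use XA in \<open>auto simp: idl_def\<close>)
  then have gA: "g1 \<in> A" "g2 \<in> A" using g by auto
  \<comment> \<open>Z holds the relations between f1 and f2 modulo K, and B the trivial ones (f2 w,
    - f1 w).\<close>
  let ?Z = "{(u1, u2). u1 \<in> A \<and> u2 \<in> A \<and> f1 * u1 + f2 * u2 \<in> K}"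
  let ?B = "{(u1, u2). u1 \<in> A \<and> u2 \<in> A \<and> (\<exists>w\<in>A. u1 - f2 * w \<in> K \<and> u2 + f1 * w \<in> K)}"
  let ?act = "\<lambda>a (u1, u2). (a * u1, a * u2)"
  have B_Z: "?B \<subseteq> ?Z"
  proof safe
    fix a b w assume *: "a \<in> A" "b \<in> A" "w \<in> A" "a - f2 * w \<in> K" "b + f1 * w \<in> K"
    have "f1 * a + f2 * b = f1 * (a - f2 * w) + f2 * (b + f1 * w)" by (simp add: algebra_simps)
    then show "f1 * a + f2 * b \<in> K" using * f K by (simp add: idl_intros)
  qed
  have "\<exists>z\<in>?Z. z \<notin> ?B \<and> (\<forall>g\<in>mm. ?act g z \<in> ?B)"
  proof (rule socle_gen[OF fin XA gens, where B = ?B and Z = ?Z and act = ?act and z = "(u1, u2)"])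
    fix a z assume a: "a \<in> A" and "z \<in> ?Z"
    then obtain v1 v2 where v: "z = (v1, v2)" "v1 \<in> A" "v2 \<in> A" "f1 * v1 + f2 * v2 \<in> K" by blast
    have "f1 * (a * v1) + f2 * (a * v2) = a * (f1 * v1 + f2 * v2)" by (simp add: algebra_simps)
    then show "?act a z \<in> ?Z" using v a idl_mult[OF K a v(4)] by simp
  next
    fix a z assume a: "a \<in> A" and "z \<in> ?B"
    then obtain v1 v2 w where v: "z = (v1, v2)" "v1 \<in> A" "v2 \<in> A" "w \<in> A" "v1 - f2 * w
      \<in> K" "v2 + f1 * w \<in> K"
      by blast
    have "a * v1 - f2 * (a * w) = a * (v1 - f2 * w)" "a * v2 + f1 * (a * w) = a * (v2 + f1 * w)"
      by (simp_all add: algebra_simps)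
    then show "?act a z \<in> ?B" using v a idl_mult[OF K a v(5)] idl_mult[OF K a v(6)]
      by (auto intro!: bexI[of _ "a * w"])
  next
    show "?B \<subseteq> ?Z" by (rule B_Z)
  next
    fix z assume "z \<in> ?Z"
    then show "?act 0 z \<in> ?B" using idl_zero[OF K] by (auto intro!: bexI[of _ 0])
  next
    fix a b z assume ab: "a \<in> A" "b \<in> A" and z: "z \<in> ?Z" "?act a z \<in> ?B" "?act b z \<in> ?B"
    obtain v1 v2 where v: "z = (v1, v2)" by (cases z)
    obtain w w' where w: "w \<in> A" "a * v1 - f2 * w \<in> K" "a * v2 + f1 * w \<in> K"
        and w': "w' \<in> A" "b * v1 - f2 * w' \<in> K" "b * v2 + f1 * w' \<in> K"
      using z unfolding v by auto
    have "(a + b) * v1 - f2 * (w + w') = (a * v1 - f2 * w) + (b * v1 - f2 * w')"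
      "(a + b) * v2 + f1 * (w + w') = (a * v2 + f1 * w) + (b * v2 + f1 * w')"
        by (simp_all add: algebra_simps)
    then have "(a + b) * v1 - f2 * (w + w') \<in> K" "(a + b) * v2 + f1 * (w + w') \<in> K"
      using idl_add[OF K w(2) w'(2)] idl_add[OF K w(3) w'(3)] by simp_all
    then show "?act (a + b) z \<in> ?B" using ab z(1) v w(1) w'(1) by (auto intro!: bexI[of _ "w + w'"])
  next
    fix x z assume x: "x \<in> X" and "z \<in> ?Z"
    then obtain v1 v2 where v: "z = (v1, v2)" "v1 \<in> A" "v2 \<in> A" "f1 * v1 + f2 * v2 \<in> K" by blast
    obtain n where "x ^ n \<in> adjoin (adjoin K f1) f2" using nil[OF x] by blast
    then obtain b where b: "b \<in> A" "x ^ n - b * f2 \<in> adjoin K f1" by (rule adjoinE)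
    from b(2) obtain a where a: "a \<in> A" "x ^ n - b * f2 - a * f1 \<in> K" by (rule adjoinE)
    \<comment> \<open>A homotopy: with x^n = a f1 + b f2 + k, the element b v1 - a v2 exhibits x^n
      (v1, v2) as a trivial relation.\<close>
    define k where "k = x ^ n - b * f2 - a * f1"
    have k: "k \<in> K" using a k_def by simp
    have xn: "x ^ n = a * f1 + b * f2 + k" by (simp add: k_def)
    have "x ^ n * v1 - f2 * (b * v1 - a * v2) = a * (f1 * v1 + f2 * v2) + v1 * k"
      "x ^ n * v2 + f1 * (b * v1 - a * v2) = b * (f1 * v1 + f2 * v2) + v2 * k"
      unfolding xn by (simp_all add: algebra_simps)
    then have "x ^ n * v1 - f2 * (b * v1 - a * v2) \<in> K" "x ^ n * v2 + f1 * (b * v1 - a * v2) \<in> K"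
      using a(1) b(1) v k K by (simp_all add: idl_intros)
    then show "\<exists>n. ?act (x ^ n) z \<in> ?B" using x XA v a(1) b(1)
      by (auto intro!: exI[of _ n] bexI[of _ "b * v1 - a * v2"])
  qed (use u contra in \<open>auto simp: mult.assoc split: prod.splits\<close>)
  then obtain v1 v2 where v: "v1 \<in> A" "v2 \<in> A" "(v1, v2) \<notin> ?B" and vg: "\<forall>g\<in>mm. ?act g (v1, v2) \<in> ?B"
    by blast
  from vg g(1) obtain wa where wa: "wa \<in> A" "g1 * v1 - f2 * wa \<in> K" "g1 * v2 + f1 * wa \<in> K" by auto
  from vg g(2) obtain wb where wb: "wb \<in> A" "g2 * v1 - f2 * wb \<in> K" "g2 * v2 + f1 * wb \<in> K" by auto
  \<comment> \<open>Both g2 wa and g1 wb trivialise g1 g2 times the class, so their difference is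
    killed by f1 and f2 modulo K.\<close>
  let ?y = "g2 * wa - g1 * wb"
  have "f2 * ?y = g1 * (g2 * v1 - f2 * wb) - g2 * (g1 * v1 - f2 * wa)"
    "f1 * ?y = g2 * (g1 * v2 + f1 * wa) - g1 * (g2 * v2 + f1 * wb)" by (simp_all add: algebra_simps)
  then have y: "f2 * ?y \<in> K" "f1 * ?y \<in> K" using wa wb gA K by (simp_all add: idl_intros)
  have yA: "?y \<in> A" using gA wa wb by simp
  \<comment> \<open>Otherwise A modulo K would have a nonzero socle element, which g1 would
    kill.\<close>
  have "?y \<in> K"
  proof (rule ccontr)
    assume "?y \<notin> K"
    have "q * ?y \<in> K" if "q \<in> adjoin (adjoin K f1) f2" for q
    proof -
      from that obtain b where b: "b \<in> A" "q - b * f2 \<in> adjoin K f1" by (rule adjoinE)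
      from b(2) obtain a where a: "a \<in> A" "q - b * f2 - a * f1 \<in> K" by (rule adjoinE)
      define k where "k = q - b * f2 - a * f1"
      have k: "k \<in> K" using a k_def by simp
      have xn: "q = a * f1 + b * f2 + k" by (simp add: k_def)
      have "q * y' = a * (f1 * y') + b * (f2 * y') + k * y'" for y' unfolding xn
        by (simp add: algebra_simps)
      then show ?thesis using a(1) b(1) y k K yA by (metis idl_add idl_mult idl_mult2)
    qed
    then have "\<exists>z'\<in>A. z' \<notin> K \<and> (\<forall>q\<in>adjoin (adjoin K f1) f2. q * z' \<in> K) \<and> (\<forall>g\<in>mm. g * z' \<in> K)"
      using K1 f yA \<open>?y \<notin> K\<close> nil
      by (intro socle_ideal[OF fin XA gens K]) (auto dest: idl_sub[OF adjoin_idl])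
    then show False using g(1) nzdD[OF g(3)] by blast
  qed
  \<comment> \<open>Regularity of g2 makes wa a multiple of g1 modulo K; cancelling g1 then
    trivialises the class itself.\<close>
  then have "g2 * wa \<in> adjoin K g1" by (intro adjoinI[OF K wb(1)]) (simp add: mult.commute)
  then have "wa \<in> adjoin K g1" using nzdD[OF g(4) wa(1)] by blast
  then obtain w where w: "w \<in> A" "wa - w * g1 \<in> K" by (rule adjoinE)
  have "g1 * (v1 - f2 * w) = (g1 * v1 - f2 * wa) + f2 * (wa - w * g1)"
    "g1 * (v2 + f1 * w) = (g1 * v2 + f1 * wa) - f1 * (wa - w * g1)" by (simp_all add: algebra_simps)
  then have "g1 * (v1 - f2 * w) \<in> K" "g1 * (v2 + f1 * w) \<in> K"
    using wa w K f by (simp_all add: idl_intros)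
  then have "v1 - f2 * w \<in> K" "v2 + f1 * w \<in> K" using nzdD[OF g(3)] v w f by simp_all
  then show False using v w by blast
qed

lemma regular_pair_H1:
  assumes K: "idl K" and f: "f1 \<in> A" "f2 \<in> A" "nzd K f1" "nzd (adjoin K f1) f2"
    and u: "u1 \<in> A" "u2 \<in> A" "f1 * u1 + f2 * u2 \<in> K"
  shows "\<exists>w\<in>A. u1 - f2 * w \<in> K \<and> u2 + f1 * w \<in> K"
proof -
  have "f2 * u2 \<in> adjoin K f1"
    by (rule adjoinI[OF K uminus_closed[OF u(1)]]) (use u(3) in \<open>simp add: algebra_simps\<close>)
  then have "u2 \<in> adjoin K f1" using nzdD[OF f(4) u(2)] by blast
  then obtain w where w: "w \<in> A" "u2 - w * f1 \<in> K" by (rule adjoinE)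
  have "f1 * (u1 + f2 * w) = (f1 * u1 + f2 * u2) - f2 * (u2 - w * f1)" by (simp add: algebra_simps)
  then have "f1 * (u1 + f2 * w) \<in> K" using u w f K by (simp add: idl_intros)
  then have "u1 + f2 * w \<in> K" using nzdD[OF f(3)] u w f by simp
  then show ?thesis using w by (intro bexI[of _ "- w"]) (simp_all add: mult.commute)
qed

text \<open>An element outside \<open>(K, f1, f2)\<close> that \<open>mm\<close> multiplies into this ideal is lifted through the Koszul
  complex of \<open>f1, f2\<close> along \<open>g1, g2, g3\<close>.\<close>

lemma no_regular_triple:
  assumes K: "idl K" and f: "f1 \<in> A" "f2 \<in> A" "nzd K f1" "nzd (adjoin K f1) f2"
    and fin: "finite X" and XA: "X \<subseteq> A"
    and gens: "\<And>P. idl P \<Longrightarrow> X \<subseteq> P \<Longrightarrow> mm \<subseteq> P"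
    and nil: "\<And>x. x \<in> X \<Longrightarrow> \<exists>n. x ^ n \<in> adjoin (adjoin K f1) f2"
    and proper: "1 \<notin> adjoin (adjoin K f1) f2"
    and g: "g1 \<in> mm" "g2 \<in> mm" "g3
      \<in> mm" "nzd K g1" "nzd (adjoin K g1) g2" "nzd (adjoin (adjoin K g1) g2) g3"
  shows False
proof -
  let ?Q = "adjoin (adjoin K f1) f2"
  have Q: "idl ?Q" and Kg: "idl (adjoin K f1)" using K f by (simp_all add: adjoin_idl)
  have mmA: "mm \<subseteq> A" by (rule gens) (use XA in \<open>auto simp: idl_def\<close>)
  then have gA: "g1 \<in> A" "g2 \<in> A" "g3 \<in> A" using g by auto
  have H1: "\<exists>w\<in>A. u1 - f2 * w \<in> K \<and> u2 + f1 * w \<in> K" if "u1 \<in> A" "u2 \<in> A" "f1 * u1 + f2 * u2 \<in> K"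
    for u1 u2
    using regular_pair_H1[OF K f that] .
  \<comment> \<open>The element 1, which lies outside Q, is moved into the socle of A modulo
    Q.\<close>
  have "\<exists>z'\<in>A. z' \<notin> ?Q \<and> (\<forall>q\<in>?Q. q * z' \<in> ?Q) \<and> (\<forall>g\<in>mm. g * z' \<in> ?Q)"
    using proper by (intro socle_ideal[OF fin XA gens Q _ nil, where z = 1]) (auto dest: idl_sub[OF Q])
  then obtain z where z: "z \<in> A" "z \<notin> ?Q" "\<forall>g\<in>mm. g * z \<in> ?Q" by blast
  have lift: "\<exists>p1\<in>A. \<exists>p2\<in>A. g * z - (f1 * p1 + f2 * p2) \<in> K" if "g \<in> mm" for g
  proof -
    from z(3) that have "g * z \<in> ?Q" by blast
    then obtain b where b: "b \<in> A" "g * z - b * f2 \<in> adjoin K f1" by (rule adjoinE)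
    from b(2) obtain a where a: "a \<in> A" "g * z - b * f2 - a * f1 \<in> K" by (rule adjoinE)
    show ?thesis using a b by (intro bexI[of _ a] bexI[of _ b]) (simp_all add: algebra_simps)
  qed
  obtain p1 p2 where p: "p1 \<in> A" "p2 \<in> A" "g1 * z - (f1 * p1 + f2 * p2) \<in> K" using lift[OF g(1)]
    by blast
  obtain q1 q2 where q: "q1 \<in> A" "q2 \<in> A" "g2 * z - (f1 * q1 + f2 * q2) \<in> K" using lift[OF g(2)]
    by blast
  obtain r1 r2 where r: "r1 \<in> A" "r2 \<in> A" "g3 * z - (f1 * r1 + f2 * r2) \<in> K" using lift[OF g(3)]
    by blast
  \<comment> \<open>Eliminating z from two of the three equations leaves a relation between f1 and
    f2, which is trivial modulo K.\<close>
  have syz: "\<exists>w\<in>A. (h * p1 - h' * q1) - f2 * w \<in> K \<and> (h * p2 - h' * q2) + f1 * w \<in> K"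
    if "h \<in> A" "h' \<in> A" "p1 \<in> A" "p2 \<in> A" "q1 \<in> A" "q2 \<in> A"
      "h' * z - (f1 * p1 + f2 * p2) \<in> K" "h * z - (f1 * q1 + f2 * q2) \<in> K" for h h' p1 p2 q1 q2
  proof (rule H1)
    have "f1 * (h * p1 - h' * q1) + f2 * (h * p2 - h' * q2)
        = h' * (h * z - (f1 * q1 + f2 * q2)) - h * (h' * z - (f1 * p1 + f2 *
          p2))" by (simp add: algebra_simps)
    then show "f1 * (h * p1 - h' * q1) + f2 * (h * p2 - h' * q2) \<in> K" using that K
      by (simp add: idl_intros)
  qed (use that in simp_all)
  obtain w12 where w12: "w12 \<in> A" "(g2 * p1 - g1 * q1) - f2 * w12 \<in> K" "(g2 * p2 - g1 * q2) + f1 * w12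
    \<in> K"
    using syz[OF gA(2,1) p(1,2) q(1,2) p(3) q(3)] by blast
  obtain w13 where w13: "w13 \<in> A" "(g3 * p1 - g1 * r1) - f2 * w13 \<in> K" "(g3 * p2 - g1 * r2) + f1 * w13
    \<in> K"
    using syz[OF gA(3,1) p(1,2) r(1,2) p(3) r(3)] by blast
  obtain w23 where w23: "w23 \<in> A" "(g3 * q1 - g2 * r1) - f2 * w23 \<in> K" "(g3 * q2 - g2 * r2) + f1 * w23
    \<in> K"
    using syz[OF gA(3,2) q(1,2) r(1,2) q(3) r(3)] by blast
  \<comment> \<open>The alternating combination of the three trivialisations is killed by f1, hence
    lies in K. Cancelling g3, g2 and g1 in this order then expresses z itself through f1 and
    f2.\<close>
  let ?W = "g3 * w12 - g2 * w13 + g1 * w23"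
  have "f1 * ?W = g3 * ((g2 * p2 - g1 * q2) + f1 * w12) - g2 * ((g3 * p2 - g1 * r2) + f1 * w13)
     + g1 * ((g3 * q2 - g2 * r2) + f1 * w23)" by (simp add: algebra_simps)
  then have "f1 * ?W \<in> K" using w12 w13 w23 gA K by (simp add: idl_intros)
  then have W: "?W \<in> K" using nzdD[OF f(3)] w12 w13 w23 gA by simp
  have Kg1: "idl (adjoin K g1)" "idl (adjoin (adjoin K g1) g2)" using K gA by (simp_all add: adjoin_idl)
  have "g3 * w12 \<in> adjoin (adjoin K g1) g2"
  proof (rule adjoinI[OF Kg1(1) w13(1)], rule adjoinI[OF K, of "- w23"])
    have "g3 * w12 - w13 * g2 - (- w23) * g1 = ?W" by (simp add: algebra_simps)
    then show "g3 * w12 - w13 * g2 - (- w23) * g1 \<in> K" using W by (simp only:)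
  qed (use w23 in simp)
  then have "w12 \<in> adjoin (adjoin K g1) g2" using nzdD[OF g(6) w12(1)] by blast
  then obtain t where t: "t \<in> A" "w12 - t * g2 \<in> adjoin K g1" by (rule adjoinE)
  from t(2) obtain s where s: "s \<in> A" "w12 - t * g2 - s * g1 \<in> K" by (rule adjoinE)
  have "g2 * (p1 - f2 * t) \<in> adjoin K g1"
  proof (rule adjoinI[OF K, of "q1 + f2 * s"])
    have "g2 * (p1 - f2 * t) - (q1 + f2 * s) * g1
      = ((g2 * p1 - g1 * q1) - f2 * w12) + f2 * (w12 - t * g2 - s * g1)"
      by (simp add: algebra_simps)
    then show "g2 * (p1 - f2 * t) - (q1 + f2 * s) * g1 \<in> K" using w12 s f K by (simp add: idl_intros)
  qed (use q s f in simp)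
  then have "p1 - f2 * t \<in> adjoin K g1" using nzdD[OF g(5)] p t f by simp
  then obtain e1 where e1: "e1 \<in> A" "p1 - f2 * t - e1 * g1 \<in> K" by (rule adjoinE)
  have "g2 * (p2 + f1 * t) \<in> adjoin K g1"
  proof (rule adjoinI[OF K, of "q2 - f1 * s"])
    have "g2 * (p2 + f1 * t) - (q2 - f1 * s) * g1
      = ((g2 * p2 - g1 * q2) + f1 * w12) - f1 * (w12 - t * g2 - s * g1)"
      by (simp add: algebra_simps)
    then show "g2 * (p2 + f1 * t) - (q2 - f1 * s) * g1 \<in> K" using w12 s f K by (simp add: idl_intros)
  qed (use q s f in simp)
  then have "p2 + f1 * t \<in> adjoin K g1" using nzdD[OF g(5)] p t f by simp
  then obtain e2 where e2: "e2 \<in> A" "p2 + f1 * t - e2 * g1 \<in> K" by (rule adjoinE)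
  have "g1 * (z - (e1 * f1 + e2 * f2)) = (g1 * z - (f1 * p1 + f2 * p2)) + f1 * (p1 - f2 * t - e1 * g1)
     + f2 * (p2 + f1 * t - e2 * g1)" by (simp add: algebra_simps)
  then have "g1 * (z - (e1 * f1 + e2 * f2)) \<in> K" using p e1 e2 f K by (simp add: idl_intros)
  then have "z - (e1 * f1 + e2 * f2) \<in> K" using nzdD[OF g(4)] z e1 e2 f by simp
  then have "z - e2 * f2 - e1 * f1 \<in> K" by (simp add: algebra_simps)
  then have "z \<in> ?Q" using adjoinI[OF Kg e2(1) adjoinI[OF K e1(1)]] by blast
  then show False using z by blast
qed

end

section \<open>Rees algebras and the associated graded ring\<close>

interpretation whole: csubring "UNIV :: 'r::comm_ring_1 set"
  by unfold_locales auto

declare ideal_pow.simps(2) [simp del]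

lemma ideal_gen_idl: "whole.idl (ideal_gen S)"
  by (rule whole.gen_idl) simp

lemma ideal_pow_idl: "whole.idl (ideal_pow I n)"
proof (cases n)
  case 0
  then show ?thesis by (simp add: whole.idl_def)
qed (simp add: ideal_gen_idl ideal_pow.simps(2))

lemma ideal_pow_mult_Suc: "a \<in> ideal_pow I n \<Longrightarrow> b \<in> I \<Longrightarrow> a * b \<in> ideal_pow I (Suc n)"
  unfolding ideal_pow.simps by (rule subsetD[OF whole.gen_sub]) blast

lemma ideal_pow_Suc_least:
  assumes "whole.idl P" "\<And>a b. a \<in> ideal_pow I n \<Longrightarrow> b \<in> I \<Longrightarrow> a * b \<in> P"
  shows "ideal_pow I (Suc n) \<subseteq> P"
  unfolding ideal_pow.simps by (rule whole.gen_least) (use assms in auto)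

lemma idl_preimage_mult: "whole.idl P \<Longrightarrow> whole.idl {b. a * b \<in> P}"
  unfolding whole.idl_def by (auto simp: distrib_left mult.left_commute)

lemma ideal_pow_mult: "a \<in> ideal_pow I m \<Longrightarrow> b \<in> ideal_pow I n \<Longrightarrow> a * b \<in> ideal_pow I (m + n)"
proof (induction n arbitrary: b)
  case 0
  then show ?case using whole.idl_mult2[OF ideal_pow_idl] by simp
next
  case (Suc n)
  have "ideal_pow I (Suc n) \<subseteq> {b. a * b \<in> ideal_pow I (m + Suc n)}"
  proof (rule ideal_pow_Suc_least[OF idl_preimage_mult[OF ideal_pow_idl]])
    fix b c assume "b \<in> ideal_pow I n" "c \<in> I"
    then have "(a * b) * c \<in> ideal_pow I (Suc (m + n))"
      using Suc.IH[OF Suc.prems(1)] by (intro ideal_pow_mult_Suc)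
    then show "b * c \<in> {b. a * b \<in> ideal_pow I (m + Suc n)}" by (simp add: mult.assoc)
  qed
  then show ?case using Suc.prems by blast
qed

lemma ideal_pow_Suc_subset: "ideal_pow I (Suc n) \<subseteq> ideal_pow I n"
  by (rule ideal_pow_Suc_least[OF ideal_pow_idl]) (rule whole.idl_mult2[OF ideal_pow_idl UNIV_I])

lemma ideal_pow_antimono: "m \<le> n \<Longrightarrow> ideal_pow I n \<subseteq> ideal_pow I m"
  by (rule lift_Suc_antimono_le[of "ideal_pow I"]) (rule ideal_pow_Suc_subset)

lemma ideal_pow_1:
  assumes "whole.idl I" shows "ideal_pow I (Suc 0) = I"
proof
  show "ideal_pow I (Suc 0) \<subseteq> I"
    by (rule ideal_pow_Suc_least[OF assms]) (rule whole.idl_mult[OF assms UNIV_I])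
  show "I \<subseteq> ideal_pow I (Suc 0)" using ideal_pow_mult_Suc[of 1 I 0] by auto
qed

lemma rees_csubring: "csubring (rees I)"
proof
  show "1 \<in> rees I" unfolding rees_def
    using whole.idl_zero[OF ideal_pow_idl] by (auto simp: coeff_1 split: nat.splits)
next
  fix x y assume xy: "x \<in> rees I" "y \<in> rees I"
  then show "x + y \<in> rees I" by (simp add: rees_def whole.idl_add[OF ideal_pow_idl])
  show "x * y \<in> rees I" unfolding rees_def
  proof (rule CollectI, rule allI)
    fix n
    have "coeff x i * coeff y (n - i) \<in> ideal_pow I n" if "i \<le> n" for i
      using ideal_pow_mult[of "coeff x i" I i "coeff y (n - i)" "n - i"] that xy
        by (auto simp: rees_def)
    then show "coeff (x * y) n \<in> ideal_pow I n"
      unfolding coeff_mult by (intro whole.idl_sum[OF ideal_pow_idl]) simp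
  qed
next
  fix x assume "x \<in> rees I"
  then show "- x \<in> rees I" unfolding rees_def using whole.idl_uminus[OF ideal_pow_idl] by auto
qed

lemma monom_in_rees: "c \<in> ideal_pow I n \<Longrightarrow> monom c n \<in> rees I"
  unfolding rees_def using whole.idl_zero[OF ideal_pow_idl] by auto

lemma const_in_rees: "[:c:] \<in> rees I"
  using monom_in_rees[of c I 0] by (simp add: monom_0)

lemma coeff_in: "F \<in> rees I \<Longrightarrow> coeff F n \<in> ideal_pow I n"
  by (simp add: rees_def)

text \<open>Degreewise form of I times the Rees algebra, the sum of the I^(n+1) t^n.\<close>

definition gr_ker :: "'r::comm_ring_1 set \<Rightarrow> 'r poly set" where
  "gr_ker I = {F. \<forall>n. coeff F n \<in> ideal_pow I (Suc n)}"

lemma gr_ker_idl: "csubring.idl (rees I) (gr_ker I)"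
proof -
  interpret csubring "rees I" by (rule rees_csubring)
  show ?thesis unfolding idl_def
  proof (intro conjI ballI)
    show "gr_ker I \<subseteq> rees I" using ideal_pow_Suc_subset by (auto simp: gr_ker_def rees_def)
    show "0 \<in> gr_ker I" by (simp add: gr_ker_def whole.idl_zero[OF ideal_pow_idl])
  next
    fix x y assume "x \<in> gr_ker I" "y \<in> gr_ker I"
    then show "x + y \<in> gr_ker I" by (simp add: gr_ker_def whole.idl_add[OF ideal_pow_idl])
  next
    fix a x assume ax: "a \<in> rees I" "x \<in> gr_ker I"
    show "a * x \<in> gr_ker I" unfolding gr_ker_def
    proof (rule CollectI, rule allI)
      fix n
      have "coeff a i * coeff x (n - i) \<in> ideal_pow I (Suc n)" if "i \<le> n" for i
        using ideal_pow_mult[of "coeff a i" I i "coeff x (n - i)" "Suc (n - i)"] that ax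
        by (auto simp: rees_def gr_ker_def)
      then show "coeff (a * x) n \<in> ideal_pow I (Suc n)"
        unfolding coeff_mult by (intro whole.idl_sum[OF ideal_pow_idl]) simp
    qed
  qed
qed

lemma gr_kernel_eq:
  assumes I: "whole.idl I" shows "gr_kernel I = gr_ker I"
proof -
  interpret csubring "rees I" by (rule rees_csubring)
  show ?thesis unfolding gr_kernel_def
  proof (rule gen_eqI[OF gr_ker_idl])
    show "{[:c:] |c. c \<in> I} \<subseteq> gr_ker I"
      using ideal_pow_1[OF I] whole.idl_zero[OF ideal_pow_idl]
      by (auto simp: gr_ker_def coeff_pCons split: nat.splits)
  next
    fix R assume R: "idl R" "{[:c:] |c. c \<in> I} \<subseteq> R"
    have "monom c n \<in> R" if "c \<in> ideal_pow I (Suc n)" for c n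
    proof -
      have "ideal_pow I (Suc n) \<subseteq> {c. monom c n \<in> R}"
      proof (rule ideal_pow_Suc_least)
        show "whole.idl {c. monom c n \<in> R}" unfolding whole.idl_def
        proof (intro conjI ballI)
          show "0 \<in> {c. monom c n \<in> R}" using idl_zero[OF R(1)] by simp
          fix x y assume "x \<in> {c. monom c n \<in> R}" "y \<in> {c. monom c n \<in> R}"
          then show "x + y \<in> {c. monom c n \<in> R}" using idl_add[OF R(1)] by (simp flip: add_monom)
        next
          fix a x assume "x \<in> {c. monom c n \<in> R}"
          then have "[:a:] * monom x n \<in> R" using idl_mult[OF R(1) const_in_rees] by simp
          then show "a * x \<in> {c. monom c n \<in> R}" by (simp add: smult_monom)
        qed simp
      next
        fix a b assume ab: "a \<in> ideal_pow I n" "b \<in> I"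
        then have "monom a n * [:b:] \<in> R" using idl_mult[OF R(1) monom_in_rees] R(2) by blast
        then show "a * b \<in> {c. monom c n \<in> R}" by (simp add: smult_monom mult.commute)
      qed
      then show ?thesis using that by blast
    qed
    then have "(\<Sum>i\<le>degree F. monom (coeff F i) i) \<in> R" if "F \<in> gr_ker I" for F
      using that by (intro idl_sum[OF R(1)]) (simp add: gr_ker_def)
    then show "gr_ker I \<subseteq> R" by (simp add: subset_iff poly_as_sum_of_monoms)
  qed
qed

text \<open>The socle arguments need finitely many generators of the homogeneous maximal ideal.
  Generators of m in degree zero and of I in degree one suffice, because the c with c t^n in P form
  an ideal of the base ring.\<close>

lemma gr_max_least:
  assumes "csubring.idl (rees (ideal_gen T)) P"
    "(\<lambda>c. [:c:]) ` S \<union> (\<lambda>c. monom c 1) ` T \<subseteq> P"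
  shows "gr_max (ideal_gen S) (ideal_gen T) \<subseteq> P"
proof -
  interpret csubring "rees (ideal_gen T)" by (rule rees_csubring)
  note P = assms(1)
  have step: "whole.idl {c. monom c n \<in> P}" for n unfolding whole.idl_def
  proof (intro conjI ballI)
    show "0 \<in> {c. monom c n \<in> P}" using idl_zero[OF P] by simp
    fix x y assume "x \<in> {c. monom c n \<in> P}" "y \<in> {c. monom c n \<in> P}"
    then show "x + y \<in> {c. monom c n \<in> P}" using idl_add[OF P] by (simp flip: add_monom)
  next
    fix a x assume "x \<in> {c. monom c n \<in> P}"
    then have "[:a:] * monom x n \<in> P" using idl_mult[OF P const_in_rees] by simp
    then show "a * x \<in> {c. monom c n \<in> P}" by (simp add: smult_monom)
  qed simp
  have "ideal_gen S \<subseteq> {c. monom c 0 \<in> P}"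
    by (rule whole.gen_least[OF step]) (use assms(2) in \<open>auto simp: monom_0\<close>)
  moreover have "ideal_gen T \<subseteq> {c. monom c 1 \<in> P}"
    by (rule whole.gen_least[OF step]) (use assms(2) in auto)
  ultimately show ?thesis unfolding gr_max_def
    by (intro gen_least[OF P]) (auto simp: monom_0)
qed

lemma gr_max_gen_in:
  assumes "whole.idl I"
  shows "c \<in> m \<Longrightarrow> [:c:] \<in> gr_max m I" "c \<in> I \<Longrightarrow> monom c 1 \<in> gr_max m I" "gr_max m I \<subseteq> rees I"
proof -
  interpret csubring "rees I" by (rule rees_csubring)
  let ?S = "{[:c:] | c. c \<in> m} \<union> {monom c 1 | c. c \<in> I}"
  have S: "?S \<subseteq> rees I"
    using const_in_rees monom_in_rees[of _ I 1] ideal_pow_1[OF assms] by auto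
  show "c \<in> m \<Longrightarrow> [:c:] \<in> gr_max m I" "c \<in> I \<Longrightarrow> monom c 1 \<in> gr_max m I"
    unfolding gr_max_def using gen_sub[of ?S] by auto
  show "gr_max m I \<subseteq> rees I" unfolding gr_max_def using idl_sub[OF gen_idl[OF S]] by blast
qed

locale graded =
  fixes m I :: "'r::comm_ring_1 set"
  assumes I: "whole.idl I" and m: "whole.idl m" and Im: "I \<subseteq> m" and m_proper: "1 \<notin> m"
begin

sublocale csubring "rees I" by (rule rees_csubring)

abbreviation "K \<equiv> gr_ker I"

lemma K: "idl K" by (rule gr_ker_idl)

lemma gr_max_sub: "gr_max m I \<subseteq> rees I" by (rule gr_max_gen_in(3)[OF I])

text \<open>Elements with constant coefficient in m form an ideal of the Rees algebra that omits 1.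
  This yields the properness clause of regular sequences.\<close>

lemma proper: "1 \<notin> ideal_gen_in (rees I) (K \<union> gr_max m I)"
proof -
  let ?P = "{F \<in> rees I. coeff F 0 \<in> m}"
  have P: "idl ?P" unfolding idl_def
    using whole.idl_zero[OF m] whole.idl_add[OF m] whole.idl_mult[OF m] by (auto simp: coeff_mult)
  have "K \<subseteq> ?P"
    using idl_sub[OF K] Im ideal_pow_1[OF I] by (auto simp: gr_ker_def)
  moreover have "gr_max m I \<subseteq> ?P" unfolding gr_max_def
    using const_in_rees monom_in_rees[of _ I 1] ideal_pow_1[OF I] whole.idl_zero[OF m]
    by (intro gen_least[OF P]) (auto)
  ultimately have "ideal_gen_in (rees I) (K \<union> gr_max m I) \<subseteq> ?P" by (intro gen_least[OF P]) auto
  then show ?thesis using m_proper by auto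
qed

lemma regular_iff:
  "gr_regular_seq m I fs \<longleftrightarrow> set fs \<subseteq> gr_max m I \<and>
     (\<forall>i<length fs. nzd (ideal_gen_in (rees I) (K \<union> set (take i fs))) (fs ! i))"
proof -
  have "1 \<notin> ideal_gen_in (rees I) (K \<union> set fs)" if "set fs \<subseteq> gr_max m I"
  proof -
    have "ideal_gen_in (rees I) (K \<union> set fs) \<subseteq> ideal_gen_in (rees I) (K \<union> gr_max m I)"
      by (intro gen_least gen_idl order.trans[OF _ gen_sub]) (use that idl_sub[OF K] gr_max_sub in auto)
    then show ?thesis using proper by blast
  qed
  moreover have "ideal_gen_in (rees I) (K \<union> ideal_gen_in (rees I) (set (take i fs)))
      = ideal_gen_in (rees I) (K \<union> set (take i fs))" if "set fs \<subseteq> gr_max m I" for i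
    by (rule gen_union_gen) (use that idl_sub[OF K] gr_max_sub set_take_subset[of i fs] in auto)
  ultimately show ?thesis
    unfolding gr_regular_seq_def gr_kernel_eq[OF I] Let_def nzd_def by (metis (no_types, lifting))
qed

lemma regular_take: "gr_regular_seq m I fs \<Longrightarrow> gr_regular_seq m I (take n fs)"
  unfolding regular_iff using set_take_subset[of n fs] by (auto simp: min_def split: if_splits)

lemma regular_1: "gr_regular_seq m I [f] \<longleftrightarrow> f \<in> gr_max m I \<and> nzd K f"
  unfolding regular_iff by (simp add: gen_of_idl[OF K])

lemma regular_2: "gr_regular_seq m I [f, g] \<longleftrightarrow> {f, g} \<subseteq> gr_max m I \<and> nzd K f \<and> nzd (adjoin K f) g"
proof -
  have "ideal_gen_in (rees I) (insert f K) = adjoin K f" if "f \<in> gr_max m I"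
    using gen_insert[of K f] idl_sub[OF K] gr_max_sub that gen_of_idl[OF K] by auto
  then show ?thesis unfolding regular_iff by (auto simp: gen_of_idl[OF K] less_Suc_eq numeral_2_eq_2)
qed

lemma regular_3:
  assumes "gr_regular_seq m I [f, g, h]"
  shows "{f, g, h} \<subseteq> gr_max m I \<and> nzd K f \<and> nzd (adjoin K f) g \<and> nzd (adjoin (adjoin K f) g) h"
proof -
  have fg: "{f, g, h} \<subseteq> gr_max m I" and h: "nzd (ideal_gen_in (rees I) (K \<union> {f, g})) h"
    using assms by (auto simp: regular_iff less_Suc_eq numeral_3_eq_3)
  have "gr_regular_seq m I [f, g]" using regular_take[OF assms, of 2] by simp
  moreover have "ideal_gen_in (rees I) (K \<union> {f, g}) = adjoin (adjoin K f) g"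
    using gen_insert[of K f] gen_insert[of "insert f K" g] idl_sub[OF K] gr_max_sub fg gen_of_idl[OF K]
    by (auto simp: insert_commute)
  ultimately show ?thesis using fg h regular_2 by auto
qed

text \<open>Prefixes of regular sequences are regular, so excluding length three excludes every
  greater length.\<close>

lemma depth_eq:
  assumes "\<And>f g h. \<not> gr_regular_seq m I [f, g, h]"
  shows "depth_gr m I = (if \<exists>f g. gr_regular_seq m I [f, g] then 2
     else if \<exists>f. gr_regular_seq m I [f] then 1 else 0)"
proof -
  have len: "\<exists>gs. length gs = n \<and> gr_regular_seq m I gs" if "gr_regular_seq m I fs" "n \<le> length fs"
    for fs n
    using regular_take[OF that(1), of n] that(2) by (intro exI[of _ "take n fs"]) auto
  have no3: "length fs < 3" if "gr_regular_seq m I fs" for fs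
  proof (rule ccontr)
    assume "\<not> length fs < 3"
    then obtain gs where "length gs = 3" "gr_regular_seq m I gs"
      using len[of fs 3] \<open>gr_regular_seq m I fs\<close> by auto
    then show False using assms by (auto simp: length_Suc_conv numeral_3_eq_3)
  qed
  let ?d = "if \<exists>f g. gr_regular_seq m I [f, g] then 2
     else if \<exists>f. gr_regular_seq m I [f] then 1 else 0 :: enat"
  have le: "enat (length fs) \<le> ?d" if fs: "gr_regular_seq m I fs" for fs
  proof -
    consider "length fs = 0" | "length fs = 1" | "length fs = 2" using no3[OF fs] by linarith
    then show ?thesis
    proof cases
      case 2
      then obtain f where "fs = [f]" by (auto simp: length_Suc_conv)
      then show ?thesis using fs by (auto simp: one_enat_def numeral_eq_enat)
    next
      case 3
      then obtain f g where "fs = [f, g]" by (auto simp: length_Suc_conv numeral_2_eq_2)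
      then show ?thesis using fs by (auto simp: numeral_eq_enat)
    qed (simp add: enat_0)
  qed
  moreover have "enat (length fs) \<le> depth_gr m I" if "gr_regular_seq m I fs" for fs
    unfolding depth_gr_def by (rule Sup_upper) (use that in blast)
  from this[of "[_, _]"] this[of "[_]"] have "?d \<le> depth_gr m I"
    by (auto simp: numeral_eq_enat one_enat_def numeral_2_eq_2)
  moreover have "depth_gr m I \<le> ?d" unfolding depth_gr_def
    by (rule Sup_least) (use le in blast)
  ultimately show ?thesis by (intro antisym)
qed

lemma monom_mult_coeff: "coeff (monom F (Suc 0) * G) n = (if n = 0 then 0 else F * coeff G (n - 1))"
  using coeff_monom_mult[of F 1 G n] by (cases n) auto

text \<open>Multiplication by a homogeneous element of degree one shifts coefficients, so regularity
  can be tested degree by degree.\<close>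

lemma nzd_monomI:
  assumes "\<And>n g. g \<in> ideal_pow I n \<Longrightarrow> F * g \<in> ideal_pow I (n + 2) \<Longrightarrow> g \<in> ideal_pow I (Suc n)"
  shows "nzd K (monom F 1)"
  unfolding nzd_def
proof (intro ballI impI)
  fix G assume G: "G \<in> rees I" "monom F 1 * G \<in> K"
  show "G \<in> K" unfolding gr_ker_def
  proof (rule CollectI, rule allI)
    fix n
    have "coeff (monom F 1 * G) (Suc n) \<in> ideal_pow I (Suc (Suc n))"
      using G(2) unfolding gr_ker_def by blast
    then have "F * coeff G n \<in> ideal_pow I (n + 2)" by (simp add: monom_mult_coeff)
    then show "coeff G n \<in> ideal_pow I (Suc n)" using assms[OF coeff_in[OF G(1)]] by blast
  qed
qed

text \<open>The degreewise test modulo a first element. In degree n the cofactor of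
  \<open>F1\<close> has degree n - 1; since 0 - 1 = 0 on the naturals, the case n = 0 is stated
  separately to rule out a cofactor there.\<close>

lemma nzd_adjoin_monomI:
  assumes F1: "F1 \<in> I"
    and "\<And>n g h. g \<in> ideal_pow I n \<Longrightarrow> h \<in> ideal_pow I n \<Longrightarrow> F1 * h + F2 * g \<in> ideal_pow I (n + 2)
      \<Longrightarrow> \<exists>w. (n = 0 \<longrightarrow> w = 0) \<and> w \<in> ideal_pow I (n - 1) \<and> g - F1 * w \<in> ideal_pow I (Suc n)"
  shows "nzd (adjoin K (monom F1 1)) (monom F2 1)"
  unfolding nzd_def
proof (intro ballI impI)
  fix G assume G: "G \<in> rees I" "monom F2 1 * G \<in> adjoin K (monom F1 1)"
  then obtain H where H: "H \<in> rees I" "monom F2 1 * G - H * monom F1 1 \<in> K" by (elim adjoinE)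
  have "\<exists>w. (n = 0 \<longrightarrow> w = 0) \<and> w \<in> ideal_pow I (n - 1) \<and> coeff G n - F1 * w \<in> ideal_pow I (Suc n)" for n
  proof (rule assms(2)[OF coeff_in[OF G(1)]])
    show "- coeff H n \<in> ideal_pow I n" using whole.idl_uminus[OF ideal_pow_idl coeff_in[OF H(1)]] .
    have "coeff (monom F2 1 * G - H * monom F1 1) (Suc n) \<in> ideal_pow I (Suc (Suc n))"
      using H(2) unfolding gr_ker_def by blast
    also have "coeff (monom F2 1 * G - H * monom F1 1) (Suc n) = F1 * (- coeff H n) + F2 * coeff G n"
      by (simp add: mult.commute[of H] monom_mult_coeff)
    finally show "F1 * (- coeff H n) + F2 * coeff G n \<in> ideal_pow I (n + 2)" by (simp)
  qed
  then obtain w where w: "\<And>n. n = 0 \<Longrightarrow> w n = 0" "\<And>n. w n \<in> ideal_pow I (n - 1)"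
     "\<And>n. coeff G n - F1 * w n \<in> ideal_pow I (Suc n)" by metis
  \<comment> \<open>A polynomial holds only finitely many cofactors; beyond degree G + 1 both G and
    the product vanish.\<close>
  define W where "W = (\<Sum>j\<le>degree G. monom (w (Suc j)) j)"
  have cW: "coeff W j = (if j \<le> degree G then w (Suc j) else 0)" for j
    unfolding W_def coeff_sum by (simp add: if_distrib cong: if_cong)
  have "w (Suc j) \<in> ideal_pow I j" for j using w(2)[of "Suc j"] by simp
  then have "W \<in> rees I" unfolding rees_def using whole.idl_zero[OF ideal_pow_idl]
    by (auto simp: cW)
  moreover have "G - W * monom F1 1 \<in> K" unfolding gr_ker_def
  proof (rule CollectI, rule allI)
    fix n
    have "coeff (G - W * monom F1 1) n = coeff G n - (if n = 0 then 0 else F1 * coeff W (n - 1))"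
      by (simp add: mult.commute[of W] monom_mult_coeff)
    also have "\<dots> = (if n \<le> Suc (degree G) then coeff G n - F1 * w n else 0)"
      using w(1) by (cases n) (auto simp: cW coeff_eq_0)
    also have "\<dots> \<in> ideal_pow I (Suc n)"
      using w(3)[of n] whole.idl_zero[OF ideal_pow_idl[of I "Suc n"]] by simp
    finally show "coeff (G - W * monom F1 1) n \<in> ideal_pow I (Suc n)" .
  qed
  ultimately show "G \<in> adjoin K (monom F1 1)" by (rule adjoinI[OF K])
qed

end

section \<open>Monomial ideals and the vertices of the Newton polygon\<close>

context csubring
begin

definition rad :: "'c set \<Rightarrow> 'c set" where
  "rad Q = {x \<in> A. \<exists>n. x ^ n \<in> Q}"

lemma of_nat_closed: "of_nat n \<in> A"
  by (induction n) simp_all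

lemma radI: "x \<in> A \<Longrightarrow> x ^ n \<in> Q \<Longrightarrow> x \<in> rad Q"
  by (auto simp: rad_def)

lemma rad_idl:
  assumes Q: "idl Q" shows "idl (rad Q)"
  unfolding idl_def
proof (intro conjI ballI)
  show "rad Q \<subseteq> A" by (auto simp: rad_def)
  show "0 \<in> rad Q" by (rule radI[of _ 1]) (use idl_zero[OF Q] in simp_all)
next
  fix a x assume a: "a \<in> A" and "x \<in> rad Q"
  then obtain n where x: "x \<in> A" "x ^ n \<in> Q" by (auto simp: rad_def)
  then have "(a * x) ^ n \<in> Q" using idl_mult[OF Q power_closed[OF a]] by (simp add: power_mult_distrib)
  then show "a * x \<in> rad Q" using a x by (intro radI) simp
next
  fix x y assume "x \<in> rad Q" "y \<in> rad Q"
  then obtain m n where x: "x \<in> A" "x ^ m \<in> Q" and y: "y \<in> A" "y ^ n \<in> Q" by (auto simp: rad_def)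
  have "of_nat ((m + n) choose k) * x ^ k * y ^ (m + n - k) \<in> Q" if "k \<le> m + n" for k
  proof (cases "m \<le> k")
    case True
    then have "x ^ k = x ^ m * x ^ (k - m)" by (simp flip: power_add)
    then have "x ^ k \<in> Q" using idl_mult2[OF Q _ x(2)] x(1) by simp
    then show ?thesis using of_nat_closed x y Q by (intro idl_mult2[OF Q] idl_mult[OF Q]) auto
  next
    case False
    then have "y ^ (m + n - k) = y ^ n * y ^ (m - k)" by (simp add: add.commute flip: power_add)
    then have "y ^ (m + n - k) \<in> Q" using idl_mult2[OF Q _ y(2)] y(1) by simp
    then show ?thesis using of_nat_closed x y Q by (intro idl_mult[OF Q]) auto
  qed
  then have "(x + y) ^ (m + n) \<in> Q" unfolding binomial_ring by (intro idl_sum[OF Q]) simp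
  then show "x + y \<in> rad Q" using x y by (intro radI) simp
qed

lemma rad_root: "x \<in> A \<Longrightarrow> x ^ n \<in> rad Q \<Longrightarrow> x \<in> rad Q"
  unfolding rad_def by (auto simp flip: power_mult)

lemma rad_sub: "Q \<subseteq> A \<Longrightarrow> Q \<subseteq> rad Q"
  using radI[of _ 1 Q] by auto

end

text \<open>The outer variable is x (z for the transform) and the inner one y, so
  \<open>cf F p q\<close> is the coefficient of x^p y^q.\<close>

definition mon :: "nat \<Rightarrow> nat \<Rightarrow> 'k::comm_ring_1 poly poly" where
  "mon p q = monom (monom 1 q) p"

abbreviation cf :: "'k::zero poly poly \<Rightarrow> nat \<Rightarrow> nat \<Rightarrow> 'k" where
  "cf F p q \<equiv> coeff (coeff F p) q"

definition mono_ideal :: "(nat \<Rightarrow> nat \<Rightarrow> bool) \<Rightarrow> 'k::comm_ring_1 poly poly set" where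
  "mono_ideal S = {F. \<forall>p q. cf F p q \<noteq> 0 \<longrightarrow> S p q}"

lemma mon_mult: "mon p q * mon p' q' = mon (p + p') (q + q')"
  by (simp add: mon_def mult_monom)

lemma mon_power: "mon p q ^ n = mon (n * p) (n * q)"
  by (simp add: mon_def monom_power mult.commute)

lemma mon_0_0: "mon 0 0 = 1"
  by (simp add: mon_def)

lemma var_out_mon: "var_out = mon 1 0"
  by (simp add: var_out_def mon_def)

lemma var_in_mon: "var_in = mon 0 1"
  by (simp add: var_in_def mon_def monom_0 monom_Suc)

lemma var_mon: "var_out ^ p * var_in ^ q = mon p q"
  by (simp add: var_out_mon var_in_mon mon_power mon_mult)

lemma cf_mon: "cf (mon p q) p' q' = (if p = p' \<and> q = q' then 1 else 0)"
  by (auto simp: mon_def)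

lemma cf_mon_mult:
  "cf (mon p q * F) p' q' = (if p \<le> p' \<and> q \<le> q' then cf F (p' - p) (q' - q) else 0)"
  unfolding mon_def by (auto simp: coeff_monom_mult)

lemma cf_mult_nz:
  assumes "cf (F * G) p q \<noteq> 0"
  shows "\<exists>p1 q1 p2 q2. p = p1 + p2 \<and> q = q1 + q2 \<and> cf F p1 q1 \<noteq> 0 \<and> cf G p2 q2 \<noteq> 0"
proof -
  have "cf (F * G) p q = (\<Sum>i\<le>p. \<Sum>j\<le>q. cf F i j * cf G (p - i) (q - j))"
    by (simp add: coeff_mult coeff_sum)
  then obtain i where i: "i \<le> p" "(\<Sum>j\<le>q. cf F i j * cf G (p - i) (q - j)) \<noteq> 0"
    using assms by (metis (no_types, lifting) atMost_iff sum.neutral)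
  then obtain j where "j \<le> q" "cf F i j * cf G (p - i) (q - j) \<noteq> 0"
    by (metis (no_types, lifting) atMost_iff sum.neutral)
  then show ?thesis using i(1)
    by (intro exI[of _ i] exI[of _ j] exI[of _ "p - i"] exI[of _ "q - j"]) auto
qed

lemma mono_ideal_mult:
  assumes "F \<in> mono_ideal S" "G \<in> mono_ideal T" "\<And>p q p' q'. S p q \<Longrightarrow> T p' q' \<Longrightarrow> U (p + p') (q + q')"
  shows "F * G \<in> mono_ideal U"
  using assms cf_mult_nz[of F G] unfolding mono_ideal_def by blast

lemma mono_ideal_idl:
  assumes up: "\<And>p q p' q'. S p q \<Longrightarrow> S (p' + p) (q' + q)"
  shows "whole.idl (mono_ideal S)"
  unfolding whole.idl_def
proof (intro conjI ballI)
  fix a x :: "'a poly poly" assume "x \<in> mono_ideal S"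
  moreover have "a \<in> mono_ideal (\<lambda>_ _. True)" by (simp add: mono_ideal_def)
  ultimately show "a * x \<in> mono_ideal S" by (intro mono_ideal_mult[of a _ x S S]) (use up in auto)
next
  fix x y :: "'a poly poly" assume "x \<in> mono_ideal S" "y \<in> mono_ideal S"
  then show "x + y \<in> mono_ideal S" unfolding mono_ideal_def by (auto, metis add.right_neutral)
qed (simp_all add: mono_ideal_def)

lemma mon_sum: "F = (\<Sum>p\<le>degree F. \<Sum>q\<le>degree (coeff F p). [:[:cf F p q:]:] * mon p q)"
proof -
  have "(\<Sum>q\<le>degree (coeff F p). [:[:cf F p q:]:] * mon p q) = monom (coeff F p) p" for p
  proof -
    have "[:[:cf F p q:]:] * mon p q = monom (monom (cf F p q) q) p" for q
      by (simp add: mon_def smult_monom)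
    moreover have "(\<Sum>q\<le>N. monom (c q) p) = monom (\<Sum>q\<le>N. c q) p" for c :: "nat \<Rightarrow> 'a poly" and N
      by (induction N) (simp_all add: add_monom)
    ultimately show ?thesis by (simp add: poly_as_sum_of_monoms)
  qed
  then show ?thesis by (simp add: poly_as_sum_of_monoms)
qed

lemma mono_ideal_least:
  fixes P :: "'k::comm_ring_1 poly poly set"
  assumes P: "whole.idl P" "\<And>p q. S p q \<Longrightarrow> mon p q \<in> P"
  shows "mono_ideal S \<subseteq> P"
proof
  fix F :: "'k poly poly" assume F: "F \<in> mono_ideal S"
  have "[:[:cf F p q:]:] * mon p q \<in> P" for p q
  proof (cases "cf F p q = 0")
    case False
    then show ?thesis using F by (intro whole.idl_mult[OF P(1)] P(2)) (auto simp: mono_ideal_def)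
  qed (simp add: whole.idl_zero[OF P(1)])
  then show "F \<in> P" by (subst mon_sum) (intro whole.idl_sum[OF P(1)])
qed

text \<open>The condition \<open>in_pow d b n p q\<close> says that \<open>x^p y^q\<close> lies in the \<open>n\<close>-th power of the ideal generated
  by the \<open>x^(d - k) y^(b k)\<close>.\<close>

fun in_pow :: "nat \<Rightarrow> (nat \<Rightarrow> nat) \<Rightarrow> nat \<Rightarrow> nat \<Rightarrow> nat \<Rightarrow> bool" where
  "in_pow d b 0 p q = True"
| "in_pow d b (Suc n) p q = (\<exists>k\<le>d. d - k \<le> p \<and> b k \<le> q \<and> in_pow d b n (p - (d - k)) (q - b k))"

lemma in_pow_SucI: "k \<le> d \<Longrightarrow> in_pow d b n p q \<Longrightarrow> in_pow d b (Suc n) (d - k + p) (b k + q)"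
  by auto

lemma in_pow_SucE:
  assumes "in_pow d b (Suc n) p q"
  obtains k p' q' where "k \<le> d" "p = d - k + p'" "q = b k + q'" "in_pow d b n p' q'"
proof -
  from assms obtain k where "k \<le> d" "d - k \<le> p" "b k \<le> q" "in_pow d b n (p - (d - k)) (q - b k)" by auto
  then show thesis using that[of k "p - (d - k)" "q - b k"] by simp
qed

lemma in_pow_up: "in_pow d b n p q \<Longrightarrow> in_pow d b n (p' + p) (q' + q)"
proof (induction n arbitrary: p q)
  case (Suc n)
  from Suc.prems obtain k r s where k: "k \<le> d" "p = d - k + r" "q = b k + s" "in_pow d b n r s"
    by (rule in_pow_SucE)
  then show ?case using in_pow_SucI[OF k(1) Suc.IH[OF k(4)]] by (simp add: add_ac)
qed simp

lemma in_pow_le: "in_pow d b n p q \<Longrightarrow> p \<le> p' \<Longrightarrow> q \<le> q' \<Longrightarrow> in_pow d b n p' q'"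
  using in_pow_up[of d b n p q "p' - p" "q' - q"] by simp

lemma in_pow_add: "in_pow d b m p q \<Longrightarrow> in_pow d b n p' q' \<Longrightarrow> in_pow d b (m + n) (p + p') (q + q')"
proof (induction m arbitrary: p q)
  case 0
  then show ?case using in_pow_up[of d b n p' q' p q] by simp
next
  case (Suc n)
  from Suc.prems(1) obtain k r s where k: "k \<le> d" "p = d - k + r" "q = b k + s" "in_pow d b n r s"
    by (rule in_pow_SucE)
  then show ?case using in_pow_SucI[OF k(1) Suc.IH[OF k(4) Suc.prems(2)]] by (simp add: add_ac)
qed

lemma in_pow_x:
  assumes "b 0 = 0" shows "n * d \<le> p \<Longrightarrow> in_pow d b n p q"
proof (induction n arbitrary: p)
  case (Suc n)
  then have "in_pow d b (Suc n) (d - 0 + (p - d)) (b 0 + q)" by (intro in_pow_SucI Suc.IH) auto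
  then show ?case using assms Suc.prems by simp
qed simp

lemma in_pow_y: "n * b d \<le> q \<Longrightarrow> in_pow d b n p q"
proof (induction n arbitrary: q)
  case (Suc n)
  then have "in_pow d b (Suc n) (d - d + p) (b d + (q - b d))" by (intro in_pow_SucI Suc.IH) auto
  then show ?case using Suc.prems by simp
qed simp

definition stair_ideal :: "nat \<Rightarrow> (nat \<Rightarrow> nat) \<Rightarrow> 'k::comm_ring_1 poly poly set" where
  "stair_ideal d b = ideal_gen {mon (d - k) (b k) | k. k \<le> d}"

lemma stair_idl: "whole.idl (stair_ideal d b)"
  unfolding stair_ideal_def by (rule ideal_gen_idl)

lemma mon_in_stair: "k \<le> d \<Longrightarrow> mon (d - k) (b k) \<in> stair_ideal d b"
  unfolding stair_ideal_def by (rule subsetD[OF whole.gen_sub]) blast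

lemma in_pow_idl: "whole.idl (mono_ideal (in_pow d b n))"
  by (rule mono_ideal_idl) (rule in_pow_up)

text \<open>Powers of I become a matter of exponents, which is what allows both depth criteria to be
  checked on monomials.\<close>

lemma pow_stair: "ideal_pow (stair_ideal d b) n
  = (mono_ideal (in_pow d b n) :: 'k::comm_ring_1 poly poly set)"
proof (induction n)
  case 0
  then show ?case by (simp add: mono_ideal_def)
next
  case (Suc n)
  show ?case
  proof
    have I1: "(stair_ideal d b :: 'k poly poly set) \<subseteq> mono_ideal (in_pow d b 1)"
      unfolding stair_ideal_def
      by (rule whole.gen_least[OF in_pow_idl]) (auto simp: mono_ideal_def cf_mon split: if_splits)
    have "x * y \<in> mono_ideal (in_pow d b (Suc n))"
      if "x \<in> ideal_pow (stair_ideal d b) n" "y \<in> stair_ideal d b" for x y :: "'k poly poly"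
      by (rule mono_ideal_mult[of x "in_pow d b n" y "in_pow d b 1"])
        (use in_pow_add[of d b n _ _ 1] I1 that(1)[unfolded Suc.IH] that(2)
          in \<open>auto simp del: in_pow.simps\<close>)
    then show "ideal_pow (stair_ideal d b) (Suc n) \<subseteq> (mono_ideal (in_pow d b (Suc n)) :: 'k poly poly
      set)"
      by (rule ideal_pow_Suc_least[OF in_pow_idl])
    show "(mono_ideal (in_pow d b (Suc n)) :: 'k poly poly set) \<subseteq> ideal_pow (stair_ideal d b) (Suc n)"
    proof (rule mono_ideal_least[OF ideal_pow_idl])
      fix p q assume "in_pow d b (Suc n) p q"
      then obtain k p' q' where k: "k \<le> d" "p = d - k + p'" "q = b k + q'" "in_pow d b n p' q'"
        by (rule in_pow_SucE)
      have "(mon p' q' :: 'k poly poly) \<in> ideal_pow (stair_ideal d b) n" unfolding Suc.IH using k(4)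
        by (auto simp: mono_ideal_def cf_mon split: if_splits)
      then have "(mon p' q' :: 'k poly poly) * mon (d - k) (b k) \<in> ideal_pow (stair_ideal d b) (Suc n)"
        by (rule ideal_pow_mult_Suc[OF _ mon_in_stair[OF k(1)]])
      then show "(mon p q :: 'k poly poly) \<in> ideal_pow (stair_ideal d b) (Suc n)"
        by (simp add: mon_mult k add.commute)
    qed
  qed
qed

lemma mon_pow_stair: "mon p q \<in> (ideal_pow (stair_ideal d b) n :: 'k::comm_ring_1 poly poly set)
  \<longleftrightarrow> in_pow d b n p q"
  unfolding pow_stair by (auto simp: mono_ideal_def cf_mon)

text \<open>The points (d - k, b k) that are vertices of the lower convex hull, as lying strictly
  below every chord around them; the ends 0 and d qualify vacuously.\<close>

definition vertices :: "nat \<Rightarrow> (nat \<Rightarrow> nat) \<Rightarrow> nat set" where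
  "vertices d b = {k. k \<le> d \<and> (\<forall>i l. i < k \<longrightarrow> k < l \<longrightarrow> l \<le> d \<longrightarrow> (l - i) * b k
    < (l - k) * b i + (k - i) * b l)}"

definition col :: "nat \<Rightarrow> (nat \<Rightarrow> nat) \<Rightarrow> nat \<Rightarrow> bool" where
  "col d b k = even (card {j \<in> vertices d b. j < k})"

text \<open>Consecutive vertices lie in different reduction elements; vertices of the same parity are never
  adjacent, so their product is nilpotent in the associated graded ring.\<close>

definition reduction_elt :: "nat \<Rightarrow> (nat \<Rightarrow> nat) \<Rightarrow> bool \<Rightarrow> 'k::comm_ring_1 poly poly" where
  "reduction_elt d b c = (\<Sum>k | k \<in> vertices d b \<and> col d b k = c. mon (d - k) (b k))"

lemma vertices_le: "k \<in> vertices d b \<Longrightarrow> k \<le> d"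
  by (simp add: vertices_def)

lemma finite_vertices: "finite (vertices d b)"
  by (rule finite_subset[of _ "{..d}"]) (auto simp: vertices_def)

lemma verticesD: "k \<in> vertices d b \<Longrightarrow> i < k \<Longrightarrow> k < l \<Longrightarrow> l \<le> d \<Longrightarrow> (l - i) * b k
  < (l - k) * b i + (k - i) * b l"
  by (simp add: vertices_def)

text \<open>With no vertex in between, the ranks differ by one and have different parity.\<close>

lemma col_between:
  assumes "i \<in> vertices d b" "l \<in> vertices d b" "i < l" "col d b i = col d b l"
  shows "\<exists>m\<in>vertices d b. i < m \<and> m < l"
proof (rule ccontr)
  assume "\<not> ?thesis"
  then have "j < l \<longleftrightarrow> j = i \<or> j < i" if "j \<in> vertices d b" for j using that assms(3) by force
  then have "{j \<in> vertices d b. j < l} = insert i {j \<in> vertices d b. j < i}" using assms(1) by blast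
  moreover have "finite {j \<in> vertices d b. j < i}" using finite_vertices by simp
  ultimately have "card {j \<in> vertices d b. j < l} = Suc (card {j \<in> vertices d b. j < i})" by simp
  then show False using assms(4) by (simp add: col_def)
qed

lemma reduction_elt_in_stair: "reduction_elt d b c \<in> stair_ideal d b"
  unfolding reduction_elt_def
    by (intro whole.idl_sum[OF stair_idl] mon_in_stair) (auto dest: vertices_le)

text \<open>The parameter \<open>ty\<close> only fixes the coefficient field.\<close>

locale staircase =
  fixes d :: nat and b :: "nat \<Rightarrow> nat" and ty :: "'k::field itself"
  assumes d_pos: "0 < d" and b_0: "b 0 = 0" and b_mono: "i \<le> j \<Longrightarrow> j \<le> d \<Longrightarrow> b i \<le> b j" and b_d: "0 < b d"
begin

abbreviation I :: "'k poly poly set" where "I \<equiv> stair_ideal d b"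
abbreviation v :: "nat \<Rightarrow> 'k poly poly" where "v k \<equiv> mon (d - k) (b k)"
abbreviation m :: "'k poly poly set" where "m \<equiv> ideal_gen {mon 1 0, mon 0 1}"
abbreviation V where "V \<equiv> vertices d b"
abbreviation F :: "bool \<Rightarrow> 'k poly poly" where "F c \<equiv> reduction_elt d b c"

lemma m_proper: "1 \<notin> m"
proof -
  have "m \<subseteq> mono_ideal (\<lambda>p q. p + q > 0)"
    by (rule whole.gen_least[OF mono_ideal_idl]) (auto simp: mono_ideal_def cf_mon split: if_splits)
  moreover have "1 \<notin> mono_ideal (\<lambda>p q. p + q > 0)"
    using cf_mon[of 0 0 0 0] by (auto simp: mono_ideal_def mon_0_0)
  ultimately show ?thesis by blast
qed

lemma mon_in_m:
  assumes "p + q > 0" shows "mon p q \<in> m"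
proof -
  have g: "{mon 1 0, mon 0 1} \<subseteq> m" by (rule whole.gen_sub)
  have "mon (p - 1) q * mon 1 0 \<in> m" "mon p (q - 1) * mon 0 1 \<in> m"
    using whole.idl_mult[OF ideal_gen_idl UNIV_I] g by auto
  then show ?thesis using assms by (cases "p = 0") (auto simp: mon_mult)
qed

lemma v_pos: "k \<le> d \<Longrightarrow> (d - k) + b k > 0"
  using b_d by (cases "k = d") auto

sublocale graded m I
proof
  show "I \<subseteq> m" unfolding stair_ideal_def
    by (rule whole.gen_least[OF ideal_gen_idl]) (use mon_in_m[OF v_pos] in blast)
qed (fact stair_idl ideal_gen_idl m_proper)+

section \<open>The two degree-one elements are a system of parameters\<close>

definition max_gens where
  "max_gens = {[:mon 1 0:], [:mon 0 1:]} \<union> (\<lambda>k. monom (v k) 1) ` {..d}"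

lemma finite_max_gens: "finite max_gens" by (simp add: max_gens_def)

lemma v_in_I: "k \<le> d \<Longrightarrow> v k \<in> I" by (rule mon_in_stair)

lemma max_gens_sub: "max_gens \<subseteq> gr_max m I"
  using gr_max_gen_in[OF I, where m = m] v_in_I whole.gen_sub[of "{mon 1 0, mon 0 1}"]
  unfolding max_gens_def by auto

lemma max_gens_closed: "max_gens \<subseteq> rees I" using max_gens_sub gr_max_sub by blast

lemma max_gens_least: "idl P \<Longrightarrow> max_gens \<subseteq> P \<Longrightarrow> gr_max m I \<subseteq> P"
  unfolding stair_ideal_def by (rule gr_max_least) (auto simp: max_gens_def stair_ideal_def)

abbreviation f where "f c \<equiv> monom (F c) (Suc 0)"
abbreviation Q where "Q \<equiv> adjoin (adjoin K (f True)) (f False)"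

lemma fM: "f c \<in> gr_max m I" using gr_max_gen_in(2)[OF I reduction_elt_in_stair] by simp

lemma fA: "f c \<in> rees I" using fM gr_max_sub by blast

lemma Q: "idl Q" by (intro adjoin_idl K fA)

lemma fQ: "f c \<in> Q"
proof (cases c)
  case True
  then show ?thesis using subsetD[OF adjoin_sub adjoin_gen[OF K, of "f True"]] by simp
next
  case False
  then show ?thesis using adjoin_gen[OF adjoin_idl[OF K fA], of "f False" True] by simp
qed

lemma KQ: "K \<subseteq> Q" by (rule subset_trans[OF adjoin_sub adjoin_sub])

lemma I_K: "c \<in> I \<Longrightarrow> [:c:] \<in> K"
  using ideal_pow_1[OF I] whole.idl_zero[OF ideal_pow_idl]
  by (auto simp: gr_ker_def coeff_pCons split: nat.splits)

lemma Q_rad: "Q \<subseteq> rad Q" by (rule rad_sub) (use idl_sub[OF Q] in blast)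

lemmas radQ = rad_idl[OF Q]

lemma const_in_rad: "[:mon 1 0:] \<in> rad Q" "[:mon 0 1:] \<in> rad Q"
proof -
  have "[:mon 1 0:] ^ d = [:v 0:]" "[:mon 0 1:] ^ b d = [:v d:]" using b_0
    by (simp_all add: mon_power poly_const_pow)
  then have "[:mon 1 0:] ^ d \<in> Q" "[:mon 0 1:] ^ b d \<in> Q"
    using KQ I_K[OF v_in_I[of 0]] I_K[OF v_in_I[of d]] by auto
  then show "[:mon 1 0:] \<in> rad Q" "[:mon 0 1:] \<in> rad Q"
    using const_in_rees by (auto intro: radI)
qed

abbreviation vt where "vt k \<equiv> monom (v k) (Suc 0)"

lemma vt_A: "k \<le> d \<Longrightarrow> vt k \<in> rees I"
  using gr_max_gen_in(2)[OF I v_in_I] gr_max_sub by auto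

lemma vt_power: "vt k ^ n = monom (mon (n * (d - k)) (n * b k)) n"
  by (simp add: monom_power mon_power)

text \<open>Strict convexity at k gives v_i^(l-k) v_l^(k-i) = y^e v_k^(l-i) with e > 0, and y is
  nilpotent in the associated graded ring because y^(b d) lies in I.\<close>

lemma nonadjacent_in_rad:
  assumes "i \<in> V" "l \<in> V" "i < l" "k \<in> V" "i < k" "k < l"
  shows "vt i * vt l \<in> rad Q"
proof -
  have le: "i \<le> d" "l \<le> d" "k \<le> d" using assms vertices_le by auto
  obtain e where e: "(l - k) * b i + (k - i) * b l = (l - i) * b k + e" "0 < e"
    using verticesD[OF assms(4-6) le(2)] by (metis less_imp_add_positive)
  obtain r s t where rst: "k = i + r" "l = i + r + s" "d = i + r + s + t"
    using assms(5,6) le(2) that[of "k - i" "l - k" "d - l"] by simp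
  have "(l - k) * (d - i) + (k - i) * (d - l) = (l - i) * (d - k)"
    unfolding rst by (simp add: algebra_simps)
  then have "vt i ^ (l - k) * vt l ^ (k - i) = [:mon 0 1:] ^ e * vt k ^ (l - i)"
    using assms(5,6) e(1) unfolding vt_power
    by (simp add: mult_monom mon_mult poly_const_pow mon_power smult_monom add.commute)
  moreover have "[:mon 0 1:] ^ e \<in> rad Q"
    using e(2) idl_mult2[OF radQ power_closed[OF const_in_rees, of _ "e - 1"] const_in_rad(2)]
      by (cases e) auto
  ultimately have *: "vt i ^ (l - k) * vt l ^ (k - i) \<in> rad Q"
    using idl_mult2[OF radQ power_closed[OF vt_A[OF le(3)]]] by simp
  \<comment> \<open>The complementary powers complete both exponents to l - i.\<close>
  have "(vt i ^ (l - k) * vt l ^ (k - i)) * (vt i ^ (k - i) * vt l ^ (l - k)) \<in> rad Q"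
    by (rule idl_mult2[OF radQ _ *]) (use vt_A le in simp)
  moreover have "(vt i ^ (l - k) * vt l ^ (k - i)) * (vt i ^ (k - i) * vt l ^ (l - k))
      = (vt i ^ (l - k) * vt i ^ (k - i)) * (vt l ^ (k - i) * vt l ^ (l - k))" by (simp only: mult_ac)
  moreover have "\<dots> = (vt i * vt l) ^ (l - i)"
    using assms(5,6) by (simp flip: power_add add: power_mult_distrib)
  ultimately have "(vt i * vt l) ^ (l - i) \<in> rad Q" by (simp only:)
  then show ?thesis using vt_A le by (intro rad_root[of "vt i * vt l" "l - i"] mult_closed) simp_all
qed

text \<open>In v_i times the reduction element of its parity, every term but v_i^2 is a product of
  two nonadjacent vertices and lies in the radical.\<close>

lemma vertex_in_rad:
  assumes i: "i \<in> V" shows "vt i \<in> rad Q"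
proof -
  let ?S = "{k \<in> V. col d b k = col d b i}"
  have fS: "finite ?S" using finite_vertices by simp
  have le: "k \<le> d" if "k \<in> V" for k using that by (rule vertices_le)
  have "f (col d b i) = (\<Sum>k\<in>?S. vt k)" unfolding reduction_elt_def
    by (simp add: monom_sum Collect_conj_eq)
  also have "\<dots> = vt i + (\<Sum>k\<in>?S - {i}. vt k)" using i fS by (subst sum.remove[of _ i]) auto
  finally have "vt i * f (col d b i) = vt i * vt i + (\<Sum>k\<in>?S - {i}. vt i * vt k)"
    by (simp only: distrib_left sum_distrib_left)
  then have "vt i * vt i = vt i * f (col d b i) - (\<Sum>k\<in>?S - {i}. vt i * vt k)"
    by (simp only: add_diff_cancel_right')
  moreover have "vt i * f (col d b i) \<in> rad Q"
    using idl_mult[OF radQ vt_A[OF le[OF i]]] fQ Q_rad by blast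
  moreover have "vt i * vt k \<in> rad Q" if "k \<in> ?S - {i}" for k
  proof -
    have k: "k \<in> V" "k \<noteq> i" "col d b k = col d b i" using that by auto
    show ?thesis
    proof (cases "i < k")
      case True
      then obtain m where "m \<in> V" "i < m" "m < k" using col_between[OF i k(1)] k(3) by auto
      then show ?thesis using nonadjacent_in_rad[OF i k(1) True] by blast
    next
      case False
      then have "k < i" using k(2) by simp
      then obtain m where "m \<in> V" "k < m" "m < i" using col_between[OF k(1) i] k(3) by auto
      then show ?thesis using nonadjacent_in_rad[OF k(1) i \<open>k < i\<close>] by (subst mult.commute) blast
    qed
  qed
  ultimately have "vt i * vt i \<in> rad Q"
    by (simp only:) (intro idl_diff[OF radQ] idl_sum[OF radQ])
  then have "vt i ^ 2 \<in> rad Q" by (simp only: power2_eq_square)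
  then show ?thesis using vt_A[OF le[OF i]] by (rule rad_root[rotated])
qed

text \<open>Off the vertices, v_j^(l-i) is a multiple of v_i^(l-j) v_l^(j-i) for some i < j < l, and
  the smaller index i is covered by induction.\<close>

lemma generators_in_rad: "j \<le> d \<Longrightarrow> vt j \<in> rad Q"
proof (induction j rule: less_induct)
  case (less j)
  show ?case
  proof (cases "j \<in> V")
    case False
    with less.prems have "\<exists>i l. i < j \<and> j < l \<and> l \<le> d \<and> (l - j) * b i + (j - i) * b l \<le> (l - i) * b j"
      by (simp only: vertices_def mem_Collect_eq not_less[symmetric]) blast
    then obtain i l where il: "i < j" "j < l" "l \<le> d" "(l - j) * b i + (j - i) * b l \<le> (l - i) * b j"
      by blast
    then obtain e where e: "(l - i) * b j = (l - j) * b i + (j - i) * b l + e" using le_Suc_ex by blast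
    obtain r s t where rst: "j = i + r" "l = i + r + s" "d = i + r + s + t"
      using il that[of "j - i" "l - j" "d - l"] by simp
    have eq: "(l - j) * (d - i) + (j - i) * (d - l) = (l - i) * (d - j)"
      unfolding rst by (simp add: algebra_simps)
    have "vt j ^ (l - i) = [:mon 0 1:] ^ e * (vt i ^ (l - j) * vt l ^ (j - i))"
    proof -
      have "[:mon 0 1:] ^ e * (vt i ^ (l - j) * vt l ^ (j - i))
          = monom (mon ((l - j) * (d - i) + (j - i) * (d - l)) (e + ((l - j) * b i + (j - i) * b l)))
            ((l - j) + (j - i))"
        unfolding vt_power by (simp add: mult_monom mon_mult poly_const_pow mon_power smult_monom)
      also have "\<dots> = vt j ^ (l - i)" unfolding vt_power eq using e il by (simp add: add.commute)
      finally show ?thesis ..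
    qed
    moreover have "vt i ^ (l - j) \<in> rad Q"
    proof -
      have irad: "vt i \<in> rad Q" using less.IH[of i] il by simp
      have iA: "vt i \<in> rees I" by (rule vt_A) (use il in simp)
      have "l - j = Suc (l - j - 1)" using il by simp
      then have "vt i ^ (l - j) = vt i * vt i ^ (l - j - 1)" by (metis power_Suc)
      then show ?thesis using idl_mult2[OF radQ power_closed[OF iA] irad] by simp
    qed
    ultimately have "vt j ^ (l - i) \<in> rad Q"
      using idl_mult[OF radQ power_closed[OF const_in_rees] idl_mult2[OF radQ power_closed[OF vt_A[OF
        il(3)]]]]
      by (simp only:)
    then show ?thesis using vt_A[OF less.prems] by (rule rad_root[rotated])
  next
    case True
    then show ?thesis by (rule vertex_in_rad)
  qed
qed

lemma generators_nilpotent: "x \<in> max_gens \<Longrightarrow> \<exists>n. x ^ n \<in> Q"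
proof -
  assume "x \<in> max_gens"
  then consider "x = [:mon 1 0:]" | "x = [:mon 0 1:]" | k where "k \<le> d" "x = monom (v k) 1"
    unfolding max_gens_def by blast
  then have "x \<in> rad Q" by cases (use const_in_rad generators_in_rad in simp_all)
  then show ?thesis by (simp add: rad_def)
qed

end

section \<open>Reduction number one implies depth two\<close>

definition lin :: "'r::comm_ring_1 set \<Rightarrow> 'r set \<Rightarrow> 'r set" where
  "lin I S = {\<Sum>t\<in>S. c t * t | c. \<forall>t. c t \<in> I}"

lemma linI: "(\<And>t. c t \<in> I) \<Longrightarrow> (\<Sum>t\<in>S. c t * t) \<in> lin I S"
  by (auto simp: lin_def)

lemma lin_idl:
  assumes I: "whole.idl I" shows "whole.idl (lin I S)"
  unfolding whole.idl_def
proof (intro conjI ballI)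
  show "0 \<in> lin I S" using linI[of "\<lambda>_. 0" I S] whole.idl_zero[OF I] by simp
next
  fix x y assume "x \<in> lin I S" "y \<in> lin I S"
  then obtain c c' where "x = (\<Sum>t\<in>S. c t * t)" "y = (\<Sum>t\<in>S. c' t * t)" "\<forall>t. c t \<in> I" "\<forall>t. c' t \<in> I"
    unfolding lin_def by blast
  then show "x + y \<in> lin I S"
    using linI[of "\<lambda>t. c t + c' t" I S] whole.idl_add[OF I] by (simp add: distrib_right sum.distrib)
next
  fix a x assume "x \<in> lin I S"
  then obtain c where "x = (\<Sum>t\<in>S. c t * t)" "\<forall>t. c t \<in> I" unfolding lin_def by blast
  then show "a * x \<in> lin I S"
    using linI[of "\<lambda>t. a * c t" I S] whole.idl_mult[OF I UNIV_I]
      by (simp add: sum_distrib_left mult.assoc)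
qed simp

lemma lin_gen:
  assumes "finite S" "whole.idl I" "c \<in> I" "s \<in> S" shows "c * s \<in> lin I S"
proof -
  have "(\<Sum>t\<in>S. (if t = s then c else 0) * t) = (\<Sum>t\<in>S. if t = s then c * s else 0)"
    by (rule sum.cong) auto
  also have "\<dots> = c * s" using assms by simp
  finally show ?thesis using linI[of "\<lambda>t. if t
    = s then c else 0" I S] assms whole.idl_zero[OF assms(2)] by simp
qed

lemma lin_insert:
  assumes "finite S" "s \<notin> S" "x \<in> lin I (insert s S)"
  obtains i l where "i \<in> I" "l \<in> lin I S" "x = i * s + l"
proof -
  from assms obtain c where c: "x = (\<Sum>t\<in>insert s S. c t * t)" "\<forall>t. c t \<in> I" unfolding lin_def by blast
  then show thesis using assms that[of "c s" "\<Sum>t\<in>S. c t * t"] linI[of c I S] by simp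
qed

lemma one_minus_mult:
  assumes I: "whole.idl I" and "1 - a \<in> I" "1 - b \<in> I" shows "1 - a * b \<in> I"
proof -
  have "1 - a * b = (1 - a) + a * (1 - b)" by (simp add: algebra_simps)
  then show ?thesis using whole.idl_add[OF I assms(2) whole.idl_mult[OF I UNIV_I assms(3)]]
    by (simp only:)
qed

text \<open>Gaussian elimination with multipliers congruent to 1 modulo I in place of units: one
  generator is solved for and substituted into the others.\<close>

lemma nakayama:
  fixes I Q :: "'r::comm_ring_1 set"
  assumes "finite S" and I: "whole.idl I" and Q: "whole.idl Q"
    and "\<And>s. s \<in> S \<Longrightarrow> \<exists>e q l. 1 - e \<in> I \<and> q \<in> Q \<and> l \<in> lin I S \<and> e * s = q + l"
  shows "\<exists>e. 1 - e \<in> I \<and> (\<forall>s\<in>S. e * s \<in> Q)"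
  using assms(1,4)
proof (induction S)
  case empty
  show ?case using whole.idl_zero[OF I] by (intro exI[of _ 1]) simp
next
  case (insert s0 S)
  obtain e0 q0 l where 0: "1 - e0 \<in> I" "q0 \<in> Q" "l \<in> lin I (insert s0 S)" "e0 * s0 = q0 + l"
    using insert.prems[of s0] by blast
  obtain i0 l0 where l: "i0 \<in> I" "l0 \<in> lin I S" "l = i0 * s0 + l0"
    using lin_insert[OF insert.hyps 0(3)] by blast
  \<comment> \<open>The multiple of s0 on the right has its coefficient in I, so moving it to the
    left keeps the multiplier congruent to 1.\<close>
  define e1 where "e1 = e0 - i0"
  have e1: "1 - e1 \<in> I" using whole.idl_add[OF I 0(1) l(1)] by (simp add: e1_def algebra_simps)
  have e1s: "e1 * s0 = q0 + l0" using 0(4) l(3) by (simp add: e1_def algebra_simps)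
  have "\<exists>e q l. 1 - e \<in> I \<and> q \<in> Q \<and> l \<in> lin I S \<and> e * s = q + l" if s: "s \<in> S" for s
  proof -
    obtain e q k where *: "1 - e \<in> I" "q \<in> Q" "k \<in> lin I (insert s0 S)" "e * s = q + k"
      using insert.prems[of s] s by blast
    obtain i k' where k: "i \<in> I" "k' \<in> lin I S" "k = i * s0 + k'"
      using lin_insert[OF insert.hyps *(3)] by blast
    have "e1 * e * s = (e1 * q + i * q0) + (i * l0 + e1 * k')"
    proof -
      have "e1 * e * s = e1 * q + i * (e1 * s0) + e1 * k'" using *(4) k(3) by (simp add: algebra_simps)
      then show ?thesis unfolding e1s by (simp add: algebra_simps)
    qed
    moreover have "e1 * q + i * q0 \<in> Q"
      by (intro whole.idl_add[OF Q] whole.idl_mult[OF Q] UNIV_I *(2) 0(2))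
    moreover have "i * l0 + e1 * k' \<in> lin I S"
      by (intro whole.idl_add[OF lin_idl[OF I]] whole.idl_mult[OF lin_idl[OF I]] UNIV_I l(2) k(2))
    ultimately show ?thesis using one_minus_mult[OF I e1 *(1)] by blast
  qed
  then obtain e2 where e2: "1 - e2 \<in> I" "\<forall>s\<in>S. e2 * s \<in> Q" using insert.IH by blast
  have "e2 * l0 \<in> Q"
  proof -
    from l(2) obtain c where c: "l0 = (\<Sum>t\<in>S. c t * t)" unfolding lin_def by blast
    have "e2 * l0 = (\<Sum>t\<in>S. c t * (e2 * t))" unfolding c by (simp add: sum_distrib_left mult_ac)
    show ?thesis unfolding \<open>e2 * l0 = _\<close>
      by (rule whole.idl_sum[OF Q], rule whole.idl_mult[OF Q UNIV_I]) (use e2(2) in blast)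
  qed
  then have "e2 * q0 + e2 * l0 \<in> Q" by (intro whole.idl_add[OF Q] whole.idl_mult[OF Q UNIV_I 0(2)])
  moreover have "(e1 * e2) * s0 = e2 * (e1 * s0)" by (simp only: mult_ac)
  ultimately have "(e1 * e2) * s0 \<in> Q" by (simp only: e1s distrib_left)
  moreover have "(e1 * e2) * s \<in> Q" if "s \<in> S" for s
    using whole.idl_mult[OF Q UNIV_I, of "e2 * s" e1] e2(2) that by (simp add: mult.assoc)
  ultimately show ?case using one_minus_mult[OF I e1 e2(1)] by (intro exI[of _ "e1 * e2"]) simp
qed

lemma var_in_prime:
  fixes F :: "'k::field poly poly"
  assumes "mon 0 1 dvd F * G" shows "mon 0 1 dvd F \<or> mon 0 1 dvd G"
proof -
  have y: "mon 0 1 = [:[:0, 1 :: 'k:]:]" by (simp add: mon_def monom_0 monom_Suc)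
  have dv: "[:0, 1 :: 'k:] dvd p \<longleftrightarrow> poly p 0 = 0" for p using poly_eq_0_iff_dvd[of p 0] by simp
  have "prime_elem [:0, 1 :: 'k:]"
    by (rule prime_elemI) (simp_all add: dv)
  then have "prime_elem (mon 0 1 :: 'k poly poly)" unfolding y by (rule lift_prime_elem_poly)
  then show ?thesis using assms by (simp add: prime_elem_dvd_mult_iff)
qed

text \<open>Reduction number at most one near the origin. The summand I^3 takes the place of
  localization.\<close>

definition reduction_le1 :: "'k::comm_ring_1 itself \<Rightarrow> nat \<Rightarrow> (nat \<Rightarrow> nat) \<Rightarrow> bool" where
  "reduction_le1 ty d b \<longleftrightarrow> (\<forall>u\<in>ideal_pow (stair_ideal d b :: 'k poly poly set) (Suc (Suc 0)).
      \<exists>g\<in>stair_ideal d b. \<exists>h\<in>stair_ideal d b.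
        u - (reduction_elt d b True * g + reduction_elt d b False * h) \<in> ideal_pow (stair_ideal d b)
          (Suc (Suc (Suc 0))))"

section \<open>Regularity of the pair from the reduction condition\<close>

context staircase
begin

abbreviation pw :: "nat \<Rightarrow> 'k poly poly set" where "pw n \<equiv> ideal_pow I n"

lemma pw_idl: "whole.idl (pw n)" by (rule ideal_pow_idl)

lemma pw_1: "pw (Suc 0) = I" by (rule ideal_pow_1[OF I])

lemma pw_Suc: "u \<in> pw (Suc n) \<Longrightarrow> u \<in> pw n"
  using ideal_pow_Suc_subset by blast

lemma F_mult: "u \<in> pw n \<Longrightarrow> F c * u \<in> pw (Suc n)"
  using ideal_pow_mult_Suc[of u I n "F c"] by (simp add: mult.commute reduction_elt_in_stair)

lemma zero_vertex: "0 \<in> V" by (simp add: vertices_def)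

lemma d_vertex: "d \<in> V" by (auto simp: vertices_def)

lemma col_zero: "col d b 0" by (simp add: col_def)

lemma cf_F: "coeff (F c) p = (if p \<le> d \<and> d - p \<in> V \<and> col d b (d - p)
  = c then monom 1 (b (d - p)) else 0)"
proof -
  have "coeff (F c) p = (\<Sum>k | k \<in> V \<and> col d b k = c. if k = d - p \<and> p
    \<le> d then monom 1 (b (d - p)) else 0)"
    unfolding reduction_elt_def coeff_sum
    by (rule sum.cong) (auto simp: mon_def dest: vertices_le)
  also have "\<dots> = (\<Sum>k | k \<in> V \<and> col d b k = c. if k = d - p then (if p
    \<le> d then monom 1 (b (d - p)) else 0) else 0)"
    by (rule sum.cong) auto
  also have "\<dots> = (if d - p \<in> V \<and> col d b (d - p) = c then (if p
    \<le> d then monom 1 (b (d - p)) else 0) else 0)"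
    using finite_vertices by (subst sum.delta) auto
  finally show ?thesis by auto
qed

lemma coeff_F_d: "coeff (F True) d = 1"
  using zero_vertex col_zero b_0 by (simp add: cf_F)

lemma degree_F: "degree (F True) = d"
proof (rule antisym)
  show "degree (F True) \<le> d" by (rule degree_le) (simp add: cf_F)
  show "d \<le> degree (F True)" by (rule le_degree) (simp add: coeff_F_d)
qed

lemma F_nonzero: "F True \<noteq> 0" using coeff_F_d by auto

lemma y_not_dvd_F: "\<not> mon 0 1 dvd F True"
proof
  assume "mon 0 1 dvd F True"
  then obtain G where "F True = mon 0 1 * G" by (rule dvdE)
  then have "cf (F True) d 0 = 0" by (simp add: cf_mon_mult)
  then show False by (simp add: coeff_F_d)
qed

text \<open>F True is monic in x, so the prime y does not divide it and each power of y passes to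
  the other factor.\<close>

lemma y_power_dvd: "F True * w = mon 0 M * u \<Longrightarrow> \<exists>w'. w = mon 0 M * w'"
proof (induction M arbitrary: u w)
  case 0
  then show ?case by (simp add: mon_0_0)
next
  case (Suc M)
  have s: "mon 0 (Suc M) = (mon 0 1 * mon 0 M :: 'k poly poly)" by (simp add: mon_mult)
  have "mon 0 1 dvd F True * w" unfolding Suc.prems s by (simp add: mult.assoc)
  then obtain w1 where w1: "w = mon 0 1 * w1" using var_in_prime y_not_dvd_F by (blast elim: dvdE)
  have "mon 0 1 * (F True * w1) = mon 0 1 * (mon 0 M * u)"
    using Suc.prems unfolding w1 s by (simp add: mult_ac)
  moreover have "(mon 0 1 :: 'k poly poly) \<noteq> 0" by (simp add: mon_def)
  ultimately have "F True * w1 = mon 0 M * u" by simp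
  then obtain w2 where "w1 = mon 0 M * w2" using Suc.IH by blast
  then show ?case unfolding w1 s by (auto simp: mult.assoc)
qed

lemma J_pow_idl: "whole.idl {F True * g + F False * h | g h. g \<in> pw n \<and> h \<in> pw n}"
  unfolding whole.idl_def
proof (intro conjI ballI)
  show "0 \<in> {F True * g + F False * h | g h. g \<in> pw n \<and> h \<in> pw n}"
    using whole.idl_zero[OF pw_idl] by (intro CollectI exI[of _ 0]) simp
next
  fix x y assume "x \<in> {F True * g + F False * h | g h. g \<in> pw n \<and> h \<in> pw n}"
    "y \<in> {F True * g + F False * h | g h. g \<in> pw n \<and> h \<in> pw n}"
  then obtain g h g' h' where *: "x = F True * g + F False * h" "y = F True * g' + F False * h'"
    "g \<in> pw n" "h \<in> pw n" "g' \<in> pw n" "h' \<in> pw n" by blast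
  have "x + y = F True * (g + g') + F False * (h + h')" unfolding * by (simp add: algebra_simps)
  then show "x + y \<in> {F True * g + F False * h | g h. g \<in> pw n \<and> h \<in> pw n}"
    using whole.idl_add[OF pw_idl *(3,5)] whole.idl_add[OF pw_idl *(4,6)] by blast
next
  fix a x assume "x \<in> {F True * g + F False * h | g h. g \<in> pw n \<and> h \<in> pw n}"
  then obtain g h where *: "x = F True * g + F False * h" "g \<in> pw n" "h \<in> pw n" by blast
  have "a * x = F True * (a * g) + F False * (a * h)" unfolding * by (simp add: algebra_simps)
  then show "a * x \<in> {F True * g + F False * h | g h. g \<in> pw n \<and> h \<in> pw n}"
    using whole.idl_mult[OF pw_idl UNIV_I *(2)] whole.idl_mult[OF pw_idl UNIV_I *(3)] by blast
qed simp

lemma reduction_le1_unit: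
  assumes "reduction_le1 TYPE('k) d b"
  shows "\<exists>e. 1 - e \<in> I \<and> (\<forall>n. \<forall>u\<in>pw (Suc (Suc n)). \<exists>g\<in>pw (Suc n). \<exists>h\<in>pw (Suc n). e * u
    = F True * g + F False * h)"
proof -
  \<comment> \<open>Products of two generators span I^2, and I^3 is contained in I times their span;
    so I^2 <= J I + I^3 has the shape required by Nakayama.\<close>
  define S where "S = (\<lambda>(i, j). v i * v j) ` ({..d} \<times> {..d})"
  have fS: "finite S" by (simp add: S_def)
  let ?J = "\<lambda>n. {F True * g + F False * h | g h. g \<in> pw n \<and> h \<in> pw n}"
  have vv: "v i * v j \<in> S" if "i \<le> d" "j \<le> d" for i j using that by (auto simp: S_def)
  have dec2: "\<exists>r s t. t \<in> S \<and> mon p q = mon r s * t" if mem2: "in_pow d b (Suc (Suc 0)) p q" for p q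
  proof -
    obtain i p1 q1 where i: "i \<le> d" "p = d - i + p1" "q = b i + q1" "in_pow d b (Suc 0) p1 q1"
      using mem2 by (rule in_pow_SucE)
    obtain j p2 q2 where j: "j \<le> d" "p1 = d - j + p2" "q1 = b j + q2" using i(4) by (rule in_pow_SucE)
    have "mon p q = mon p2 q2 * (v i * v j)" unfolding i j by (simp add: mon_mult add_ac)
    then show ?thesis using vv[OF i(1) j(1)] by blast
  qed
  have pw2: "pw (Suc (Suc 0)) \<subseteq> lin UNIV S" unfolding pow_stair
  proof (rule mono_ideal_least[OF lin_idl])
    fix p q assume "in_pow d b (Suc (Suc 0)) p q"
    then obtain r s t where "t \<in> S" "mon p q = (mon r s * t :: 'k poly poly)" using dec2 by blast
    then show "mon p q \<in> lin UNIV S" using lin_gen[OF fS, of UNIV "mon r s" t]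
      by (simp add: whole.idl_def)
  qed (simp add: whole.idl_def)
  have pw3: "pw (Suc (Suc (Suc 0))) \<subseteq> lin I S" unfolding pow_stair
  proof (rule mono_ideal_least[OF lin_idl[OF I]])
    fix p q assume "in_pow d b (Suc (Suc (Suc 0))) p q"
    then obtain k p1 q1 where k: "k \<le> d" "p = d - k + p1" "q
      = b k + q1" "in_pow d b (Suc (Suc 0)) p1 q1"
      by (rule in_pow_SucE)
    obtain r s t where rst: "t \<in> S" "mon p1 q1 = (mon r s * t :: 'k poly poly)" using dec2[OF k(4)]
      by blast
    have "mon p q = v k * mon p1 q1" by (simp add: k mon_mult)
    also have "\<dots> = (mon r s * v k) * t" unfolding rst(2) by (simp only: mult_ac)
    finally show "mon p q \<in> lin I S"
      using lin_gen[OF fS I whole.idl_mult[OF I UNIV_I v_in_I[OF k(1)]] rst(1)] by simp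
  qed
  have "\<exists>e. 1 - e \<in> I \<and> (\<forall>s\<in>S. e * s \<in> ?J (Suc 0))"
  proof (rule nakayama[OF fS I J_pow_idl])
    fix s assume "s \<in> S"
    then have "s \<in> pw (Suc (Suc 0))" using v_in_I ideal_pow_mult_Suc[of _ I "Suc 0"] pw_1
      by (auto simp: S_def)
    then obtain g h where gh: "g \<in> I" "h \<in> I" "s - (F True * g + F False * h) \<in> pw (Suc (Suc (Suc 0)))"
      using assms unfolding reduction_le1_def by blast
    have "1 * s = (F True * g + F False * h) + (s - (F True * g + F False * h))" by simp
    then show "\<exists>e q l. 1 - e \<in> I \<and> q \<in> ?J (Suc 0) \<and> l \<in> lin I S \<and> e * s = q + l"
      using gh pw3 whole.idl_zero[OF I] pw_1
      by (intro exI[of _ 1] exI[of _ "F True * g + F False * h"] exI[of _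
        "s - (F True * g + F False * h)"] conjI) auto
  qed
  then obtain e where e: "1 - e \<in> I" "\<forall>s\<in>S. e * s \<in> ?J (Suc 0)" by blast
  \<comment> \<open>One e serves for every n, because further factors from I pass into the
    cofactors.\<close>
  have "pw (Suc (Suc n)) \<subseteq> {u. e * u \<in> ?J (Suc n)}" for n
  proof (induction n)
    case 0
    show ?case
    proof
      fix u assume "u \<in> pw (Suc (Suc 0))"
      then obtain c where c: "u = (\<Sum>t\<in>S. c t * t)" using pw2 unfolding lin_def by blast
      have "e * u = (\<Sum>t\<in>S. c t * (e * t))" unfolding c by (simp add: sum_distrib_left mult_ac)
      have "e * u \<in> ?J (Suc 0)" unfolding \<open>e * u = _\<close>
        by (rule whole.idl_sum[OF J_pow_idl], rule whole.idl_mult[OF J_pow_idl UNIV_I]) (use e(2)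
          in blast)
      then show "u \<in> {u. e * u \<in> ?J (Suc 0)}" by blast
    qed
  next
    case (Suc n)
    show ?case
    proof (rule ideal_pow_Suc_least[OF idl_preimage_mult[OF J_pow_idl]])
      fix x y assume x: "x \<in> pw (Suc (Suc n))" and y: "y \<in> I"
      then obtain g h where gh: "g \<in> pw (Suc n)" "h \<in> pw (Suc n)" "e * x = F True * g + F False * h"
        using Suc.IH by blast
      have "e * (x * y) = (e * x) * y" by (simp add: mult_ac)
      also have "\<dots> = F True * (g * y) + F False * (h * y)" unfolding gh(3) by (simp add: algebra_simps)
      finally show "x * y \<in> {u. e * u \<in> ?J (Suc (Suc n))}"
        using ideal_pow_mult_Suc[OF gh(1) y] ideal_pow_mult_Suc[OF gh(2) y] by blast
    qed
  qed
  then show ?thesis using e(1) by blast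
qed

text \<open>Since 1 - e lies in I, multiplication by e is the identity on I^n modulo
  I^(n+1).\<close>

lemma unit_cancel:
  assumes "1 - e \<in> I" "e * g \<in> pw (Suc n)" "g \<in> pw n"
  shows "g \<in> pw (Suc n)"
proof -
  have "g = e * g + g * (1 - e)" by (simp add: algebra_simps)
  then show ?thesis using whole.idl_add[OF pw_idl assms(2) ideal_pow_mult_Suc[OF assms(3,1)]] by simp
qed

text \<open>An argument in the style of Valabrega and Valla: two representations of e u in J differ
  by a syzygy, syzygies are trivial up to e, and the factors e are cancelled in gr.\<close>

lemma reduction_le1_regular:
  assumes "reduction_le1 TYPE('k) d b"
  shows "nzd K (f True) \<and> nzd (adjoin K (f True)) (f False)"
proof -
  obtain e where e: "1 - e \<in> I" and
    eJ: "\<And>n u. u \<in> pw (Suc (Suc n)) \<Longrightarrow> \<exists>g\<in>pw (Suc n). \<exists>h\<in>pw (Suc n). e * u = F True * g + F False * h"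
    using reduction_le1_unit[OF assms] by blast
  \<comment> \<open>y^(2 b d) is the square of the generator v d, so e y^M lies in J.\<close>
  let ?M = "Suc (Suc 0) * b d"
  have "mon 0 ?M \<in> pw (Suc (Suc 0))" unfolding mon_pow_stair by (rule in_pow_y) simp
  then obtain \<alpha> \<beta> where ab: "e * mon 0 ?M = F True * \<alpha> + F False * \<beta>" using eJ by blast
  \<comment> \<open>Combining a syzygy with e y^M \<in> J yields its would-be cofactor times y^M.
    Divisibility by y^M can be undone since F True is prime to y.\<close>
  have exact: "\<exists>w. e * g = F False * w \<and> e * h = - (F True * w)" if gh: "F True * g + F False * h = 0"
    for g h
  proof -
    have "F True * (\<alpha> * h - \<beta> * g) = (F True * \<alpha> + F False * \<beta>) * h - \<beta> * (F True * g + F False * h)"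
      by (simp add: algebra_simps)
    also have "\<dots> = mon 0 ?M * (e * h)" unfolding ab[symmetric] gh by (simp add: mult_ac)
    finally have eq: "F True * (\<alpha> * h - \<beta> * g) = mon 0 ?M * (e * h)" .
    then obtain w where w: "\<alpha> * h - \<beta> * g = mon 0 ?M * w" using y_power_dvd by blast
    have "mon 0 ?M * (e * h) = F True * (mon 0 ?M * w)"
      using eq unfolding w by (rule sym)
    then have "mon 0 ?M * (e * h) = mon 0 ?M * (F True * w)" by (simp only: mult_ac)
    moreover have "(mon 0 ?M :: 'k poly poly) \<noteq> 0" by (simp add: mon_def)
    ultimately have eh: "e * h = F True * w" by simp
    have "F True * g = - (F False * h)" using gh by (simp add: eq_neg_iff_add_eq_0)
    then have "F True * (e * g) = - (F False * (e * h))" by (simp add: mult.left_commute)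
    also have "\<dots> = F True * (- (F False * w))" unfolding eh by (simp add: mult_ac)
    finally have "e * g = - (F False * w)" by (simp only: mult_left_cancel[OF F_nonzero])
    then show ?thesis using eh by (intro exI[of _ "- w"]) simp
  qed
  have W: "F True * w \<in> pw (Suc n) \<Longrightarrow> w \<in> pw n" for n w
  proof (induction n arbitrary: w)
    case 0
    show ?case by simp
  next
    case (Suc n)
    obtain g h where gh: "g \<in> pw (Suc n)" "h \<in> pw (Suc n)" "e * (F True * w) = F True * g + F False * h"
      using eJ[OF Suc.prems] by blast
    then have "F True * (e * w - g) + F False * (- h) = 0" by (simp add: algebra_simps)
    then obtain t where t: "e * (e * w - g) = F False * t" "e * (- h) = - (F True * t)"
      using exact by blast
    have "F True * t = e * h" using t(2) by simp
    then have "F True * t \<in> pw (Suc n)" using whole.idl_mult[OF pw_idl UNIV_I gh(2)] by simp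
    then have "t \<in> pw n" by (rule Suc.IH)
    then have "F False * t \<in> pw (Suc n)" by (rule F_mult)
    moreover have "e * (e * w) = F False * t + e * g" using t(1) by (simp add: algebra_simps)
    ultimately have eew: "e * (e * w) \<in> pw (Suc n)"
      using whole.idl_add[OF pw_idl _ whole.idl_mult[OF pw_idl UNIV_I gh(1)]] by simp
    \<comment> \<open>Cancelling the two factors e requires w to lie in I^n beforehand; the
      induction hypothesis applied to w itself gives this.\<close>
    have w: "w \<in> pw n" by (rule Suc.IH) (rule pw_Suc[OF Suc.prems])
    then have "e * w \<in> pw n" using whole.idl_mult[OF pw_idl UNIV_I] by blast
    then have "e * w \<in> pw (Suc n)" by (rule unit_cancel[OF e eew])
    then show ?case using w by (rule unit_cancel[OF e])
  qed
  have "nzd K (f True)" unfolding One_nat_def[symmetric]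
    by (rule nzd_monomI) (use W in simp)
  moreover have "nzd (adjoin K (f True)) (f False)"
    unfolding One_nat_def[symmetric]
  proof (rule nzd_adjoin_monomI[OF reduction_elt_in_stair])
    fix n g h assume g: "g \<in> pw n" and h: "h \<in> pw n" and gh: "F True * h + F False * g \<in> pw (n + 2)"
    have "F True * h + F False * g \<in> pw (Suc (Suc n))" using gh by simp
    then obtain \<gamma> \<delta> where gd: "\<gamma> \<in> pw (Suc n)" "\<delta> \<in> pw (Suc n)"
       "e * (F True * h + F False * g) = F True * \<gamma> + F False * \<delta>" using eJ by blast
    have "F True * (e * h - \<gamma>) + F False * (e * g - \<delta>) =
       e * (F True * h + F False * g) - (F True * \<gamma> + F False * \<delta>)" by (simp add: algebra_simps)
    then obtain t where t: "e * (e * g - \<delta>) = - (F True * t)" using exact unfolding gd(3) by force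
    have eq: "F True * t = e * \<delta> - e * (e * g)"
    proof -
      have "F True * t = - (e * (e * g - \<delta>))" unfolding t by simp
      then show ?thesis by (simp only: right_diff_distrib minus_diff_eq)
    qed
    have ed: "e * \<delta> \<in> pw (Suc n)" using whole.idl_mult[OF pw_idl UNIV_I gd(2)] .
    have en: "1 - e * e \<in> I" by (rule one_minus_mult[OF I e e])
    have "g * (1 - e * e) + e * \<delta> \<in> pw (Suc n)"
      by (rule whole.idl_add[OF pw_idl ideal_pow_mult_Suc[OF g en] ed])
    moreover have "g * (1 - e * e) + e * \<delta> = g - F True * (- t)"
      unfolding mult_minus_right eq by (simp add: algebra_simps)
    ultimately have gt: "g - F True * (- t) \<in> pw (Suc n)" by simp
    show "\<exists>w. (n = 0 \<longrightarrow> w = 0) \<and> w \<in> pw (n - 1) \<and> g - F True * w \<in> pw (Suc n)"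
    \<comment> \<open>In degree zero there is no room for a cofactor, but F True t already lies in
      I, so g does too.\<close>
    proof (cases n)
      case 0
      have "F True * t \<in> pw (Suc 0)" by (rule F_mult) simp
      from whole.idl_diff[OF pw_idl _ this] gt 0 have "g \<in> pw (Suc n)" by fastforce
      then show ?thesis using 0 by (intro exI[of _ 0]) simp
    next
      case (Suc k)
      have "F True * t \<in> pw n" unfolding eq
        using whole.idl_diff[OF pw_idl pw_Suc[OF ed]] whole.idl_mult[OF pw_idl UNIV_I] g by blast
      then have "t \<in> pw k" unfolding Suc by (rule W)
      then have "- t \<in> pw k" by (rule whole.idl_uminus[OF pw_idl])
      then show ?thesis using gt Suc by (intro exI[of _ "- t"]) simp
    qed
  qed
  ultimately show ?thesis by blast
qed

text \<open>Triviality of the relation makes the constants g and h multiples of degree-one elements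
  modulo K; in degree zero nothing but I remains.\<close>

lemma regular_pair_linear:
  assumes "gr_regular_seq m I [g1, g2]" and gh: "F True * g + F False * h \<in> pw (Suc (Suc 0))"
  shows "g \<in> I \<and> h \<in> I"
proof -
  have g12: "g1 \<in> gr_max m I" "g2 \<in> gr_max m I" "nzd K g1" "nzd (adjoin K g1) g2"
    using assms(1) regular_2 by auto
  have "f True * [:g:] + f False * [:h:] = monom (F True * g + F False * h) (Suc 0)"
    by (simp add: smult_monom add_monom mult.commute)
  also have "\<dots> \<in> K" using gh whole.idl_zero[OF pw_idl] by (auto simp: gr_ker_def)
  finally obtain w where "[:g:] - f False * w \<in> K" "[:h:] + f True * w \<in> K"
    using koszul_H1[OF K fA fA finite_max_gens max_gens_closed max_gens_least generators_nilpotent g12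
      const_in_rees const_in_rees] by blast
  then have "coeff ([:g:] - f False * w) 0 \<in> pw (Suc 0)" "coeff ([:h:] + f True * w) 0 \<in> pw (Suc 0)"
    unfolding gr_ker_def by blast+
  then show ?thesis by (simp add: pw_1 monom_mult_coeff)
qed

text \<open>Stands in for the bound of the depth by the dimension.\<close>

lemma no_triple:
  assumes "nzd K (f True)" "nzd (adjoin K (f True)) (f False)"
  shows "\<not> gr_regular_seq m I [g1, g2, g3]"
proof
  assume "gr_regular_seq m I [g1, g2, g3]"
  then have g: "g1 \<in> gr_max m I" "g2 \<in> gr_max m I" "g3 \<in> gr_max m I"
      "nzd K g1" "nzd (adjoin K g1) g2" "nzd (adjoin (adjoin K g1) g2) g3" using regular_3 by auto
  have "Q \<subseteq> ideal_gen_in (rees I) (K \<union> gr_max m I)"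
  proof -
    have *: "idl (ideal_gen_in (rees I) (K \<union> gr_max m I))"
      by (rule gen_idl) (use idl_sub[OF K] gr_max_sub in blast)
    show ?thesis using gen_sub[of "K \<union> gr_max m I"] fM by (intro adjoin_least[OF *]) auto
  qed
  then have "1 \<notin> Q" using proper by blast
  then show False using no_regular_triple[OF K fA fA assms finite_max_gens max_gens_closed
    max_gens_least generators_nilpotent _ g] by blast
qed

end

section \<open>Positive depth\<close>

definition colon_stable :: "nat \<Rightarrow> (nat \<Rightarrow> nat) \<Rightarrow> bool" where
  "colon_stable d b \<longleftrightarrow> (\<forall>n p q. (\<forall>k\<le>d. in_pow d b (Suc n) (d - k + p) (b k + q)) \<longrightarrow> in_pow d b n p q)"

lemma in_pow_SucD: "in_pow d b (Suc n) p q \<Longrightarrow> in_pow d b n p q"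
  by (elim in_pow_SucE) (simp only: in_pow_up)

lemma in_pow_antimono: "m \<le> n \<Longrightarrow> in_pow d b n p q \<Longrightarrow> in_pow d b m p q"
  by (induction rule: dec_induct) (auto dest: in_pow_SucD simp del: in_pow.simps)

context staircase
begin

text \<open>A monomial u violating the colon condition at n has an order j < n. The class of u t^j
  is nonzero, killed by I, and killed by I t because I u lies in I^(n+1), hence in I^(j+2). It
  forces a nonzero socle element, which g would kill.\<close>

lemma colon_stable_if_nzd:
  assumes g: "g \<in> gr_max m I" "nzd K g" shows "colon_stable d b"
  unfolding colon_stable_def
proof (intro allI impI, rule ccontr)
  fix n p q assume u: "\<forall>k\<le>d. in_pow d b (Suc n) (d - k + p) (b k + q)" and not: "\<not> in_pow d b n p q"
  define j where "j = (GREATEST j. in_pow d b j p q)"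
  have bound: "i \<le> n" if "in_pow d b i p q" for i using in_pow_antimono[of n i] not that
    by (meson nat_le_linear)
  have j: "in_pow d b j p q" unfolding j_def by (rule GreatestI_nat[of _ 0 n]) (use bound in auto)
  have jS: "\<not> in_pow d b (Suc j) p q"
    using Greatest_le_nat[of "\<lambda>j. in_pow d b j p q" "Suc j" n] bound unfolding j_def by fastforce
  have "j < n" using bound[OF j] not j by (cases "j = n") auto
  let ?z = "monom (mon p q) j"
  have zA: "?z \<in> rees I" using j by (intro monom_in_rees) (simp add: mon_pow_stair)
  have zK: "?z \<notin> K"
  proof
    assume "?z \<in> K"
    then have "coeff ?z j \<in> pw (Suc j)" unfolding gr_ker_def by blast
    then show False using jS by (simp add: mon_pow_stair del: in_pow.simps)
  qed
  \<comment> \<open>This set contains a power of each element of \<open>max_gens\<close>, as x^d and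
    y^(b d) lie in I.\<close>
  let ?Q = "(\<lambda>c. [:c:]) ` I \<union> (\<lambda>k. monom (v k) 1) ` {..d}"
  have "\<exists>z'\<in>rees I. z' \<notin> K \<and> (\<forall>q\<in>?Q. q * z' \<in> K) \<and> (\<forall>g\<in>gr_max m I. g * z' \<in> K)"
  proof (rule socle_ideal[OF finite_max_gens max_gens_closed max_gens_least K _ _ zA zK])
    show "?Q \<subseteq> rees I" using vt_A by (simp add: image_subset_iff const_in_rees)
  next
    fix x assume "x \<in> max_gens"
    then consider "x = [:mon 1 0:]" | "x = [:mon 0 1:]" | k where "k \<le> d" "x = monom (v k) 1"
      unfolding max_gens_def by blast
    then show "\<exists>n. x ^ n \<in> ?Q"
    proof cases
      case 1
      then have "x ^ d = [:v 0:]" using b_0 by (simp add: poly_const_pow mon_power)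
      then show ?thesis using v_in_I[of 0] by (intro exI[of _ d]) simp
    next
      case 2
      then have "x ^ b d = [:v d:]" by (simp add: poly_const_pow mon_power)
      then show ?thesis using v_in_I[of d] by (intro exI[of _ "b d"]) simp
    next
      case 3
      then show ?thesis by (intro exI[of _ 1]) auto
    qed
  next
    fix x assume "x \<in> ?Q"
    then consider c where "c \<in> I" "x = [:c:]" | k where "k \<le> d" "x = monom (v k) 1" by blast
    then show "x * ?z \<in> K"
    proof cases
      case 1
      have "mon p q * c \<in> pw (Suc j)" using ideal_pow_mult_Suc[OF _ 1(1)] j by (simp add: mon_pow_stair)
      then show ?thesis using 1 whole.idl_zero[OF pw_idl]
        by (simp add: smult_monom gr_ker_def mult.commute)
    next
      case 2
      have "in_pow d b (Suc (Suc j)) (d - k + p) (b k + q)"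
        using u 2(1) \<open>j < n\<close> in_pow_antimono[of "Suc (Suc j)" "Suc n"] by (simp del: in_pow.simps)
      then have "v k * mon p q \<in> pw (Suc (Suc j))"
        by (simp add: mon_mult mon_pow_stair del: in_pow.simps)
      then show ?thesis using 2 whole.idl_zero[OF pw_idl] by (simp add: mult_monom gr_ker_def)
    qed
  qed
  then show False using g nzdD by blast
qed

definition tail :: "nat \<Rightarrow> 'k poly poly" where "tail k = (\<Sum>j\<in>{k..d}. v j)"

lemma tail_Suc: "k \<le> d \<Longrightarrow> tail k = v k + tail (Suc k)"
  unfolding tail_def by (simp add: sum.atLeast_Suc_atMost)

definition bad_exps :: "nat \<Rightarrow> 'k poly poly \<Rightarrow> (nat \<times> nat) set" where
  "bad_exps n g = {(p, q). cf g p q \<noteq> 0 \<and> \<not> in_pow d b (Suc n) p q}"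

lemma finite_bad_exps: "finite (bad_exps n g)"
proof (rule finite_subset)
  show "bad_exps n g \<subseteq> (SIGMA p:{..degree g}. {..degree (coeff g p)})"
    unfolding bad_exps_def by (auto intro!: le_degree simp del: in_pow.simps)
qed simp

lemma bad_exps_empty: "bad_exps n g = {} \<Longrightarrow> g \<in> pw (Suc n)"
  unfolding pow_stair mono_ideal_def bad_exps_def by (auto simp del: in_pow.simps)

text \<open>In \<open>gr_I(R)\<close>, a nonzero element annihilated by the sum of all generators has a nonzero
  multiple annihilated by each of them: the generator \<open>v k\<close> of largest \<open>x\<close>-degree kills the leading
  term, so multiplication by a power of \<open>v k\<close> annihilates the element term by term.\<close>

lemma tail_colon:
  assumes R: "colon_stable d b" and "k \<le> Suc d"
  shows "g \<in> pw n \<Longrightarrow> (\<And>j. j < k \<Longrightarrow> v j * g \<in> pw (n + 2)) \<Longrightarrow> tail k * g \<in> pw (n + 2) \<Longrightarrow> g \<in> pw (Suc n)"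
  using assms(2)
proof (induction k arbitrary: n g rule: inc_induct)
  case base
  show ?case unfolding pow_stair mono_ideal_def
  proof (intro CollectI allI impI)
    fix p q assume nz: "cf g p q \<noteq> 0"
    have "in_pow d b (Suc (Suc n)) (d - j + p) (b j + q)" if "j \<le> d" for j
    proof -
      have "v j * g \<in> mono_ideal (in_pow d b (n + 2))" using base.prems(2)[of j] that
        unfolding pow_stair by simp
      moreover have "cf (v j * g) (d - j + p) (b j + q) \<noteq> 0" using nz by (simp add: cf_mon_mult)
      ultimately show ?thesis unfolding mono_ideal_def by (simp del: in_pow.simps)
    qed
    then show "in_pow d b (Suc n) p q" using R unfolding colon_stable_def by blast
  qed
next
  case (step k)
  have kd: "k \<le> d" using step.hyps by simp
  from step.prems show ?case
  proof (induction "card (bad_exps n g)" arbitrary: n g rule: less_induct)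
    case less
    show ?case
    proof (cases "bad_exps n g = {}")
      case False
      \<comment> \<open>The leading term: among the terms of g outside I^(n+1), one of largest
        x-exponent.\<close>
      obtain p q where pq: "(p, q) \<in> bad_exps n g" and max: "\<And>p' q'. (p', q') \<in> bad_exps n g \<Longrightarrow> p' \<le> p"
      proof -
        have "finite (fst ` bad_exps n g)" "fst ` bad_exps n g \<noteq> {}" using finite_bad_exps False by auto
        then have "Max (fst ` bad_exps n g) \<in> fst ` bad_exps n g" "\<And>x. x \<in> fst ` bad_exps n g \<Longrightarrow> x
          \<le> Max (fst ` bad_exps n g)"
          using Max_in[of "fst ` bad_exps n g"] Max_ge[of "fst ` bad_exps n g"] by blast+
        then show thesis using that by (metis (no_types, lifting) fst_conv imageE imageI prod.collapse)
      qed
      define P q' where P: "P = d - k + p" and q': "q' = b k + q"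
      \<comment> \<open>A later v j has smaller x-degree, so its contribution to this exponent comes
        from a term of g beyond the leading one, which lies in I^(n+1). Without any such
        contribution the term survives in \<open>tail k * g\<close>.\<close>
      have killed: "in_pow d b (n + 2) P q'"
      proof (cases "\<exists>j\<in>{Suc k..d}. cf (v j * g) P q' \<noteq> 0")
        case True
        then obtain j where j: "k < j" "j \<le> d" "cf (v j * g) P q' \<noteq> 0" by (auto simp: Suc_le_eq)
        then have le: "d - j \<le> P" "b j \<le> q'" and nz: "cf g (P - (d - j)) (q' - b j) \<noteq> 0"
          by (auto simp: cf_mon_mult split: if_splits)
        have "p < P - (d - j)" using j P by linarith
        then have "(P - (d - j), q' - b j) \<notin> bad_exps n g" using max by (meson not_less)
        then have "in_pow d b (Suc n) (P - (d - j)) (q' - b j)" using nz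
          by (simp add: bad_exps_def del: in_pow.simps)
        from in_pow_SucI[OF j(2) this] show ?thesis using le by simp
      next
        case False
        have "cf (tail k * g) P q' = cf (v k * g) P q' + cf (tail (Suc k) * g) P q'"
          using tail_Suc[OF kd] by (simp add: distrib_right)
        moreover have "cf (tail (Suc k) * g) P q' = 0"
          using False unfolding tail_def by (simp add: sum_distrib_right coeff_sum)
        ultimately have "cf (tail k * g) P q' = cf g p q" by (simp add: cf_mon_mult P q')
        then have "cf (tail k * g) P q' \<noteq> 0" using pq by (simp add: bad_exps_def)
        then show ?thesis using less.prems(3) unfolding pow_stair mono_ideal_def by blast
      qed
      have up: "v k * u \<in> pw (Suc i)" if "u \<in> pw i" for u i
        using ideal_pow_mult_Suc[OF that v_in_I[OF kd]] by (simp add: mult.commute)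
      \<comment> \<open>Multiplication by v k shifts the bad exponents and removes the leading one,
        so the inner induction on their number applies.\<close>
      have "bad_exps (Suc n) (v k * g) \<subseteq> (\<lambda>(p, q). (d - k + p, b k + q)) ` (bad_exps n g - {(p, q)})"
      proof
        fix x assume x: "x \<in> bad_exps (Suc n) (v k * g)"
        obtain p1 q1 where x': "x = (p1, q1)" by (cases x)
        have le: "d - k \<le> p1" "b k \<le> q1" and nz: "cf g (p1 - (d - k)) (q1 - b k) \<noteq> 0"
          and nm: "\<not> in_pow d b (Suc (Suc n)) p1 q1"
          using x unfolding x' bad_exps_def
            by (auto simp: cf_mon_mult simp del: in_pow.simps split: if_splits)
        have "\<not> in_pow d b (Suc n) (p1 - (d - k)) (q1 - b k)"
          using in_pow_SucI[OF kd, of b "Suc n" "p1 - (d - k)" "q1 - b k"] le nm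
            by (auto simp del: in_pow.simps)
        then have "(p1 - (d - k), q1 - b k) \<in> bad_exps n g" using nz
          by (simp add: bad_exps_def del: in_pow.simps)
        moreover have "(p1 - (d - k), q1 - b k) \<noteq> (p, q)" using killed nm le unfolding P q'
          by (auto simp del: in_pow.simps)
        ultimately show "x \<in> (\<lambda>(p, q). (d - k + p, b k + q)) ` (bad_exps n g - {(p, q)})"
          unfolding x' using le by (intro image_eqI[of _ _ "(p1 - (d - k), q1 - b k)"]) auto
      qed
      then have "card (bad_exps (Suc n) (v k * g)) \<le> card (bad_exps n g - {(p, q)})"
        using finite_bad_exps by (meson card_image_le card_mono finite_Diff finite_imageI le_trans)
      also have "\<dots> < card (bad_exps n g)" using card_Diff1_less[OF finite_bad_exps pq] .
      finally have "v k * g \<in> pw (Suc (Suc n))"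
      proof (rule less.hyps)
        show "v k * g \<in> pw (Suc n)" using up less.prems(1) .
        show "v j * (v k * g) \<in> pw (Suc n + 2)" if "j < k" for j
          using up[OF less.prems(2)[OF that]] by (simp add: mult.left_commute)
        show "tail k * (v k * g) \<in> pw (Suc n + 2)"
          using up[OF less.prems(3)] by (simp add: mult.left_commute)
      qed
      \<comment> \<open>Now v k kills g on its own and can leave the tail for the list of generators
        known to do so.\<close>
      then have vk: "v k * g \<in> pw (n + 2)" by simp
      show ?thesis
      proof (rule step.IH[OF less.prems(1)])
        show "v j * g \<in> pw (n + 2)" if "j < Suc k" for j
          using that vk less.prems(2) by (cases "j = k") auto
        have "tail (Suc k) * g = tail k * g - v k * g" using tail_Suc[OF kd]
          by (simp add: algebra_simps)
        then show "tail (Suc k) * g \<in> pw (n + 2)" using whole.idl_diff[OF pw_idl less.prems(3) vk]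
          by simp
      qed
    qed (rule bad_exps_empty)
  qed
qed

lemma nzd_if_colon_stable:
  assumes "colon_stable d b" shows "gr_regular_seq m I [monom (tail 0) 1]"
  unfolding regular_1
proof
  have "tail 0 \<in> I" unfolding tail_def by (intro whole.idl_sum[OF I] v_in_I) simp
  then show "monom (tail 0) 1 \<in> gr_max m I" by (rule gr_max_gen_in(2)[OF I])
  show "nzd K (monom (tail 0) 1)"
    by (rule nzd_monomI) (rule tail_colon[OF assms, of 0], auto)
qed

end

section \<open>Depth two implies reduction number one\<close>

context staircase
begin

text \<open>The condition \<open>0 < b l\<close> discards a horizontal edge, which occurs for the transform when \<open>a 1 = 1\<close>.\<close>

definition edges :: "(nat \<times> nat) set" where
  "edges = {(i, l). i \<in> V \<and> l \<in> V \<and> i < l \<and> (\<forall>k\<in>V. \<not> (i < k \<and> k < l)) \<and> 0 < b l}"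

text \<open>The linear form is constant on the edge; \<open>edge_order\<close> normalises this constant to 1.\<close>

definition edge_form :: "nat \<times> nat \<Rightarrow> real \<Rightarrow> real \<Rightarrow> real" where
  "edge_form e p q = (real (snd e) - real (fst e)) * q + (real (b (snd e)) - real (b (fst e))) * p"

definition edge_order :: "nat \<times> nat \<Rightarrow> real \<Rightarrow> real \<Rightarrow> real" where
  "edge_order e p q = edge_form e p q / edge_form e (real (d - fst e)) (real (b (fst e)))"

abbreviation val :: "nat \<times> nat \<Rightarrow> nat \<Rightarrow> real" where
  "val e k \<equiv> edge_form e (real (d - k)) (real (b k))"

section \<open>Edges support the Newton polygon\<close>

lemma edgesD:
  assumes "(i, l) \<in> edges"
  shows "i \<in> V" "l \<in> V" "i < l" "l \<le> d" "0 < b l" "b i < b l"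
proof -
  show *: "i \<in> V" "l \<in> V" "i < l" "0 < b l" using assms by (auto simp: edges_def)
  then show "l \<le> d" using vertices_le by blast
  then have le: "b i \<le> b l" using * b_mono by simp
  show "b i < b l"
  proof (rule ccontr)
    assume "\<not> b i < b l"
    then have eq: "b i = b l" using le by simp
    then have "0 < i" using * b_0 by (cases i) auto
    then have "l * b i < i * b l" using verticesD[OF *(1), of 0 l] * \<open>l \<le> d\<close> b_0 by simp
    then show False using eq * by simp
  qed
qed

lemma edges_consecutive: "(i, l) \<in> edges \<Longrightarrow> k \<in> V \<Longrightarrow> i < k \<Longrightarrow> k < l \<Longrightarrow> False"
  by (auto simp: edges_def)

lemma val_eq: "(i, l) \<in> edges \<Longrightarrow> val (i, l) l = val (i, l) i"
  using edgesD[of i l] by (simp add: edge_form_def of_nat_diff algebra_simps)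

lemma val_pos: assumes "(i, l) \<in> edges" shows "0 < val (i, l) i"
proof -
  have "0 < (real (b l) - real (b i)) * real (d - i)" using edgesD[OF assms]
    by (intro mult_pos_pos) auto
  moreover have "0 \<le> (real l - real i) * real (b i)" using edgesD[OF assms]
    by (intro mult_nonneg_nonneg) auto
  ultimately show ?thesis unfolding edge_form_def fst_conv snd_conv by (intro add_nonneg_pos)
qed

text \<open>The x-parts d - i, d - k, d - l cancel by the barycentric identity, so convexity of the
  form along i, k, l is convexity of b.\<close>

lemma val_convex:
  assumes "i \<le> k" "k \<le> l" "l \<le> d"
  shows "real (l - k) * val e i + real (k - i) * val e l - real (l - i) * val e k
    = (real (snd e) - real (fst e)) * (real (l - k) * real (b i) + real (k - i) * real (b l) - real (l
      - i) * real (b k))"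
  using assms by (simp add: edge_form_def of_nat_diff algebra_simps)

lemma val_vertex:
  assumes "(i', l') \<in> edges" "k \<in> V" "i < k" "k < l" "l \<le> d"
  shows "real (l - i) * val (i', l') k < real (l - k) * val (i', l') i + real (k - i) * val (i', l') l"
proof -
  have "real ((l - i) * b k) < real ((l - k) * b i + (k - i) * b l)"
    using verticesD[OF assms(2-5)] by (simp only: of_nat_less_iff)
  then have "real (l - i) * real (b k) < real (l - k) * real (b i) + real (k - i) * real (b l)"
    by (simp only: of_nat_mult of_nat_add)
  then have "0 < (real l' - real i') * (real (l - k) * real (b i) + real (k - i) * real (b l) - real
    (l - i) * real (b k))"
    using edgesD[OF assms(1)] by (intro mult_pos_pos) simp_all
  then show ?thesis using val_convex[of i k l "(i', l')"] assms by simp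
qed

text \<open>The line through an edge supports the staircase: a minimiser of the form is found among
  the vertices, and a vertex beyond the edge with smaller value would contradict strict convexity at
  an end of the edge.\<close>

lemma val_min:
  assumes e: "(i, l) \<in> edges" and k: "k \<le> d" shows "val (i, l) i \<le> val (i, l) k"
proof -
  let ?v = "val (i, l)"
  define c where "c = Min (?v ` {..d})"
  have c: "c \<le> ?v j" if "j \<le> d" for j using that by (simp add: c_def)
  have "c \<in> ?v ` {..d}" unfolding c_def by (rule Min_in) auto
  then have ex: "\<exists>j. j \<le> d \<and> ?v j = c" by auto
  \<comment> \<open>The least index makes the inequality strict on one side, as the strict vertex
    condition demands.\<close>
  define r where "r = (LEAST j. j \<le> d \<and> ?v j = c)"
  have r: "r \<le> d" "?v r = c" using LeastI_ex[OF ex] unfolding r_def by blast+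
  have less: "c < ?v j" if "j < r" for j
    using not_less_Least[of j "\<lambda>j. j \<le> d \<and> ?v j = c"] that c[of j] r(1) unfolding r_def[symmetric]
      by fastforce
  have "r \<in> V" unfolding vertices_def
  proof (intro CollectI conjI allI impI)
    fix i' l' assume il: "i' < r" "r < l'" "l' \<le> d"
    have "real (l' - r) * c < real (l' - r) * ?v i'" using less[OF il(1)] il by simp
    moreover have "real (r - i') * c \<le> real (r - i') * ?v l'" using c[OF il(3)]
      by (simp add: mult_left_mono)
    moreover have "real (l' - i') * c = real (l' - r) * c + real (r - i') * c"
      using il by (simp add: of_nat_diff algebra_simps)
    ultimately have "0 < (real l - real i) * (real (l' - r) * real (b i') + real (r - i') * real (b
      l') - real (l' - i') * real (b r))"
      using val_convex[of i' r l' "(i, l)", unfolded r(2) fst_conv snd_conv] il by linarith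
    then have "real (l' - i') * real (b r) < real (l' - r) * real (b i') + real (r - i') * real (b l')"
      using edgesD(3)[OF e] by (simp add: zero_less_mult_iff)
    then show "(l' - i') * b r < (l' - r) * b i' + (r - i') * b l'"
      by (simp only: of_nat_less_iff flip: of_nat_mult of_nat_add)
  qed (rule r(1))
  have "?v i \<le> c"
  proof (rule ccontr)
    assume "\<not> ?v i \<le> c"
    then have lt: "?v r < ?v i" using r by simp
    then have "r \<noteq> i" "r \<noteq> l" using val_eq[OF e] by auto
    then consider "r < i" | "l < r" using edges_consecutive[OF e \<open>r \<in> V\<close>] by (meson linorder_neqE_nat)
    then show False
    proof cases
      case 1
      have "real (l - r) * ?v i < real (l - i) * ?v r + real (i - r) * ?v l"
        using val_vertex[OF e edgesD(1)[OF e] 1 edgesD(3,4)[OF e]] .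
      moreover have "real (l - i) * ?v r < real (l - i) * ?v i" using lt edgesD(3)[OF e] by simp
      moreover have "real (l - r) * ?v i = real (l - i) * ?v i + real (i - r) * ?v i"
        using 1 edgesD(3)[OF e] by (simp add: of_nat_diff algebra_simps)
      ultimately show False using val_eq[OF e] by simp
    next
      case 2
      have "real (r - i) * ?v l < real (r - l) * ?v i + real (l - i) * ?v r"
        using val_vertex[OF e edgesD(2,3)[OF e] 2 r(1)] .
      moreover have "real (l - i) * ?v r < real (l - i) * ?v i" using lt edgesD(3)[OF e] by simp
      moreover have "real (r - i) * ?v i = real (r - l) * ?v i + real (l - i) * ?v i"
        using 2 edgesD(3)[OF e] by (simp add: of_nat_diff algebra_simps)
      ultimately show False using val_eq[OF e] by simp
    qed
  qed
  then show ?thesis using c[OF k] by simp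
qed

lemma val_strict:
  assumes e: "(i, l) \<in> edges" and k: "k \<in> V" "k \<noteq> i" "k \<noteq> l" shows "val (i, l) i < val (i, l) k"
proof -
  let ?v = "val (i, l)"
  consider "k < i" | "l < k" using edges_consecutive[OF e k(1)] k by (meson linorder_neqE_nat)
  then show ?thesis
  proof cases
    case 1
    have "real (l - k) * ?v i < real (l - i) * ?v k + real (i - k) * ?v l"
      using val_vertex[OF e edgesD(1)[OF e] 1 edgesD(3,4)[OF e]] .
    moreover have "real (l - k) * ?v i = real (l - i) * ?v i + real (i - k) * ?v i"
      using 1 edgesD(3)[OF e] by (simp add: of_nat_diff algebra_simps)
    ultimately have "real (l - i) * ?v i < real (l - i) * ?v k" using val_eq[OF e] by simp
    then show ?thesis using edgesD(3)[OF e] by simp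
  next
    case 2
    have "real (k - i) * ?v l < real (k - l) * ?v i + real (l - i) * ?v k"
      using val_vertex[OF e edgesD(2,3)[OF e] 2 vertices_le[OF k(1)]] .
    moreover have "real (k - i) * ?v i = real (k - l) * ?v i + real (l - i) * ?v i"
      using 2 edgesD(3)[OF e] by (simp add: of_nat_diff algebra_simps)
    ultimately have "real (l - i) * ?v i < real (l - i) * ?v k" using val_eq[OF e] by simp
    then show ?thesis using edgesD(3)[OF e] by simp
  qed
qed

lemma edge_order_linear: "edge_order e (s * p + t * p') (s * q + t * q')
  = s * edge_order e p q + t * edge_order e p' q'"
  by (simp add: edge_order_def edge_form_def add_divide_distrib[symmetric] algebra_simps)

lemma edge_order_add: "edge_order e (p + p') (q + q') = edge_order e p q + edge_order e p' q'"
  using edge_order_linear[of e 1 p 1 p' q q'] by simp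

abbreviation vorder :: "nat \<times> nat \<Rightarrow> nat \<Rightarrow> real" where
  "vorder e k \<equiv> edge_order e (real (d - k)) (real (b k))"

lemma vorder_ends: "(i, l) \<in> edges \<Longrightarrow> vorder (i, l) i = 1" "(i, l) \<in> edges \<Longrightarrow> vorder (i, l) l = 1"
  using val_pos[of i l] val_eq[of i l] by (simp_all add: edge_order_def)

lemma vorder_ge: "e \<in> edges \<Longrightarrow> k \<le> d \<Longrightarrow> 1 \<le> vorder e k"
  using val_pos val_min by (cases e) (simp add: edge_order_def)

lemma vorder_gt: "(i, l) \<in> edges \<Longrightarrow> k \<in> V \<Longrightarrow> k \<noteq> i \<Longrightarrow> k \<noteq> l \<Longrightarrow> 1 < vorder (i, l) k"
  using val_pos val_strict by (simp add: edge_order_def)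

lemma vorder_gt_either:
  assumes e: "(i, l) \<in> edges" and k: "k \<in> V" "k' \<in> V" and n: "\<not> (k \<in> {i, l} \<and> k' \<in> {i, l})"
  shows "1 < vorder (i, l) k \<or> 1 < vorder (i, l) k'"
proof (cases "k \<in> {i, l}")
  case True
  then have "k' \<noteq> i" "k' \<noteq> l" using n by auto
  then show ?thesis using vorder_gt[OF e k(2)] by (intro disjI2)
next
  case False
  then have "k \<noteq> i" "k \<noteq> l" by auto
  then show ?thesis using vorder_gt[OF e k(1)] by (intro disjI1)
qed

lemma edge_order_nonneg: "e \<in> edges \<Longrightarrow> 0 \<le> edge_order e (real p) (real q)"
proof (cases e)
  case (Pair i l)
  assume "e \<in> edges"
  then have e: "(i, l) \<in> edges" using Pair by simp
  have "0 \<le> edge_form (i, l) (real p) (real q)"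
    unfolding edge_form_def using edgesD[OF e] by (intro add_nonneg_nonneg mult_nonneg_nonneg) auto
  then show ?thesis using val_pos[OF e] Pair by (simp add: edge_order_def)
qed

lemma edges_next:
  assumes "l \<in> V" "l < d" "0 < b l" obtains k where "(l, k) \<in> edges"
proof -
  let ?S = "{k \<in> V. l < k}"
  have S: "finite ?S" "?S \<noteq> {}" using finite_vertices d_vertex assms by auto
  have k: "Min ?S \<in> V" "l < Min ?S" using Min_in[OF S] by auto
  have "b l \<le> b (Min ?S)" using k vertices_le[OF k(1)] by (intro b_mono) auto
  then have b: "0 < b (Min ?S)" using assms(3) by (rule order.strict_trans2[rotated])
  have cons: "\<not> (l < k \<and> k < Min ?S)" if "k \<in> V" for k
  proof
    assume *: "l < k \<and> k < Min ?S"
    then have "k \<in> ?S" using that by simp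
    from Min_le[OF S(1) this] show False using * by simp
  qed
  have "(l, Min ?S) \<in> edges" unfolding edges_def mem_Collect_eq prod.case
    by (intro conjI ballI cons k assms b)
  then show thesis by (rule that)
qed

lemma edges_prev:
  assumes "i \<in> V" "0 < b i" obtains k where "(k, i) \<in> edges"
proof -
  let ?S = "{k \<in> V. k < i}"
  have "0 < i" using assms b_0 by (cases i) auto
  then have S: "finite ?S" "?S \<noteq> {}" using finite_vertices zero_vertex by auto
  have k: "Max ?S \<in> V" "Max ?S < i" using Max_in[OF S] by auto
  have cons: "\<not> (Max ?S < k \<and> k < i)" if "k \<in> V" for k
  proof
    assume *: "Max ?S < k \<and> k < i"
    then have "k \<in> ?S" using that by simp
    from Max_ge[OF S(1) this] show False using * by simp
  qed
  have "(Max ?S, i) \<in> edges" unfolding edges_def mem_Collect_eq prod.case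
    by (intro conjI ballI cons k assms)
  then show thesis by (rule that)
qed

section \<open>The Newton order and its cones\<close>

lemma finite_edges: "finite edges"
  by (rule finite_subset[of _ "V \<times> V"]) (auto simp: edges_def finite_vertices)

lemma edges_nonempty: "edges \<noteq> {}"
  using edges_prev[OF d_vertex b_d] by blast

lemma edges_col: assumes "(i, l) \<in> edges" shows "col d b i \<noteq> col d b l"
  using col_between[OF edgesD(1,2,3)[OF assms]] edges_consecutive[OF assms] by blast

text \<open>The concave, piecewise linear function with value 1 along the edges; it tells which
  multiple of the Newton polygon a monomial reaches.\<close>

definition newton_order :: "nat \<Rightarrow> nat \<Rightarrow> real" where
  "newton_order p q = Min ((\<lambda>e. edge_order e (real p) (real q)) ` edges)"

lemma newton_order_le: "e \<in> edges \<Longrightarrow> newton_order p q \<le> edge_order e (real p) (real q)"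
  unfolding newton_order_def using finite_edges by (intro Min_le) auto

lemma newton_order_gtI: "(\<And>e. e \<in> edges \<Longrightarrow> x < edge_order e (real p) (real q)) \<Longrightarrow> x < newton_order p q"
  unfolding newton_order_def using finite_edges edges_nonempty by (subst Min_gr_iff) auto

lemma newton_order_geI: "(\<And>e. e \<in> edges \<Longrightarrow> x \<le> edge_order e (real p) (real q)) \<Longrightarrow> x \<le> newton_order p q"
  unfolding newton_order_def using finite_edges edges_nonempty by (subst Min_ge_iff) auto

text \<open>The edge attaining the minimum spans the cone that contains (p, q), with coefficients
  from Cramer's rule. A negative coefficient would make the neighbouring edge form smaller than the
  minimum; at the two ends the sign comes from p and q being nonnegative.\<close>

lemma cone_decomposition:
  obtains i l s t where "(i, l) \<in> edges" "0 \<le> s" "0 \<le> t" "newton_order p q = s + t"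
    "real p = s * real (d - i) + t * real (d - l)" "real q = s * real (b i) + t * real (b l)"
proof -
  have "newton_order p q \<in> (\<lambda>e. edge_order e (real p) (real q)) ` edges"
    unfolding newton_order_def using finite_edges edges_nonempty by (intro Min_in) auto
  then obtain i l where e: "(i, l) \<in> edges"
    and min: "newton_order p q = edge_order (i, l) (real p) (real q)" by auto
  note edges = edgesD[OF e]
  define D where "D = real (d - i) * real (b l) - real (d - l) * real (b i)"
  have "real (d - l) * real (b i) \<le> real (d - l) * real (b l)" using edges by (simp add: mult_left_mono)
  also have "\<dots> < real (d - i) * real (b l)" using edges by simp
  finally have D: "D > 0" by (simp add: D_def)
  define s where "s = (real p * real (b l) - real q * real (d - l)) / D"
  define t where "t = (real q * real (d - i) - real p * real (b i)) / D"
  have "s * real (d - i) + t * real (d - l) = (real p * D) / D"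
    unfolding s_def t_def by (simp add: add_divide_distrib[symmetric] D_def algebra_simps)
  then have p: "real p = s * real (d - i) + t * real (d - l)" using D by simp
  have "s * real (b i) + t * real (b l) = (real q * D) / D"
    unfolding s_def t_def by (simp add: add_divide_distrib[symmetric] D_def algebra_simps)
  then have q: "real q = s * real (b i) + t * real (b l)" using D by simp
  have edge_order: "edge_order e' (real p) (real q) = s * vorder e' i + t * vorder e' l" for e'
    unfolding p q by (rule edge_order_linear)
  have st: "newton_order p q = s + t" using min edge_order vorder_ends[OF e] by simp
  have "0 \<le> s"
  proof (cases "l = d")
    case True
    then have "real p = s * real (d - i)" using p by simp
    then show ?thesis using edges
      by (metis of_nat_0_le_iff of_nat_0_less_iff zero_le_mult_iff zero_less_diff order.strict_trans2
        not_le)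
  next
    case False
    then obtain k where k: "(l, k) \<in> edges" using edges_next[OF edges(2) _ edges(5)] edges(4)
      by (metis le_neq_implies_less)
    have "s + t \<le> s * vorder (l, k) i + t"
      using newton_order_le[OF k, of p q] edge_order[of "(l, k)"] vorder_ends(1)[OF k] st by simp
    moreover have "1 < vorder (l, k) i" using edges(1,3) edgesD[OF k] by (intro vorder_gt[OF k]) auto
    ultimately have "0 \<le> s * (vorder (l, k) i - 1)" "0 < vorder (l, k) i - 1"
      by (simp_all add: algebra_simps)
    then show ?thesis by (simp add: zero_le_mult_iff)
  qed
  moreover have "0 \<le> t"
  proof (cases "b i = 0")
    case True
    then have "real q = t * real (b l)" using q by simp
    then have "0 \<le> t * real (b l)" by (metis of_nat_0_le_iff)
    then show ?thesis using edges(5) by (simp add: zero_le_mult_iff)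
  next
    case False
    then obtain k where k: "(k, i) \<in> edges" using edges_prev[OF edges(1)] by auto
    have "s + t \<le> s + t * vorder (k, i) l"
      using newton_order_le[OF k, of p q] edge_order[of "(k, i)"] vorder_ends(2)[OF k] st by simp
    moreover have "1 < vorder (k, i) l" using edges(2,3) edgesD[OF k] by (intro vorder_gt[OF k]) auto
    ultimately have "0 \<le> t * (vorder (k, i) l - 1)" "0 < vorder (k, i) l - 1"
      by (simp_all add: algebra_simps)
    then show ?thesis by (simp add: zero_le_mult_iff)
  qed
  ultimately show thesis using that[OF e _ _ st p q] by blast
qed

text \<open>The ideal J + I^3. In contrast to \<open>reduction_le1\<close> the cofactors are
  arbitrary; the Koszul argument moves them into I afterwards.\<close>

definition J_cube :: "'k poly poly set" where
  "J_cube = {u. \<exists>g h. u - (F True * g + F False * h) \<in> pw (Suc (Suc (Suc 0)))}"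

lemma J_cube_idl: "whole.idl J_cube"
  unfolding whole.idl_def
proof (intro conjI ballI)
  show "0 \<in> J_cube" unfolding J_cube_def using whole.idl_zero[OF pw_idl]
    by (intro CollectI exI[of _ 0]) simp
next
  fix x y assume "x \<in> J_cube" "y \<in> J_cube"
  then obtain g h g' h' where *: "x - (F True * g + F False * h) \<in> pw (Suc (Suc (Suc 0)))"
    "y - (F True * g' + F False * h') \<in> pw (Suc (Suc (Suc 0)))" unfolding J_cube_def by blast
  have "x + y - (F True * (g + g') + F False * (h + h'))
    = (x - (F True * g + F False * h)) + (y - (F True * g' + F False *
      h'))" by (simp add: algebra_simps)
  then show "x + y \<in> J_cube" using whole.idl_add[OF pw_idl *] unfolding J_cube_def
    by (intro CollectI exI[of _ "g + g'"] exI[of _ "h + h'"]) (simp only:)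
next
  fix a x assume "x \<in> J_cube"
  then obtain g h where *: "x - (F True * g + F False * h) \<in> pw (Suc (Suc (Suc 0)))"
    unfolding J_cube_def by blast
  have "a * x - (F True * (a * g) + F False * (a * h)) = a * (x - (F True * g + F False * h))"
    by (simp add: algebra_simps)
  then show "a * x \<in> J_cube" using whole.idl_mult[OF pw_idl UNIV_I *] unfolding J_cube_def
    by (intro CollectI exI[of _ "a * g"] exI[of _ "a * h"]) (simp only:)
qed simp

lemma cube_in_J_cube: "u \<in> pw (Suc (Suc (Suc 0))) \<Longrightarrow> u \<in> J_cube"
  unfolding J_cube_def by (intro CollectI exI[of _ 0]) simp

section \<open>Monomials of Newton order at least two lie in J + I^3\<close>

lemma F_in_J_cube: "F c * w \<in> J_cube"
proof -
  have "F c * w - (F True * (if c then w else 0) + F False * (if c then 0 else w)) = 0"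
    by (cases c) auto
  then show ?thesis unfolding J_cube_def
    by (intro CollectI exI[of _ "if c then w else 0"] exI[of _ "if c then 0 else w"])
      (simp only: whole.idl_zero[OF pw_idl])
qed

text \<open>Modulo J a vertex monomial is minus the sum of the others of its parity, and this
  persists for monomial multiples.\<close>

lemma peel:
  assumes i: "i \<in> V" and "\<And>k. k \<in> V \<Longrightarrow> col d b k = col d b i \<Longrightarrow> k \<noteq> i \<Longrightarrow> mon (d - k + p) (b k + q)
    \<in> J_cube"
  shows "mon (d - i + p) (b i + q) \<in> J_cube"
proof -
  let ?S = "{k. k \<in> V \<and> col d b k = col d b i}"
  have fS: "finite ?S" using finite_vertices by simp
  have "F (col d b i) * mon p q = (\<Sum>k\<in>?S. mon (d - k + p) (b k + q))"
    unfolding reduction_elt_def by (simp add: sum_distrib_right mon_mult)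
  also have "\<dots> = mon (d - i + p) (b i + q) + (\<Sum>k\<in>?S - {i}. mon (d - k + p) (b k + q))"
    using i fS by (subst sum.remove[of _ i]) auto
  finally have "mon (d - i + p) (b i + q)
    = F (col d b i) * mon p q - (\<Sum>k\<in>?S - {i}. mon (d - k + p) (b k + q))"
    by (simp only: add_diff_cancel_right')
  moreover have "(\<Sum>k\<in>?S - {i}. mon (d - k + p) (b k + q)) \<in> J_cube"
    by (rule whole.idl_sum[OF J_cube_idl]) (use assms(2) in simp)
  ultimately show ?thesis using whole.idl_diff[OF J_cube_idl F_in_J_cube] by (simp only:)
qed

text \<open>Peeling v i leaves products v k v l with k of the parity of i. If k is the vertex after
  l, this is the product for the next edge and the induction on d - l applies; otherwise no edge
  contains both k and l, and the Newton order exceeds 2.\<close>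

lemma pair_in_J_cube:
  assumes H: "\<And>p q. 2 < newton_order p q \<Longrightarrow> mon p q \<in> J_cube"
  shows "(i, l) \<in> edges \<Longrightarrow> mon (d - i + (d - l)) (b i + b l) \<in> J_cube"
proof (induction "d - l" arbitrary: i l rule: less_induct)
  case less
  note e = less.prems
  note edges = edgesD[OF e]
  show ?case
  proof (rule peel[OF edges(1)])
    fix k assume k: "k \<in> V" "col d b k = col d b i" "k \<noteq> i"
    show "mon (d - k + (d - l)) (b k + b l) \<in> J_cube"
    proof (cases "(l, k) \<in> edges")
      case True
      have "d - k < d - l" using edgesD[OF True] by linarith
      then show ?thesis using less.hyps[OF _ True] by (simp add: add.commute)
    next
      case False
      have kl: "k \<noteq> l" using k edges_col[OF e] by auto
      have "2 < edge_order e' (real (d - k + (d - l))) (real (b k + b l))" if e': "e' \<in> edges" for e'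
      proof -
        obtain i' l' where il: "e' = (i', l')" by (cases e')
        have "\<not> (k \<in> {i', l'} \<and> l \<in> {i', l'})"
        proof
          assume *: "k \<in> {i', l'} \<and> l \<in> {i', l'}"
          then have "e' = (k, l)" using il kl False e' by auto
          then have kE: "(k, l) \<in> edges" using e' by simp
          then show False using edges_consecutive[OF e k(1)] edges_consecutive[OF kE edges(1)]
            edgesD(3)[OF kE] edges(3) k(3)
            by (meson linorder_neqE_nat)
        qed
        then have "1 < vorder e' k \<or> 1 < vorder e' l"
          using vorder_gt_either[OF e'[unfolded il] k(1) edges(2)] unfolding il by blast
        moreover have "1 \<le> vorder e' k" "1 \<le> vorder e' l"
          by (rule vorder_ge[OF e' vertices_le[OF k(1)]], rule vorder_ge[OF e' vertices_le[OF
            edges(2)]])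
        ultimately show ?thesis by (simp add: edge_order_add) linarith
      qed
      then show ?thesis by (intro H newton_order_gtI)
    qed
  qed
qed

text \<open>Vertices of equal parity never share an edge, so each edge form exceeds 1 at v k or at v
  i. Exchanging one v i for v k then raises the Newton order; if only v i is in excess, this depends
  on a positive share of v i being left, hence 1 < s.\<close>

lemma peel_in_J_cube:
  assumes H: "\<And>p' q'. newton_order p q < newton_order p' q' \<Longrightarrow> mon p' q' \<in> J_cube"
    and i: "i \<in> V" and l: "l \<in> V" and st: "1 < s" "0 \<le> t" "newton_order p q = s + t"
    and p: "real p = s * real (d - i) + t * real (d - l)"
      and q: "real q = s * real (b i) + t * real (b l)"
  shows "mon p q \<in> J_cube"
proof -
  have *: "1 * real (d - i) \<le> s * real (d - i)" "1 * real (b i) \<le> s * real (b i)"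
    "0 \<le> t * real (d - l)" "0 \<le> t * real (b l)"
    by (rule mult_right_mono mult_nonneg_nonneg; use st in simp)+
  then have "real (d - i) \<le> real p" "real (b i) \<le> real q" using p q by linarith+
  then obtain p' q' where p': "p = d - i + p'" and q': "q = b i + q'"
    by (metis le_Suc_ex of_nat_le_iff)
  have rp': "real p' = (s - 1) * real (d - i) + t * real (d - l)" using p p'
    by (simp add: algebra_simps)
  have rq': "real q' = (s - 1) * real (b i) + t * real (b l)" using q q' by (simp add: algebra_simps)
  have "mon (d - i + p') (b i + q') \<in> J_cube"
  proof (rule peel[OF i])
    fix k assume k: "k \<in> V" "col d b k = col d b i" "k \<noteq> i"
    have "newton_order p q < edge_order e' (real (d - k + p')) (real (b k + q'))" if e': "e' \<in> edges"
      for e'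
    proof -
      obtain i' l' where il: "e' = (i', l')" by (cases e')
      have "\<not> (k \<in> {i', l'} \<and> i \<in> {i', l'})"
      proof
        assume "k \<in> {i', l'} \<and> i \<in> {i', l'}"
        then have "col d b k \<noteq> col d b i" using edges_col[of i' l'] e' il k(3) by auto
        then show False using k(2) by simp
      qed
      then have gt: "1 < vorder e' k \<or> 1 < vorder e' i"
        using vorder_gt_either[OF e'[unfolded il] k(1) i] unfolding il by blast
      have ge: "1 \<le> vorder e' k" "1 \<le> vorder e' i" "1 \<le> vorder e' l"
        by (rule vorder_ge[OF e' vertices_le[OF k(1)]], rule vorder_ge[OF e' vertices_le[OF i]], rule
          vorder_ge[OF e' vertices_le[OF l]])
      have "edge_order e' (real (d - k + p')) (real (b k + q'))
        = vorder e' k + ((s - 1) * vorder e' i + t * vorder e' l)"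
        using edge_order_linear[of e' "s - 1" "real (d - i)" t "real (d - l)" "real (b i)" "real (b l)"]
        by (simp add: edge_order_add rp' rq')
      moreover have "(s - 1) * 1 \<le> (s - 1) * vorder e' i" "t * 1 \<le> t * vorder e' l"
        by (rule mult_left_mono; use st ge in simp)+
      moreover have "1 < vorder e' k \<or> (s - 1) * 1 < (s - 1) * vorder e' i" using gt st by auto
      moreover have "N < x" if "x = u + (u' + u'')" "(s - 1) * 1 \<le> u'" "t * 1 \<le> u''" "N = s + t" "1 \<le> u"
        "1 < u \<or> (s - 1) * 1 < u'" for N x u u' u'' :: real
        using that by auto
      ultimately show ?thesis using st(3) ge(1) by blast
    qed
    then show "mon (d - k + p') (b k + q') \<in> J_cube" by (intro H newton_order_gtI)
  qed
  then show ?thesis by (simp add: p' q')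
qed

text \<open>A monomial instance of the Briancon-Skoda theorem, with induction on the Newton order: on the cone
  spanned by \<open>v i\<close> and \<open>v l\<close>, replacing a factor \<open>v i\<close> by minus the other terms of its reduction element
  raises the Newton order, except for the product \<open>v i * v l\<close>, which is moved along the chain of edges.\<close>

lemma briancon_skoda: "2 \<le> newton_order p q \<Longrightarrow> mon p q \<in> J_cube"
proof (rule ccontr)
  assume pq: "2 \<le> newton_order p q" "mon p q \<notin> J_cube"
  let ?B = "{(p, q). 2 \<le> newton_order p q \<and> mon p q \<notin> J_cube}"
  \<comment> \<open>Large exponents lie in I^3 already, so there are finitely many counterexamples
    and one of maximal Newton order can be taken.\<close>
  have "?B \<subseteq> {..3 * d} \<times> {..3 * b d}"
  proof safe
    fix p q assume nZ: "mon p q \<notin> J_cube"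
    have "\<not> in_pow d b (Suc (Suc (Suc 0))) p q" using nZ cube_in_J_cube mon_pow_stair by blast
    then have "\<not> Suc (Suc (Suc 0)) * d \<le> p" "\<not> Suc (Suc (Suc 0)) * b d \<le> q"
      using in_pow_x[of b _ d p q, OF b_0] in_pow_y[of _ b d q p] by blast+
    then show "p \<le> 3 * d" "q \<le> 3 * b d" by simp_all
  qed
  then have fin: "finite ?B" by (rule finite_subset) simp
  have "?B \<noteq> {}" using pq by auto
  define N where "N = Max ((\<lambda>(p, q). newton_order p q) ` ?B)"
  have "N \<in> (\<lambda>(p, q). newton_order p q) ` ?B" unfolding N_def using fin \<open>?B \<noteq> {}\<close> by (intro Max_in) auto
  then obtain p q where pq: "2 \<le> newton_order p q" "mon p q \<notin> J_cube" "newton_order p q = N" by auto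
  have H: "mon p' q' \<in> J_cube" if "newton_order p q < newton_order p' q'" for p' q'
  proof (rule ccontr)
    assume "mon p' q' \<notin> J_cube"
    then have "(p', q') \<in> ?B" using that pq by auto
    then have "newton_order p' q' \<le> N" unfolding N_def using fin
      by (intro Max_ge) (auto intro!: image_eqI[of _ _ "(p', q')"])
    then show False using that pq by simp
  qed
  obtain i l s t where c: "(i, l) \<in> edges" "0 \<le> s" "0 \<le> t" "newton_order p q = s + t"
    "real p = s * real (d - i) + t * real (d - l)" "real q = s * real (b i) + t * real (b l)"
    by (rule cone_decomposition)
  note edges = edgesD[OF c(1)]
  \<comment> \<open>As s + t >= 2, neither vertex can be peeled only for s = t = 1, which is the
    product v i v l.\<close>
  consider "1 < s" | "1 < t" | "s = 1" "t = 1" using pq(1) c(4) by linarith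
  then have "mon p q \<in> J_cube"
  proof cases
    case 1
    show ?thesis by (rule peel_in_J_cube[OF H edges(1,2) 1 c(3-6)])
  next
    case 2
    show ?thesis by (rule peel_in_J_cube[OF H edges(2,1) 2 c(2)]) (use c in simp_all)
  next
    case 3
    then have "newton_order p q = 2" using c(4) by simp
    then have "mon (d - i + (d - l)) (b i + b l) \<in> J_cube" using H by (intro pair_in_J_cube c(1)) simp
    moreover have "p = d - i + (d - l)" "q = b i + b l" using c(5,6) 3
      by (simp_all flip: of_nat_add add: of_nat_eq_iff)
    ultimately show ?thesis by simp
  qed
  then show False using pq by simp
qed

section \<open>From the monomial statement to the depth formula\<close>

lemma in_pow_edge_order: "e \<in> edges \<Longrightarrow> in_pow d b n p q \<Longrightarrow> real n \<le> edge_order e (real p) (real q)"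
proof (induction n arbitrary: p q)
  case 0
  then show ?case using edge_order_nonneg by simp
next
  case (Suc n)
  from Suc.prems(2) obtain k p' q' where k: "k \<le> d" "p = d - k + p'" "q
    = b k + q'" "in_pow d b n p' q'" by (rule in_pow_SucE)
  have "edge_order e (real p) (real q) = vorder e k + edge_order e (real p') (real q')"
    unfolding k(2,3) of_nat_add by (rule edge_order_add)
  then show ?case using Suc.IH[OF Suc.prems(1) k(4)] vorder_ge[OF Suc.prems(1) k(1)] by simp
qed

lemma square_subset_J_cube: "pw (Suc (Suc 0)) \<subseteq> J_cube"
  unfolding pow_stair
proof (rule mono_ideal_least[OF J_cube_idl])
  fix p q assume "in_pow d b (Suc (Suc 0)) p q"
  then show "mon p q \<in> J_cube" using in_pow_edge_order[of _ "Suc (Suc 0)" p q]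
    by (intro briancon_skoda newton_order_geI) (simp del: in_pow.simps)
qed

lemma reduction_le1_if_regular:
  assumes "gr_regular_seq m I [g1, g2]" shows "reduction_le1 TYPE('k) d b"
  unfolding reduction_le1_def
proof
  fix u assume u: "u \<in> pw (Suc (Suc 0))"
  then obtain g h where gh: "u - (F True * g + F False * h) \<in> pw (Suc (Suc (Suc 0)))"
    using square_subset_J_cube unfolding J_cube_def by blast
  have "F True * g + F False * h \<in> pw (Suc (Suc 0))"
    using whole.idl_diff[OF pw_idl u pw_Suc[OF gh]] by simp
  then have "g \<in> I" "h \<in> I" using regular_pair_linear[OF assms] by blast+
  then show "\<exists>g\<in>I. \<exists>h\<in>I. u - (F True * g + F False * h) \<in> pw (Suc (Suc (Suc 0)))" using gh by blast
qed

theorem depth_formula: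
  "depth_gr m I = (if reduction_le1 TYPE('k) d b then 2 else if colon_stable d b then 1 else 0)"
proof -
  have two: "(\<exists>g1 g2. gr_regular_seq m I [g1, g2]) \<longleftrightarrow> reduction_le1 TYPE('k) d b"
    using reduction_le1_if_regular reduction_le1_regular fM regular_2[of "f True" "f False"] by auto
  have one: "(\<exists>g. gr_regular_seq m I [g]) \<longleftrightarrow> colon_stable d b"
    using nzd_if_colon_stable colon_stable_if_nzd regular_1 by blast
  have "\<not> gr_regular_seq m I [g1, g2, g3]" for g1 g2 g3
  proof
    assume *: "gr_regular_seq m I [g1, g2, g3]"
    then have "gr_regular_seq m I [g1, g2]" using regular_take[of "[g1, g2, g3]" 2] by simp
    then show False using reduction_le1_if_regular reduction_le1_regular no_triple * by blast
  qed
  from depth_eq[OF this] show ?thesis unfolding two one .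
qed

end

section \<open>The transform\<close>

lemma monic_division:
  fixes F s :: "'r::comm_ring_1 poly"
  assumes "degree F = d" "coeff F d = 1" "0 < d"
  shows "\<exists>q r. s = F * q + r \<and> degree r < d"
proof (induction "degree s" arbitrary: s rule: less_induct)
  case less
  show ?case
  proof (cases "degree s < d")
    case True
    then show ?thesis by (intro exI[of _ 0] exI[of _ s]) simp
  next
    case False
    let ?m = "monom (lead_coeff s) (degree s - d)"
    let ?t = "s - F * ?m"
    have "degree (F * ?m) \<le> degree s"
      using degree_mult_le[of F ?m] degree_monom_le[of "lead_coeff s" "degree s - d"] False assms(1)
        by linarith
    then have le: "degree ?t \<le> degree s" by (simp add: degree_diff_le)
    have "coeff (F * ?m) (degree s) = lead_coeff s"
      using False assms(2) coeff_monom_mult[of "lead_coeff s" "degree s - d" F "degree s"]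
        by (simp add: mult.commute[of F])
    then have "coeff ?t (degree s) = 0" by simp
    then have "degree ?t < degree s"
      using le False assms(3)
        by (metis degree_0 leading_coeff_0_iff le_neq_implies_less not_less neq0_conv)
    then obtain q r where "?t = F * q + r" "degree r < d" using less.hyps by blast
    then have "s = F * (q + ?m) + r" "degree r < d" by (simp_all add: algebra_simps)
    then show ?thesis by blast
  qed
qed

text \<open>The substitution x = y z; the outer variable is read as x in the argument and as z in
  the result.\<close>

definition theta :: "'k::comm_ring_1 poly poly \<Rightarrow> 'k poly poly" where
  "theta F = pcompose F (monom [:0, 1:] 1)"

lemma theta_mult: "theta (F * G) = theta F * theta G"
  and theta_add: "theta (F + G) = theta F + theta G"
  and theta_diff: "theta (F - G) = theta F - theta G"
  by (simp_all add: theta_def pcompose_mult pcompose_add pcompose_diff)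

lemma coeff_theta: "coeff (theta F) p = monom 1 p * coeff F p"
proof (induction F arbitrary: p)
  case 0
  then show ?case by (simp add: theta_def)
next
  case (pCons c F)
  have "coeff (theta (pCons c F)) p = coeff [:c:] p + coeff (monom [:0, 1:] 1 * theta F) p"
    by (simp add: theta_def pcompose_pCons)
  also have "\<dots> = monom 1 p * coeff (pCons c F) p"
  proof (cases p)
    case 0
    then show ?thesis by (simp add: coeff_mult)
  next
    case (Suc i)
    have "coeff (monom [:0, 1:] 1 * theta F) (Suc i) = [:0, 1:] * coeff (theta F) i"
      using coeff_monom_mult[of "[:0, 1:]" 1 "theta F" "Suc i"] by simp
    also have "\<dots> = monom 1 (Suc i) * coeff F i" unfolding pCons.IH by (simp add: monom_Suc)
    finally show ?thesis using Suc by simp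
  qed
  finally show ?case .
qed

lemma cf_theta: "cf (theta F) p r = (if p \<le> r then cf F p (r - p) else 0)"
  by (simp add: coeff_theta coeff_monom_mult)

lemma theta_mon: "theta (mon p q) = mon p (p + q)"
  by (rule poly_eqI) (auto simp: coeff_theta mon_def mult_monom)

lemma theta_sum: "theta (sum f S) = (\<Sum>i\<in>S. theta (f i))"
  by (induction S rule: infinite_finite_induct) (simp_all add: theta_add, simp_all add: theta_def)

lemma theta_eq_0:
  assumes "theta F = 0" shows "F = 0"
proof (rule poly_eqI, rule poly_eqI)
  fix p q show "cf F p q = cf 0 p q"
    using cf_theta[of F p "p + q"] assms by simp
qed

text \<open>For p \<le> N the monomial z^p y^N equals x^p y^(N - p), so y^N clears all z of degree
  up to N.\<close>

lemma theta_lift: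
  assumes "\<And>p. N < p \<Longrightarrow> coeff G p = 0"
  shows "\<exists>F. theta F = mon 0 N * G"
proof -
  define F where "F = (\<Sum>p\<le>N. monom (monom 1 (N - p) * coeff G p) p)"
  have "coeff F p = (if p \<le> N then monom 1 (N - p) * coeff G p else 0)" for p
    unfolding F_def coeff_sum by (simp add: if_distrib cong: if_cong)
  then have "coeff (theta F) p = coeff (mon 0 N * G) p" for p
    using assms[of p] by (auto simp: coeff_theta mon_def coeff_monom_mult mult_monom simp flip:
      mult.assoc)
  then show ?thesis by (blast intro: poly_eqI)
qed

section \<open>Comparison of the two staircases\<close>

locale transform =
  fixes d :: nat and a :: "nat \<Rightarrow> nat" and ty :: "'k::field itself"
  assumes a_0: "a 0 = 0" and a_Suc: "\<forall>i<d. a i < a (Suc i)" and a_d: "d < a d"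
begin

definition b :: "nat \<Rightarrow> nat" where "b i = a i - i"

lemma a_step: "i \<le> j \<Longrightarrow> j \<le> d \<Longrightarrow> a i + (j - i) \<le> a j"
proof (induction j rule: dec_induct)
  case (step j)
  then have "a j < a (Suc j)" using a_Suc by simp
  then show ?case using step by simp
qed simp

lemma a_eq: "i \<le> d \<Longrightarrow> a i = b i + i"
  using a_step[of 0 i] a_0 by (simp add: b_def)

lemma b_mono: "i \<le> j \<Longrightarrow> j \<le> d \<Longrightarrow> b i \<le> b j"
  using a_step[of i j] by (simp add: b_def)

lemma d_pos: "0 < d" using a_d a_0 by (cases d) auto

lemma a_mono: "i \<le> j \<Longrightarrow> j \<le> d \<Longrightarrow> a i \<le> a j"
  using a_step[of i j] by simp

sublocale L: staircase d a ty
  by unfold_locales (use d_pos a_0 a_mono a_d in auto)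

sublocale T: staircase d b ty
  by unfold_locales (use d_pos b_mono a_d in \<open>auto simp: b_def a_0\<close>)

text \<open>Subtracting the linear function i from a changes both sides of every chord inequality by
  the same amount.\<close>

lemma vertices_eq: "vertices d a = vertices d b"
proof -
  have "(l - i) * a k < (l - k) * a i + (k - i) * a l \<longleftrightarrow> (l - i) * b k < (l - k) * b i + (k - i) * b l"
    if il: "i < k" "k < l" "l \<le> d" for i k l
  proof -
    obtain r s where rs: "k = i + r" "l = i + r + s" using il that by (metis less_imp_add_positive)
    have "(l - i) * k = (l - k) * i + (k - i) * l" unfolding rs by (simp add: algebra_simps)
    then have "(l - i) * a k = (l - i) * b k + ((l - k) * i + (k - i) * l)"
      using il a_eq[of k] by (simp add: distrib_left)
    moreover have "(l - k) * a i + (k - i) * a l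
      = ((l - k) * b i + (k - i) * b l) + ((l - k) * i + (k - i) * l)"
      using il a_eq[of i] a_eq[of l] by (simp add: distrib_left)
    ultimately show ?thesis by linarith
  qed
  then show ?thesis unfolding vertices_def by blast
qed

lemma theta_reduction_elt: "theta (L.F c) = mon 0 d * T.F c"
proof -
  have "theta (L.F c) = (\<Sum>k | k \<in> vertices d b \<and> col d b k = c. theta (mon (d - k) (a k)))"
    unfolding reduction_elt_def col_def vertices_eq by (rule theta_sum)
  also have "\<dots> = (\<Sum>k | k \<in> vertices d b \<and> col d b k = c. mon 0 d * mon (d - k) (b k))"
    by (rule sum.cong) (auto simp: theta_mon mon_mult a_eq dest: vertices_le)
  finally show ?thesis by (simp add: reduction_elt_def sum_distrib_left)
qed

lemma in_pow_transform: "in_pow d a n p q \<Longrightarrow> n * d \<le> p + q \<and> in_pow d b n p (p + q - n * d)"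
proof (induction n arbitrary: p q)
  case (Suc n)
  from Suc.prems obtain k p' q' where k: "k \<le> d" "p = d - k + p'" "q = a k + q'" "in_pow d a n p' q'"
    by (rule in_pow_SucE)
  have IH: "n * d \<le> p' + q'" "in_pow d b n p' (p' + q' - n * d)" using Suc.IH[OF k(4)] by auto
  have "Suc n * d \<le> p + q" using IH(1) k a_eq[OF k(1)] by simp
  moreover have "p + q - Suc n * d = b k + (p' + q' - n * d)" using IH(1) k a_eq[OF k(1)] by simp
  ultimately show ?case using in_pow_SucI[OF k(1) IH(2)] k(2) by simp
qed simp

lemma in_pow_transform_back: "in_pow d b n p r \<Longrightarrow> p \<le> n * d \<Longrightarrow> in_pow d a n p (r + n * d - p)"
proof (induction n arbitrary: p r)
  case (Suc n)
  from Suc.prems(1) obtain k p' r' where k: "k \<le> d" "p = d - k + p'" "r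
    = b k + r'" "in_pow d b n p' r'" by (rule in_pow_SucE)
  show ?case
  proof (cases "p' \<le> n * d")
    case True
    then have "in_pow d a n p' (r' + n * d - p')" using Suc.IH[OF k(4)] by blast
    from in_pow_SucI[OF k(1) this] show ?thesis using True k a_eq[OF k(1)] by (simp add: algebra_simps)
  next
    case False
    \<comment> \<open>The other n factors cannot be made to carry x-degree beyond n d. The excess
      goes into the first factor, whose index drops to j, and the others become x^d.\<close>
    define j where "j = k - (p' - n * d)"
    have j: "j \<le> k" "d - j + n * d = p" using Suc.prems(2) k False by (auto simp: j_def)
    have "in_pow d a n (n * d) 0" by (rule in_pow_x[of a, OF a_0]) simp
    from in_pow_SucI[of j d, OF _ this] have "in_pow d a (Suc n) p (a j)" using j k(1) by simp
    moreover have "a j \<le> r + Suc n * d - p"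
    proof -
      have "b j \<le> r" using b_mono[OF j(1) k(1)] k(3) by simp
      moreover have "Suc n * d - p = j" "p \<le> Suc n * d" using j k(1) by auto
      ultimately show ?thesis using a_eq[of j] j(1) k(1) by linarith
    qed
    ultimately show ?thesis by (rule in_pow_le[OF _ order.refl])
  qed
qed simp

text \<open>Exponents with n d \<le> p belong to both n-th powers because of x^(n d). Below that
  bound the shear matches membership in the powers, for the monomial and for its products with
  generators.\<close>

lemma colon_stable_iff: "colon_stable d a \<longleftrightarrow> colon_stable d b"
proof
  assume R: "colon_stable d b"
  show "colon_stable d a" unfolding colon_stable_def
  proof (intro allI impI)
    fix n p q assume H: "\<forall>k\<le>d. in_pow d a (Suc n) (d - k + p) (a k + q)"
    show "in_pow d a n p q"
    proof (cases "n * d \<le> p")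
      case True
      then show ?thesis by (rule in_pow_x[of a, OF a_0])
    next
      case False
      have le: "n * d \<le> p + q" using in_pow_transform[of "Suc n" "d + p" q] H a_0 by force
      have "in_pow d b (Suc n) (d - k + p) (b k + (p + q - n * d))" if "k \<le> d" for k
      proof -
        have "d - k + p + (a k + q) - Suc n * d = b k + (p + q - n * d)" using le that a_eq[OF that]
          by simp
        then show ?thesis using in_pow_transform[of "Suc n" "d - k + p" "a k + q"] H that by metis
      qed
      then have "in_pow d b n p (p + q - n * d)" using R unfolding colon_stable_def by blast
      from in_pow_transform_back[OF this] show ?thesis using False le by simp
    qed
  qed
next
  assume R: "colon_stable d a"
  show "colon_stable d b" unfolding colon_stable_def
  proof (intro allI impI)
    fix n p r assume H: "\<forall>k\<le>d. in_pow d b (Suc n) (d - k + p) (b k + r)"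
    show "in_pow d b n p r"
    proof (cases "n * d \<le> p")
      case True
      then show ?thesis by (rule in_pow_x[of b, OF T.b_0])
    next
      case False
      have "in_pow d a (Suc n) (d - k + p) (a k + (r + n * d - p))" if "k \<le> d" for k
      proof -
        have "b k + r + Suc n * d - (d - k + p) = a k + (r + n * d - p)"
          using False that a_eq[OF that] by simp
        then show ?thesis using in_pow_transform_back[of "Suc n" "d - k + p" "b k + r"] H that False
          by fastforce
      qed
      then have "in_pow d a n p (r + n * d - p)" using R unfolding colon_stable_def by blast
      from in_pow_transform[OF this] show ?thesis using False by simp
    qed
  qed
qed

lemma theta_pow: "G \<in> L.pw n \<Longrightarrow> \<exists>H\<in>T.pw n. theta G = mon 0 (n * d) * H"
proof -
  let ?P = "{G. \<exists>H\<in>T.pw n. theta G = mon 0 (n * d) * H}"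
  have "whole.idl ?P" unfolding whole.idl_def
  proof (intro conjI ballI)
    show "0 \<in> ?P" using whole.idl_zero[OF T.pw_idl] by (auto simp: theta_def intro!: bexI[of _ 0])
  next
    fix x y assume "x \<in> ?P" "y \<in> ?P"
    then obtain H H' where "H \<in> T.pw n" "H' \<in> T.pw n" "theta x = mon 0 (n * d) * H" "theta y
      = mon 0 (n * d) * H'" by blast
    then show "x + y \<in> ?P" using whole.idl_add[OF T.pw_idl, of H n H']
      by (intro CollectI bexI[of _ "H + H'"]) (simp_all add: theta_add distrib_left)
  next
    fix c x assume "x \<in> ?P"
    then obtain H where "H \<in> T.pw n" "theta x = mon 0 (n * d) * H" by blast
    then show "c * x \<in> ?P" using whole.idl_mult[OF T.pw_idl UNIV_I, of H n "theta c"]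
      by (intro CollectI bexI[of _ "theta c * H"]) (simp_all add: theta_mult mult.left_commute)
  qed simp
  then have "L.pw n \<subseteq> ?P" unfolding pow_stair[of d a]
  proof (rule mono_ideal_least)
    fix p q assume "in_pow d a n p q"
    from in_pow_transform[OF this] show "mon p q \<in> ?P"
      by (intro CollectI bexI[of _ "mon p (p + q - n * d)"]) (simp_all add: theta_mon mon_mult
        mon_pow_stair)
  qed
  then show "G \<in> L.pw n \<Longrightarrow> \<exists>H\<in>T.pw n. theta G = mon 0 (n * d) * H" by blast
qed

text \<open>Terms of x-degree at most n d are matched by the shear; the remaining ones are multiples
  of x^(n d).\<close>

lemma theta_pow_iff:
  assumes H: "H \<in> T.pw n" "theta G = mon 0 (n * d) * H" shows "G \<in> L.pw n"
  unfolding pow_stair mono_ideal_def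
proof (intro CollectI allI impI)
  fix p q assume "cf G p q \<noteq> 0"
  then have "cf (mon 0 (n * d) * H) p (p + q) \<noteq> 0" using cf_theta[of G p "p + q"] H(2) by simp
  then have le: "n * d \<le> p + q" and "cf H p (p + q - n * d) \<noteq> 0"
    by (auto simp: cf_mon_mult split: if_splits)
  then have m: "in_pow d b n p (p + q - n * d)" using H(1) unfolding pow_stair mono_ideal_def by blast
  show "in_pow d a n p q"
  proof (cases "n * d \<le> p")
    case False
    from in_pow_transform_back[OF m] show ?thesis using False le by simp
  qed (rule in_pow_x[of a, OF a_0])
qed

end

section \<open>Solving the reduction condition to high order\<close>

context staircase
begin

text \<open>Monomials of larger x-degree are multiples of x^(2 d). The bound on p is what keeps z^p
  y^(r + 2 d) a monomial in x and y.\<close>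

lemma reduction_le1I:
  assumes "\<And>p q. p \<le> Suc (Suc 0) * d \<Longrightarrow> in_pow d b (Suc (Suc 0)) p q \<Longrightarrow> \<exists>g\<in>I. \<exists>h\<in>I.
     mon p q - (F True * g + F False * h) \<in> pw (Suc (Suc (Suc 0)))"
  shows "reduction_le1 TYPE('k) d b"
proof -
  let ?P = "{u. \<exists>g\<in>I. \<exists>h\<in>I. u - (F True * g + F False * h) \<in> pw (Suc (Suc (Suc 0)))}"
  have P: "whole.idl ?P" unfolding whole.idl_def
  proof (intro conjI ballI)
    show "0 \<in> ?P" using whole.idl_zero[OF I] whole.idl_zero[OF pw_idl]
      by (intro CollectI bexI[of _ 0]) simp_all
  next
    fix x y assume "x \<in> ?P" "y \<in> ?P"
    then obtain g h g' h' where *: "g \<in> I" "h \<in> I" "g' \<in> I" "h' \<in> I"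
      "x - (F True * g + F False * h) \<in> pw (Suc (Suc (Suc 0)))"
      "y - (F True * g' + F False * h') \<in> pw (Suc (Suc (Suc 0)))" by blast
    have "x + y - (F True * (g + g') + F False * (h + h'))
      = (x - (F True * g + F False * h)) + (y - (F True * g' + F False *
        h'))" by (simp add: algebra_simps)
    then show "x + y \<in> ?P"
      using whole.idl_add[OF pw_idl *(5,6)] whole.idl_add[OF I *(1,3)] whole.idl_add[OF I *(2,4)]
      by (intro CollectI bexI[of _ "g + g'"] bexI[of _ "h + h'"]) (simp_all only:)
  next
    fix c x assume "x \<in> ?P"
    then obtain g h where *: "g \<in> I" "h \<in> I" "x - (F True * g + F False * h) \<in> pw (Suc (Suc (Suc 0)))"
      by blast
    have "c * x - (F True * (c * g) + F False * (c * h)) = c * (x - (F True * g + F False * h))"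
      by (simp add: algebra_simps)
    then show "c * x \<in> ?P"
      using whole.idl_mult[OF pw_idl UNIV_I *(3)] whole.idl_mult[OF I UNIV_I *(1)] whole.idl_mult[OF I
        UNIV_I *(2)]
      by (intro CollectI bexI[of _ "c * g"] bexI[of _ "c * h"]) (simp_all only:)
  qed simp
  have "pw (Suc (Suc 0)) \<subseteq> ?P" unfolding pow_stair[of d b "Suc (Suc 0)"]
  proof (rule mono_ideal_least[OF P])
    fix p q assume in_pow: "in_pow d b (Suc (Suc 0)) p q"
    show "mon p q \<in> ?P"
    proof (cases "p \<le> Suc (Suc 0) * d")
      case True
      then show ?thesis using assms[OF True in_pow] by blast
    next
      case False
      have "in_pow d b (Suc (Suc 0)) (Suc (Suc 0) * d) 0" by (rule in_pow_x[of b, OF b_0]) simp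
      then have "mon (Suc (Suc 0) * d) 0 \<in> ?P" using assms[OF order.refl] by blast
      then have "mon (p - Suc (Suc 0) * d) q * mon (Suc (Suc 0) * d) 0 \<in> ?P"
        by (rule whole.idl_mult[OF P UNIV_I])
      then show ?thesis using False
        by (simp only: mon_mult add_0_right le_add_diff_inverse2 nat_le_linear not_le less_imp_le)
    qed
  qed
  then show ?thesis unfolding reduction_le1_def by blast
qed

text \<open>At each step e times the error is absorbed into the cofactors, and the rest, 1 - e times
  the error, gains a power of I.\<close>

lemma reduction_le1_iterate:
  assumes "reduction_le1 TYPE('k) d b"
  shows "u \<in> pw (Suc (Suc 0)) \<Longrightarrow> \<exists>g\<in>pw (Suc 0). \<exists>h\<in>pw (Suc 0). u - (F True * g + F False * h)
    \<in> pw (Suc (Suc n))"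
proof (induction n)
  case 0
  then show ?case using whole.idl_zero[OF pw_idl] by (intro bexI[of _ 0]) simp_all
next
  case (Suc n)
  obtain g h where gh: "g \<in> pw (Suc 0)" "h \<in> pw (Suc 0)" "u - (F True * g + F False * h)
    \<in> pw (Suc (Suc n))"
    using Suc by blast
  let ?w = "u - (F True * g + F False * h)"
  obtain e where e: "1 - e \<in> I" and
    eJ: "\<And>n u. u \<in> pw (Suc (Suc n)) \<Longrightarrow> \<exists>g\<in>pw (Suc n). \<exists>h\<in>pw (Suc n). e * u = F True * g + F False * h"
    using reduction_le1_unit[OF assms] by blast
  obtain g' h' where gh': "g' \<in> pw (Suc n)" "h' \<in> pw (Suc n)" "e * ?w = F True * g' + F False * h'"
    using eJ[OF gh(3)] by blast
  have in1: "g' \<in> pw (Suc 0)" "h' \<in> pw (Suc 0)" using gh' ideal_pow_antimono[of "Suc 0" "Suc n" I]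
    by auto
  have "?w * (1 - e) \<in> pw (Suc (Suc (Suc n)))" by (rule ideal_pow_mult_Suc[OF gh(3) e])
  moreover have "u - (F True * (g + g') + F False * (h + h')) = ?w * (1 - e)"
  proof -
    have "u - (F True * (g + g') + F False * (h + h')) = ?w - e * ?w" unfolding gh'(3)
      by (simp add: algebra_simps)
    then show ?thesis by (simp add: algebra_simps)
  qed
  ultimately show ?case
    using whole.idl_add[OF pw_idl gh(1) in1(1)] whole.idl_add[OF pw_idl gh(2) in1(2)]
    by (intro bexI[of _ "g + g'"] bexI[of _ "h + h'"]) (simp_all only:)
qed

text \<open>Every other vertex of even rank is separated from 0 by a vertex, and strict convexity
  there forces a positive power of y, even if the first edge is horizontal.\<close>

lemma F_mod_y: "\<exists>\<eta>. mon d 0 = F True + mon 0 1 * \<eta>"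
proof -
  let ?S = "{k. k \<in> V \<and> col d b k = True}"
  have "F True = mon d 0 + (\<Sum>k\<in>?S - {0}. v k)"
    unfolding reduction_elt_def using zero_vertex col_zero b_0 finite_vertices
      by (subst sum.remove[of _ 0]) auto
  moreover have "v k = mon 0 1 * mon (d - k) (b k - 1)" if k: "k \<in> ?S - {0}" for k
  proof -
    have "b k \<noteq> 0"
    proof
      assume bk: "b k = 0"
      have "0 < k" "k \<in> V" "col d b 0 = col d b k" using k col_zero by auto
      then obtain i where i: "i \<in> V" "0 < i" "i < k" using col_between[OF zero_vertex] by blast
      then have "k * b i < i * b k" using verticesD[OF i(1), of 0 k] vertices_le[OF \<open>k \<in> V\<close>] b_0 by simp
      then show False using bk by simp
    qed
    then show ?thesis by (simp add: mon_mult)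
  qed
  then have "(\<Sum>k\<in>?S - {0}. v k) = mon 0 1 * (\<Sum>k\<in>?S - {0}. mon (d - k) (b k - 1))"
    by (simp add: sum_distrib_left)
  ultimately have "mon d 0 = F True + mon 0 1 * (- (\<Sum>k\<in>?S - {0}. mon (d - k) (b k - 1)))" by simp
  then show ?thesis by blast
qed

lemma x_power_mod: "\<exists>\<alpha> s. mon (M * d) 0 = F True * \<alpha> + mon 0 M * s"
proof (induction M)
  case 0
  show ?case by (intro exI[of _ 0] exI[of _ 1]) (simp add: mon_0_0)
next
  case (Suc M)
  then obtain \<alpha> s where as: "mon (M * d) 0 = F True * \<alpha> + mon 0 M * s" by blast
  obtain \<eta> where e: "mon d 0 = F True + mon 0 1 * \<eta>" using F_mod_y by blast
  have "mon (Suc M * d) 0 = mon d 0 * mon (M * d) 0" by (simp add: mon_mult)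
  also have "\<dots> = F True * (mon d 0 * \<alpha>) + mon 0 M * s * mon d 0" unfolding as
    by (simp add: algebra_simps)
  also have "mon 0 M * s * mon d 0 = F True * (mon 0 M * s) + mon 0 1 * mon 0 M * (s * \<eta>)" unfolding e
    by (simp add: algebra_simps)
  also have "F True * (mon d 0 * \<alpha>) + \<dots>
    = F True * (mon d 0 * \<alpha> + mon 0 M * s) + mon 0 (Suc M) * (s * \<eta>)"
    by (simp add: mon_mult algebra_simps)
  finally show ?case by blast
qed

lemma in_pow_total: "in_pow d b n p q \<Longrightarrow> n \<le> p + q"
proof (induction n arbitrary: p q)
  case (Suc n)
  from Suc.prems obtain k p' q' where k: "k \<le> d" "p = d - k + p'" "q = b k + q'" "in_pow d b n p' q'"
    by (rule in_pow_SucE)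
  then show ?case using Suc.IH[OF k(4)] v_pos[OF k(1)] by simp
qed simp

text \<open>A total degree of at least (M + 1) d + M forces divisibility by y^M or by x^((M + 1) d).
  In the second case M factors x^d are reduced modulo F True, and the extra one keeps the cofactor
  in I.\<close>

lemma high_power:
  assumes "w \<in> pw (Suc M * d + M)"
  shows "\<exists>w1\<in>pw (Suc 0). \<exists>s. w = F True * w1 + mon 0 M * s"
proof -
  let ?P = "{w. \<exists>w1\<in>pw (Suc 0). \<exists>s. w = F True * w1 + mon 0 M * s}"
  have P: "whole.idl ?P" unfolding whole.idl_def
  proof (intro conjI ballI)
    show "0 \<in> ?P" using whole.idl_zero[OF pw_idl] by (intro CollectI bexI[of _ 0] exI[of _ 0]) simp_all
  next
    fix x y assume "x \<in> ?P" "y \<in> ?P"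
    then obtain w s w' s' where *: "w \<in> pw (Suc 0)" "w' \<in> pw (Suc 0)" "x
      = F True * w + mon 0 M * s" "y = F True * w' + mon 0 M * s'" by blast
    have "x + y = F True * (w + w') + mon 0 M * (s + s')" unfolding * by (simp add: algebra_simps)
    then show "x + y \<in> ?P" using whole.idl_add[OF pw_idl *(1,2)] by blast
  next
    fix c x assume "x \<in> ?P"
    then obtain w s where *: "w \<in> pw (Suc 0)" "x = F True * w + mon 0 M * s" by blast
    have "c * x = F True * (c * w) + mon 0 M * (c * s)" unfolding * by (simp add: algebra_simps)
    then show "c * x \<in> ?P" using whole.idl_mult[OF pw_idl UNIV_I *(1)] by blast
  qed simp
  have "pw (Suc M * d + M) \<subseteq> ?P" unfolding pow_stair[of d b "Suc M * d + M"]
  proof (rule mono_ideal_least[OF P])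
    fix p q assume "in_pow d b (Suc M * d + M) p q"
    then have "Suc M * d + M \<le> p + q" by (rule in_pow_total)
    then consider "M \<le> q" | "Suc M * d \<le> p" by linarith
    then show "mon p q \<in> ?P"
    proof cases
      case 1
      then have "mon p q = F True * 0 + mon 0 M * mon p (q - M)" by (simp add: mon_mult)
      then show ?thesis using whole.idl_zero[OF pw_idl] by blast
    next
      case 2
      obtain \<alpha> s where as: "mon (M * d) 0 = F True * \<alpha> + mon 0 M * s" using x_power_mod by blast
      have "mon d 0 * mon (M * d) 0 = F True * (mon d 0 * \<alpha>) + mon 0 M * (mon d 0 * s)"
        unfolding as by (simp add: algebra_simps)
      moreover have "mon d 0 * \<alpha> \<in> pw (Suc 0)"
        using whole.idl_mult2[OF pw_idl UNIV_I, of "mon d 0" "Suc 0" \<alpha>] in_pow_x[of b "Suc 0" d d 0,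
          OF b_0]
        by (simp add: mon_pow_stair del: in_pow.simps)
      ultimately have "mon d 0 * mon (M * d) 0 \<in> ?P" by blast
      then have "mon (p - Suc M * d) q * (mon d 0 * mon (M * d) 0) \<in> ?P"
        by (rule whole.idl_mult[OF P UNIV_I])
      moreover have eq: "mon p q = mon (p - Suc M * d) q * (mon d 0 * mon (M * d) 0 :: 'k poly poly)"
        using 2 by (simp add: mon_mult)
      ultimately show ?thesis unfolding eq by blast
    qed
  qed
  then show ?thesis using assms by blast
qed

end

section \<open>Transfer of the reduction condition\<close>

context transform
begin

lemma reduction_le1_transform:
  assumes "reduction_le1 TYPE('k) d a" shows "reduction_le1 TYPE('k) d b"
proof (rule T.reduction_le1I)
  fix p r assume p: "p \<le> Suc (Suc 0) * d" and in_pow: "in_pow d b (Suc (Suc 0)) p r"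
  define q where "q = r + Suc (Suc 0) * d - p"
  have "mon p q \<in> L.pw (Suc (Suc 0))" unfolding mon_pow_stair q_def
    by (rule in_pow_transform_back[OF in_pow p])
  then obtain g h where gh: "g \<in> L.I" "h \<in> L.I"
    and w: "mon p q - (L.F True * g + L.F False * h) \<in> L.pw (Suc (Suc (Suc 0)))"
    using assms unfolding reduction_le1_def by blast
  obtain g' where g': "g' \<in> T.I" "theta g = mon 0 d * g'" using theta_pow[of g "Suc 0"] gh(1)
    by (auto simp: L.pw_1 T.pw_1)
  obtain h' where h': "h' \<in> T.I" "theta h = mon 0 d * h'" using theta_pow[of h "Suc 0"] gh(2)
    by (auto simp: L.pw_1 T.pw_1)
  obtain w' where w': "w' \<in> T.pw (Suc (Suc (Suc 0)))"
    "theta (mon p q - (L.F True * g + L.F False * h)) = mon 0 (Suc (Suc (Suc 0)) * d) * w'"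
      using theta_pow[OF w] by blast
  have y2: "mon 0 (Suc (Suc 0) * d) = (mon 0 d * mon 0 d :: 'k poly poly)"
    and y3: "mon 0 (Suc (Suc (Suc 0)) * d) = (mon 0 d * mon 0 d * mon 0 d :: 'k poly poly)"
    by (simp_all add: mon_mult add_ac)
  have "mon 0 (Suc (Suc 0) * d) * mon p r = theta (mon p q)" using p
    by (simp add: theta_mon mon_mult q_def add_ac)
  also have "\<dots> = theta (mon p q - (L.F True * g + L.F False * h)) + theta (L.F True * g + L.F False *
    h)"
    by (simp add: theta_diff)
  also have "\<dots> = mon 0 (Suc (Suc 0) * d) * (mon 0 d * w' + (T.F True * g' + T.F False * h'))"
    unfolding w'(2) theta_add theta_mult g' h' theta_reduction_elt y2 y3 by (simp add: algebra_simps)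
  finally have "mon p r = mon 0 d * w' + (T.F True * g' + T.F False * h')" by (simp add: mon_def)
  then have "mon p r - (T.F True * g' + T.F False * h') = mon 0 d * w'" by simp
  then show "\<exists>g\<in>T.I. \<exists>h\<in>T.I. mon p r - (T.F True * g + T.F False * h) \<in> T.pw (Suc (Suc (Suc 0)))"
    using g'(1) h'(1) whole.idl_mult[OF T.pw_idl UNIV_I w'(1)] by (metis (no_types, lifting))
qed

text \<open>An equation \<open>x^p y^r = F1 G + F2 h + w\<close> over the transform lifts to the original ring once \<open>h\<close> and \<open>w\<close>
  have small degree in \<open>x\<close>, which division by the monic \<open>F1\<close> achieves, and \<open>w\<close> is divisible by a high power
  of \<open>y\<close>, because \<open>F1\<close> is \<open>x^d\<close> modulo \<open>y\<close>. The factor \<open>G\<close> then lifts automatically.\<close>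

lemma reduction_le1_transform_back:
  assumes R: "reduction_le1 TYPE('k) d b" shows "reduction_le1 TYPE('k) d a"
proof (rule L.reduction_le1I)
  fix p q assume p: "p \<le> Suc (Suc 0) * d" and in_pow: "in_pow d a (Suc (Suc 0)) p q"
  define r where "r = p + q - Suc (Suc 0) * d"
  have r: "Suc (Suc 0) * d \<le> p + q" "in_pow d b (Suc (Suc 0)) p r" using in_pow_transform[OF in_pow]
    by (auto simp: r_def)
  \<comment> \<open>Of the powers of y, 3 b d put the error into T^3, and d supply the surplus
    factor by which y^(3 d) in the cubic term exceeds the common y^(2 d).\<close>
  define M where "M = Suc (Suc (Suc 0)) * b d + d"
  have "mon p r \<in> T.pw (Suc (Suc 0))" using r by (simp only: mon_pow_stair)
  from T.reduction_le1_iterate[OF R this, of "Suc M * d + M"] obtain g h where gh: "g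
    \<in> T.pw (Suc 0)" "h \<in> T.pw (Suc 0)" and
    "mon p r - (T.F True * g + T.F False * h) \<in> T.pw (Suc (Suc (Suc M * d + M)))" by blast
  from T.pw_Suc[OF T.pw_Suc[OF this(3)]] obtain w s where w: "w \<in> T.pw (Suc 0)"
    and ws: "mon p r - (T.F True * g + T.F False * h) = T.F True * w + mon 0 M * s"
    using T.high_power by blast
  \<comment> \<open>The quotients of both divisions go into G, which leaves h' and \<rho> of
    z-degree below d.\<close>
  obtain s1 \<rho> where s1: "s = T.F True * s1 + \<rho>" "degree \<rho> < d"
    using monic_division[OF T.degree_F T.coeff_F_d d_pos] by blast
  obtain h1 h' where h1: "h = T.F True * h1 + h'" "degree h' < d"
    using monic_division[OF T.degree_F T.coeff_F_d d_pos] by blast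
  have "h' = h - T.F True * h1" using h1 by simp
  then have h'pw: "h' \<in> T.pw (Suc 0)"
    using whole.idl_diff[OF T.pw_idl gh(2) whole.idl_mult2[OF T.pw_idl UNIV_I]] reduction_elt_in_stair
      T.pw_1 by metis
  have yM: "mon 0 M * s1 \<in> T.pw (Suc 0)"
    using in_pow_y[of "Suc 0" b d M 0]
      by (intro whole.idl_mult2[OF T.pw_idl UNIV_I]) (simp add: mon_pow_stair M_def del: in_pow.simps)
  define G where "G = g + w + mon 0 M * s1 + T.F False * h1"
  have "T.F False * h1 \<in> T.pw (Suc 0)"
    using whole.idl_mult2[OF T.pw_idl UNIV_I] reduction_elt_in_stair T.pw_1 by metis
  then have G: "G \<in> T.pw (Suc 0)" unfolding G_def by (intro whole.idl_add[OF T.pw_idl] gh(1) w yM)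
  define \<rho>' where "\<rho>' = mon 0 (Suc (Suc (Suc 0)) * b d) * \<rho>"
  have \<rho>': "\<rho>' \<in> T.pw (Suc (Suc (Suc 0)))" unfolding \<rho>'_def
    by (rule whole.idl_mult2[OF T.pw_idl UNIV_I]) (simp add: mon_pow_stair in_pow_y del: in_pow.simps)
  have yM': "mon 0 M * \<rho> = mon 0 d * \<rho>'" unfolding \<rho>'_def M_def
    by (simp add: mon_mult add_ac flip: mult.assoc)
  have eq: "mon p r = T.F True * G + T.F False * h' + mon 0 d * \<rho>'"
  proof -
    have "mon p r = T.F True * g + T.F False * h + T.F True * w + mon 0 M * s" using ws
      by (simp add: algebra_simps)
    then show ?thesis unfolding s1(1) h1(1) G_def yM'[symmetric] by (simp add: algebra_simps)
  qed
  obtain hL where hL: "theta hL = mon 0 d * h'" using theta_lift[of d h'] h1(2) coeff_eq_0[of h']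
    by auto
  have "coeff \<rho>' p' = 0" if "Suc (Suc (Suc 0)) * d < p'" for p'
    using s1(2) that by (simp add: \<rho>'_def mon_def coeff_monom_mult coeff_eq_0)
  then obtain \<rho>L where \<rho>L: "theta \<rho>L = mon 0 (Suc (Suc (Suc 0)) * d) * \<rho>'" using theta_lift by blast
  have hLI: "hL \<in> L.I" using theta_pow_iff[of h' "Suc 0" hL] h'pw hL L.pw_1 by simp
  have \<rho>LI: "\<rho>L \<in> L.pw (Suc (Suc (Suc 0)))" using theta_pow_iff[OF \<rho>' \<rho>L] .
  define u where "u = mon p q - L.F False * hL - \<rho>L"
  have y3: "mon 0 (Suc (Suc (Suc 0)) * d) = (mon 0 d * mon 0 d * mon 0 d :: 'k poly poly)"
    by (simp add: mon_mult add_ac)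
  have "theta (mon p q) = (mon 0 d * mon 0 d * mon p r :: 'k poly poly)" using r(1)
    by (simp add: theta_mon mon_mult r_def)
  then have "theta (mon p q) = mon 0 d * mon 0 d * (T.F True * G + T.F False * h' + mon 0 d * \<rho>')"
    by (simp only: eq)
  then have tu: "theta u = theta (L.F True) * (mon 0 d * G)"
    unfolding u_def theta_diff theta_mult hL \<rho>L theta_reduction_elt y3 by (simp add: algebra_simps)
  obtain u1 \<tau> where u1: "u = L.F True * u1 + \<tau>" "degree \<tau> < d"
    using monic_division[OF L.degree_F L.coeff_F_d d_pos] by blast
  \<comment> \<open>The product of D with the image of F True equals the image of \<tau>, of
    z-degree below d, while that image has z-degree at least d. Hence D and \<tau> vanish and y^d G
    comes from the polynomial u1.\<close>
  let ?D = "mon 0 d * G - theta u1"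
  have D: "theta (L.F True) * ?D = theta \<tau>" using tu unfolding u1(1) theta_add theta_mult
    by (simp add: algebra_simps)
  have "?D = 0"
  proof (rule ccontr)
    assume nz: "?D \<noteq> 0"
    have nzF: "theta (L.F True) \<noteq> 0" using theta_eq_0 L.F_nonzero by blast
    have "d \<le> degree (theta (L.F True))" by (rule le_degree) (simp add: coeff_theta L.coeff_F_d)
    also have "\<dots> \<le> degree (theta \<tau>)" unfolding D[symmetric] using degree_mult_eq[OF nzF nz] by simp
    also have "\<dots> \<le> degree \<tau>" by (rule degree_le) (simp add: coeff_theta coeff_eq_0)
    finally show False using u1(2) by simp
  qed
  then have "\<tau> = 0" and u1G: "theta u1 = mon 0 d * G" using D theta_eq_0[of \<tau>] by simp_all
  then have "mon p q - (L.F True * u1 + L.F False * hL) = \<rho>L" using u1(1) unfolding u_def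
    by (simp add: algebra_simps)
  moreover have "u1 \<in> L.I" using theta_pow_iff[OF G] u1G L.pw_1 by simp
  ultimately show "\<exists>g\<in>L.I. \<exists>h\<in>L.I. mon p q - (L.F True * g + L.F False * h) \<in> L.pw (Suc (Suc (Suc 0)))"
    using hLI \<rho>LI by (metis (no_types, lifting))
qed

theorem depth_transform: "depth_gr L.m (stair_ideal d a :: 'k poly poly set)
  = depth_gr L.m (stair_ideal d b)"
  using L.depth_formula T.depth_formula colon_stable_iff reduction_le1_transform
    reduction_le1_transform_back by metis

end

theorem theorem4p4:
  fixes d :: nat and a :: "nat \<Rightarrow> nat"
  assumes "a 0 = 0"
    and "\<forall>i<d. a i < a (Suc i)"
    and "a d > d"
  shows "depth_gr (ideal_gen {var_out, var_in} :: ('k::{alg_closed_field, field_char_0}) poly poly set)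
            (ideal_gen {var_out ^ (d - i) * var_in ^ (a i) | i. i \<le> d})
       = depth_gr (ideal_gen {var_out, var_in} :: 'k poly poly set)
            (ideal_gen {var_out ^ (d - i) * var_in ^ (a i - i) | i. i \<le> d})"
proof -
  interpret transform d a "TYPE('k)" by unfold_locales (use assms in auto)
  show ?thesis
    unfolding var_mon unfolding var_out_mon var_in_mon
    using depth_transform unfolding stair_ideal_def b_def .
qed

end
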